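(* Fix $(\zeta,\eta)\in\Lambda\times\Xi$ and assume hypotheses H(A), H(B), H(F), H(G), H(W), H($\ell$) and H($\varphi$) spelled out in the context. Then there exists $w^*\in\mathcal W_{ad}$ such that $$m_{\zeta,\eta}(w^* )+\mathcal R(w^* )=\inf_{w\in\mathcal W_{ad}}\{m_{\zeta,\eta}(w)+\mathcal R(w)\}.$$
   Context: **Setting.** $E,H,Y$ are real separable Hilbert spaces with norms $\|\cdot\|_E,\|\cdot\|,\|\cdot\|_Y$ ($\langle\cdot,\cdot\rangle$ is the inner product of $H$), $I=[0,b]$ with $b>0$, $(\Lambda,d_\Lambda)$ and $(\Xi,d_\Xi)$ are metric spaces, $\Lambda\times\Xi$ has the product metric. Spaces $C(I,\cdot)$ carry the sup norm. $\operatorname{Haus}$ is the Hausdorff metric between sets; for a set $S$ in a normed space $\|S\|:=\sup_{s\in S}\|s\|$. A multifunction $\Phi$ on $I$ is measurable if $\{t:\Phi(t)\subset O\}$ is Lebesgue measurable for every open $O$. A set $S\subset H$ is ball-relatively compact if its intersection with every closed ball centered at $0$ is relatively compact. For a maximal monotone $B:D(B)\subset H\rightrightarrows H$, $B^0(v)$ is the minimal-norm element of $B(v)$. The pseudo-distance of maximal monotone operators is $$\operatorname{dis}(B_1,B_2)=\sup\Big\{\tfrac{\langle y-y',x'-x\rangle}{1+\|y\|+\|y'\|}: x\in D(B_1),y\in B_1(x),x'\in D(B_2),y'\in B_2(x')\Big\}\in[0,\infty].$$ **Data.** Linear operators $A_\zeta:D(A_\zeta)\subset E\to E$ ($\zeta\in\Lambda$);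 maximal monotone operators $B(t,u,\eta):D(B(t,u,\eta))\subset H\rightrightarrows H$ ($(t,u,\eta)\in I\times H\times\Xi$); multifunctions $F:I\times E\times H\times\Lambda\rightrightarrows E$, $G:I\times E\times H\times\Xi\rightrightarrows H$, $W:I\rightrightarrows Y$; a bounded linear operator $\mathcal B:Y\to E$; maps $x_0:\Lambda\to E$, $u_0:\Xi\to H$ with $u_0(\eta)\in D(B(0,u_0(\eta),\eta))$; functions $\ell:I\times E\times H\times\Lambda\times\Xi\to\mathbb R$, $\varphi:E\times H\times\Lambda\times\Xi\to\mathbb R$. **H(A).** Each $A_\zeta$ generates a $C_0$-semigroup $\{T_\zeta(t)\}_{t\ge0}$ on $E$ with $T_\zeta(t)$ compact for all $t>0$; for every bounded $D\subset\Lambda$ there is $M_D>0$ with $\sup_{t\in I}\|T_\zeta(t)\|_{\mathcal L(E)}\le M_D$ for all $\zeta\in D$; whenever $\zeta_n\to\zeta$, $\sup_{t\in I}\|T_{\zeta_n}(t)x-T_\zeta(t)x\|_E\to0$ for every $x\in E$, and $\sup_{t\in[\delta,b]}\|T_{\zeta_n}(t)-T_\zeta(t)\|_{\mathcal L(E)}\to0$ for every $0<\delta<b$. **H(B).** (i) There are $\theta\in W^{1,2}(I,\mathbb R)$, $\lambda\in[0,1)$, $\lambda'>0$ with $\operatorname{dis}(B(t,u,\eta_1),B(s,v,\eta_2))\le|\theta(t)-\theta(s)|+\lambda\|u-v\|+\lambda' d_\Xi(\eta_1,\eta_2)$ for all $t,s\in I$, $u,v\in H$, $\eta_1,\eta_2\in\Xi$.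 (ii) There is $M_B>0$ with $\|B^0(t,u,\eta)v\|\le M_B(1+\|u\|+\|v\|)$ for all $t\in I$, $u\in H$, $\eta\in\Xi$, $v\in D(B(t,u,\eta))$. (iii) For every bounded $\Omega\subset H\times\Xi$, $\bigcup_{t\in I,(u,\eta)\in\Omega}D(B(t,u,\eta))$ is ball-relatively compact in $H$. (iv) For every bounded $D\subset\Xi$ and $r>0$ there is $\varrho_D\in L^1(I,\mathbb R_+)$ with $\langle v_1-v_2,u_1-u_2\rangle\ge-\varrho_D(t)\|u_1-u_2\|^2$ for all $t\in I$, $\|u_1\|,\|u_2\|\le r$, $\eta_1,\eta_2\in D$, $v_i\in B(t,u_i,\eta_i)(u_i)$. **H(F).** $F$ has nonempty weakly compact convex values and: (i) $t\mapsto F(t,x,u,\zeta)$ is measurable for all $(x,u,\zeta)$; (ii) for every bounded $D\subset\Lambda$ there is $k_D\in L^1(I,\mathbb R_+)$ with $\operatorname{Haus}(F(t,x,u,\zeta),F(t,y,v,\zeta))\le k_D(t)(\|x-y\|_E+\|u-v\|)$ for all $(x,u),(y,v)$, $\zeta\in D$, a.e. $t$; (iii) for every bounded $D\subset\Lambda$ there is $M_F>0$ with $\|F(t,x,u,\zeta)\|_E\le M_F(1+\|x\|_E+\|u\|)$ for a.e. $t$ and all $(x,u,\zeta)\in E\times H\times D$; (iv) $\operatorname{Haus}(F(t,x,u,\zeta_1),F(t,x,u,\zeta_2))\le\gamma_1(d_\Lambda(\zeta_1,\zeta_2))\rho_1(t,\|x\|_E,\|u\|)$ for all $(x,u)$,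 $\zeta_1,\zeta_2$, a.e. $t$, where $\gamma_1(r)\to0$ as $r\to0^+$ and for every bounded $S\subset L^2(I,E)\times L^2(I,H)$ there is $\omega_S\in L^1(I,\mathbb R_+)$ with $\rho_1(t,\|x(t)\|_E,\|u(t)\|)\le\omega_S(t)$ for a.e. $t$ and all $(x,u)\in S$. **H(G).** $G$ has nonempty weakly compact convex values and: (i) $t\mapsto G(t,x,u,\eta)$ is measurable; (ii) for every bounded $D\subset\Xi$ there is $l_D\in L^1(I,\mathbb R_+)$ with $\operatorname{Haus}(G(t,x,u,\eta),G(t,y,v,\eta))\le l_D(t)(\|x-y\|_E+\|u-v\|)$ for all $(x,u),(y,v)$, $\eta\in D$, a.e. $t$; (iii) for every bounded $D\subset\Xi$ there is $M_G>0$ with $\|G(t,x,u,\eta)\|\le M_G(1+\|x\|_E+\|u\|)$ for a.e. $t$ and all $(x,u,\eta)\in E\times H\times D$; (iv) $\operatorname{Haus}(G(t,x,u,\eta_1),G(t,x,u,\eta_2))\le\gamma_2(d_\Xi(\eta_1,\eta_2))\rho_2(t,\|x\|_E,\|u\|)$ for all $(x,u)$, $\eta_1,\eta_2$, a.e. $t$, where $\gamma_2(r)\to0$ as $r\to0^+$ and for every bounded $Q\subset C(I,E)\times C(I,H)$ there is $\omega_Q\in L^1(I,\mathbb R_+)$ with $\rho_2(t,\|x(t)\|_E,\|u(t)\|)\le\omega_Q(t)$ for a.e. $t$ and all $(x,u)\in Q$. **H(W).** $W$ is measurable with nonempty closed convex values, and there is $\phi_W\in L^2(I,\mathbb R_+)$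 with $\sup_{v\in W(t)}\|v\|_Y\le\phi_W(t)$ for a.e. $t$. **H($\ell$).** (i) $t\mapsto\ell(t,x,u,\zeta,\eta)$ is measurable for all $(x,u,\zeta,\eta)$. (ii) For a.e. $t$, all $x,y\in E$ and all $(u,\zeta,\eta)$, $|\ell(t,x,u,\zeta,\eta)-\ell(t,y,u,\zeta,\eta)|\le(1+\max\{\|x\|_E,\|y\|_E\})\,\kappa(t,\|x-y\|_E)$, where $\kappa:I\times\mathbb R_+\to\mathbb R_+$ is Carath\'eodory, $\kappa(t,0)=0$ for a.e. $t$, and for each $R>0$ there is $\beta_R\in L^1(I,\mathbb R_+)$ with $\sup_{0\le r\le R}\kappa(t,r)\le\beta_R(t)$ for a.e. $t$. (iii) For a.e. $t$ and all $(x,\zeta,\eta)$, $u\mapsto\ell(t,x,u,\zeta,\eta)$ is convex. (iv) For every bounded $D\subset\Lambda\times\Xi$ there is $\vartheta_D\in L^1(I,\mathbb R_+)$ with $|\ell(t,0,u,\zeta,\eta)|\le\vartheta_D(t)(1+\|u\|)$ for a.e. $t$, all $u\in H$, $(\zeta,\eta)\in D$. (v) For a.e. $t$, $(x,u,\zeta,\eta)\mapsto\ell(t,x,u,\zeta,\eta)$ is continuous. **H($\varphi$).** $\varphi$ is continuous. **Controls and controlled solution sets.** $\mathcal W_{ad}=\{w\in L^2(I,Y):w(t)\in W(t)\text{ for a.e. }t\in I\}$. For $w\in\mathcal W_{ad}$, $\mathcal S_{\zeta,\eta}(w)$ is the set of mild solutions of $\dot x\in A_\zeta x+F(t,x,u,\zeta)+\mathcal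 Bw(t)$, $\dot u\in-B(t,u,\eta)(u)+G(t,x,u,\eta)$, $x(0)=x_0(\zeta)$, $u(0)=u_0(\eta)$, i.e. pairs $(x,u)\in C(I,E)\times W^{1,2}(I,H)$ with $u(0)=u_0(\eta)$ for which there are integrable $f:I\to E$, $g:I\to H$ such that, for a.e. $t\in I$, $f(t)\in F(t,x(t),u(t),\zeta)$, $g(t)\in G(t,x(t),u(t),\eta)$, $-\dot u(t)+g(t)\in B(t,u(t),\eta)(u(t))$ (in particular $u(t)\in D(B(t,u(t),\eta))$), and for all $t\in I$, $x(t)=T_\zeta(t)x_0(\zeta)+\int_0^tT_\zeta(t-s)(f(s)+\mathcal Bw(s))\,ds$. **Costs.** $\mathcal J_{\zeta,\eta}(x,u)=\int_0^b\ell(t,x(t),u(t),\zeta,\eta)\,dt+\varphi(x(b),u(b),\zeta,\eta)$; $m_{\zeta,\eta}(w)=\inf_{(x,u)\in\mathcal S_{\zeta,\eta}(w)}\mathcal J_{\zeta,\eta}(x,u)$; $\mathcal R(w)=\frac12\int_0^b\|w(t)\|_Y^2\,dt$. *)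

theory Defs
  imports "HOL-Analysis.Analysis"
begin

text \<open>
  Conventions.  The time interval is \<^term>\<open>{0..b}\<close>; functions on it are total functions on the reals
  whose values outside \<^term>\<open>{0..b}\<close> are never used, and elements of Lebesgue spaces are represented by
  functions (not by classes).  Suprema, infima and set distances that may be infinite are taken in
  \<^typ>\<open>ereal\<close>.  In a condition that holds for a.e. t and for all values of other variables, the
  exceptional null set does not depend on those variables, except in the integral bound on the
  modulus inside \<open>HF\<close>, where the variables range over elements of Lebesgue spaces.
\<close>

subsection \<open>Function spaces on the interval\<close>

abbreviation leb :: "real \<Rightarrow> real measure" where
  "leb b \<equiv> lebesgue_on {0..b}"

definition L1_nonneg :: "real \<Rightarrow> (real \<Rightarrow> real) \<Rightarrow> bool" where
  "L1_nonneg b k \<longleftrightarrow> integrable (leb b) k \<and> (\<forall>t\<in>{0..b}. 0 \<le> k t)"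

definition in_L2 :: "real \<Rightarrow> (real \<Rightarrow> 'a::{real_normed_vector, second_countable_topology}) \<Rightarrow> bool" where
  "in_L2 b w \<longleftrightarrow> w \<in> borel_measurable (leb b) \<and> integrable (leb b) (\<lambda>t. (norm (w t))\<^sup>2)"

definition L2_norm :: "real \<Rightarrow> (real \<Rightarrow> 'a::real_normed_vector) \<Rightarrow> real" where
  "L2_norm b w = sqrt (\<integral>t. (norm (w t))\<^sup>2 \<partial>leb b)"

text \<open>
  An element of $W^{1,2}$, always taken as its continuous representative, is the primitive of its
  derivative \<open>v\<close>, which is square integrable and determined up to a null set.
\<close>

definition has_W12_derivative ::
    "real \<Rightarrow> (real \<Rightarrow> 'a::{banach, second_countable_topology}) \<Rightarrow> (real \<Rightarrow> 'a) \<Rightarrow> bool" where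
  "has_W12_derivative b u v \<longleftrightarrow>
     in_L2 b v \<and> (\<forall>t\<in>{0..b}. u t = u 0 + (\<integral>s. v s \<partial>lebesgue_on {0..t}))"

definition in_W12 :: "real \<Rightarrow> (real \<Rightarrow> 'a::{banach, second_countable_topology}) \<Rightarrow> bool" where
  "in_W12 b u \<longleftrightarrow> (\<exists>v. has_W12_derivative b u v)"

definition bounded_in_L2 ::
    "real \<Rightarrow> ((real \<Rightarrow> 'e::{real_normed_vector, second_countable_topology})
      \<times> (real \<Rightarrow> 'h::{real_normed_vector, second_countable_topology})) set \<Rightarrow> bool" where
  "bounded_in_L2 b S \<longleftrightarrow>
     (\<forall>(x, u)\<in>S. in_L2 b x \<and> in_L2 b u) \<and>
     (\<exists>R. \<forall>(x, u)\<in>S. L2_norm b x \<le> R \<and> L2_norm b u \<le> R)"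

definition bounded_in_C ::
    "real \<Rightarrow> ((real \<Rightarrow> 'e::real_normed_vector) \<times> (real \<Rightarrow> 'h::real_normed_vector)) set \<Rightarrow> bool" where
  "bounded_in_C b Q \<longleftrightarrow>
     (\<forall>(x, u)\<in>Q. continuous_on {0..b} x \<and> continuous_on {0..b} u) \<and>
     (\<exists>R. \<forall>(x, u)\<in>Q. \<forall>t\<in>{0..b}. norm (x t) \<le> R \<and> norm (u t) \<le> R)"


subsection \<open>Sets and multifunctions\<close>

definition Haus :: "'a::metric_space set \<Rightarrow> 'a set \<Rightarrow> ereal" where
  "Haus A B = max (SUP a\<in>A. ereal (infdist a B)) (SUP b\<in>B. ereal (infdist b A))"

definition set_norm :: "'a::real_normed_vector set \<Rightarrow> ereal" where
  "set_norm S = (SUP s\<in>S. ereal (norm s))"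

definition weak_topology :: "'a::real_normed_vector topology" where
  "weak_topology = pullback_topology UNIV (\<lambda>x (f :: 'a \<Rightarrow>\<^sub>L real). blinfun_apply f x) euclidean"

definition measurable_multi :: "real \<Rightarrow> (real \<Rightarrow> 'a::topological_space set) \<Rightarrow> bool" where
  "measurable_multi b \<Phi> \<longleftrightarrow> (\<forall>U. open U \<longrightarrow> {t\<in>{0..b}. \<Phi> t \<subseteq> U} \<in> sets lebesgue)"

definition relatively_compact :: "'a::topological_space set \<Rightarrow> bool" where
  "relatively_compact S \<longleftrightarrow> compact (closure S)"

definition ball_relatively_compact :: "'a::real_normed_vector set \<Rightarrow> bool" where
  "ball_relatively_compact S \<longleftrightarrow> (\<forall>r. relatively_compact (S \<inter> cball 0 r))"


subsection \<open>Semigroups\<close>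

definition linear_operator_on :: "'a::real_vector set \<Rightarrow> ('a \<Rightarrow> 'a) \<Rightarrow> bool" where
  "linear_operator_on D A \<longleftrightarrow> subspace D \<and>
     (\<forall>x\<in>D. \<forall>y\<in>D. A (x + y) = A x + A y) \<and> (\<forall>c. \<forall>x\<in>D. A (c *\<^sub>R x) = c *\<^sub>R A x)"

definition C0_semigroup :: "(real \<Rightarrow> 'a::real_normed_vector \<Rightarrow>\<^sub>L 'a) \<Rightarrow> bool" where
  "C0_semigroup T \<longleftrightarrow> T 0 = id_blinfun \<and>
     (\<forall>s\<ge>0. \<forall>t\<ge>0. T (s + t) = T s o\<^sub>L T t) \<and>
     (\<forall>x. ((\<lambda>t. blinfun_apply (T t) x) \<longlongrightarrow> x) (at_right 0))"

definition generates ::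
    "'a::real_normed_vector set \<Rightarrow> ('a \<Rightarrow> 'a) \<Rightarrow> (real \<Rightarrow> 'a \<Rightarrow>\<^sub>L 'a) \<Rightarrow> bool" where
  "generates D A T \<longleftrightarrow> C0_semigroup T \<and>
     D = {x. \<exists>y. ((\<lambda>h. (1 / h) *\<^sub>R (blinfun_apply (T h) x - x)) \<longlongrightarrow> y) (at_right 0)} \<and>
     (\<forall>x\<in>D. ((\<lambda>h. (1 / h) *\<^sub>R (blinfun_apply (T h) x - x)) \<longlongrightarrow> A x) (at_right 0))"

definition compact_operator :: "('a::real_normed_vector \<Rightarrow>\<^sub>L 'b::real_normed_vector) \<Rightarrow> bool" where
  "compact_operator K \<longleftrightarrow> (\<forall>S. bounded S \<longrightarrow> relatively_compact (blinfun_apply K ` S))"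


subsection \<open>Maximal monotone operators\<close>

definition op_dom :: "('a \<Rightarrow> 'b set) \<Rightarrow> 'a set" where
  "op_dom B = {x. B x \<noteq> {}}"

definition monotone_operator :: "('h::real_inner \<Rightarrow> 'h set) \<Rightarrow> bool" where
  "monotone_operator B \<longleftrightarrow> (\<forall>x x'. \<forall>y\<in>B x. \<forall>y'\<in>B x'. 0 \<le> (y - y') \<bullet> (x - x'))"

definition maximal_monotone :: "('h::real_inner \<Rightarrow> 'h set) \<Rightarrow> bool" where
  "maximal_monotone B \<longleftrightarrow> monotone_operator B \<and>
     (\<forall>C. monotone_operator C \<and> (\<forall>x. B x \<subseteq> C x) \<longrightarrow> C = B)"

definition minimal_section :: "('h::real_inner \<Rightarrow> 'h set) \<Rightarrow> 'h \<Rightarrow> 'h" where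
  "minimal_section B v = (THE y. y \<in> B v \<and> (\<forall>z\<in>B v. norm y \<le> norm z))"

definition dis :: "('h::real_inner \<Rightarrow> 'h set) \<Rightarrow> ('h \<Rightarrow> 'h set) \<Rightarrow> ereal" where
  "dis B1 B2 = Sup {ereal (((y - y') \<bullet> (x' - x)) / (1 + norm y + norm y')) | x y x' y'.
     x \<in> op_dom B1 \<and> y \<in> B1 x \<and> x' \<in> op_dom B2 \<and> y' \<in> B2 x'}"


subsection \<open>Hypotheses\<close>

definition HA ::
    "real \<Rightarrow> ('l::metric_space \<Rightarrow> 'e::{real_inner, banach, second_countable_topology} set) \<Rightarrow>
     ('l \<Rightarrow> 'e \<Rightarrow> 'e) \<Rightarrow> ('l \<Rightarrow> real \<Rightarrow> 'e \<Rightarrow>\<^sub>L 'e) \<Rightarrow> bool" where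
  "HA b domA A T \<longleftrightarrow>
     (\<forall>\<zeta>. generates (domA \<zeta>) (A \<zeta>) (T \<zeta>) \<and> (\<forall>t>0. compact_operator (T \<zeta> t))) \<and>
     (\<forall>D. bounded D \<longrightarrow> (\<exists>M>0. \<forall>\<zeta>\<in>D. \<forall>t\<in>{0..b}. norm (T \<zeta> t) \<le> M)) \<and>
     (\<forall>\<zeta>s \<zeta>. \<zeta>s \<longlonglongrightarrow> \<zeta> \<longrightarrow>
        (\<forall>x. uniform_limit {0..b} (\<lambda>n t. blinfun_apply (T (\<zeta>s n) t) x)
               (\<lambda>t. blinfun_apply (T \<zeta> t) x) sequentially) \<and>
        (\<forall>\<delta>. 0 < \<delta> \<and> \<delta> < b \<longrightarrow>
           uniform_limit {\<delta>..b} (\<lambda>n t. T (\<zeta>s n) t) (\<lambda>t. T \<zeta> t) sequentially))"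

definition HB ::
    "real \<Rightarrow> (real \<Rightarrow> 'h::{real_inner, banach, second_countable_topology} \<Rightarrow> 'k::metric_space \<Rightarrow>
       'h \<Rightarrow> 'h set) \<Rightarrow> bool" where
  "HB b B \<longleftrightarrow>
     (\<exists>(\<theta> :: real \<Rightarrow> real) (lam :: real) (lam' :: real).
        in_W12 b \<theta> \<and> 0 \<le> lam \<and> lam < 1 \<and> 0 < lam' \<and>
        (\<forall>t\<in>{0..b}. \<forall>s\<in>{0..b}. \<forall>u v \<eta>1 \<eta>2.
           dis (B t u \<eta>1) (B s v \<eta>2)
             \<le> ereal (\<bar>\<theta> t - \<theta> s\<bar> + lam * norm (u - v) + lam' * dist \<eta>1 \<eta>2))) \<and>
     (\<exists>M>0. \<forall>t\<in>{0..b}. \<forall>u \<eta>. \<forall>v\<in>op_dom (B t u \<eta>).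
        norm (minimal_section (B t u \<eta>) v) \<le> M * (1 + norm u + norm v)) \<and>
     (\<forall>\<Omega>. bounded \<Omega> \<longrightarrow>
        ball_relatively_compact (\<Union>t\<in>{0..b}. \<Union>(u, \<eta>)\<in>\<Omega>. op_dom (B t u \<eta>))) \<and>
     (\<forall>D. bounded D \<longrightarrow> (\<forall>r>0. \<exists>\<rho>. L1_nonneg b \<rho> \<and>
        (\<forall>t\<in>{0..b}. \<forall>u1 u2. \<forall>\<eta>1\<in>D. \<forall>\<eta>2\<in>D. norm u1 \<le> r \<and> norm u2 \<le> r \<longrightarrow>
           (\<forall>v1\<in>B t u1 \<eta>1 u1. \<forall>v2\<in>B t u2 \<eta>2 u2.
              (v1 - v2) \<bullet> (u1 - u2) \<ge> - \<rho> t * (norm (u1 - u2))\<^sup>2))))"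

definition HF ::
    "real \<Rightarrow> (real \<Rightarrow> 'e::{real_inner, banach, second_countable_topology} \<Rightarrow>
       'h::{real_inner, banach, second_countable_topology} \<Rightarrow> 'l::metric_space \<Rightarrow> 'e set) \<Rightarrow> bool" where
  "HF b F \<longleftrightarrow>
     (\<forall>t\<in>{0..b}. \<forall>x u \<zeta>.
        F t x u \<zeta> \<noteq> {} \<and> compactin weak_topology (F t x u \<zeta>) \<and> convex (F t x u \<zeta>)) \<and>
     (\<forall>x u \<zeta>. measurable_multi b (\<lambda>t. F t x u \<zeta>)) \<and>
     (\<forall>D. bounded D \<longrightarrow> (\<exists>k. L1_nonneg b k \<and>
        (AE t in leb b. \<forall>x u y v. \<forall>\<zeta>\<in>D.
           Haus (F t x u \<zeta>) (F t y v \<zeta>) \<le> ereal (k t * (norm (x - y) + norm (u - v)))))) \<and>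
     (\<forall>D. bounded D \<longrightarrow> (\<exists>M>0. AE t in leb b. \<forall>x u. \<forall>\<zeta>\<in>D.
        set_norm (F t x u \<zeta>) \<le> ereal (M * (1 + norm x + norm u)))) \<and>
     (\<exists>(\<gamma> :: real \<Rightarrow> real) (\<rho> :: real \<Rightarrow> real \<Rightarrow> real \<Rightarrow> real).
        (\<gamma> \<longlongrightarrow> 0) (at_right 0) \<and>
        (AE t in leb b. \<forall>x u \<zeta>1 \<zeta>2.
           Haus (F t x u \<zeta>1) (F t x u \<zeta>2) \<le> ereal (\<gamma> (dist \<zeta>1 \<zeta>2) * \<rho> t (norm x) (norm u))) \<and>
        (\<forall>S :: ((real \<Rightarrow> 'e) \<times> (real \<Rightarrow> 'h)) set. bounded_in_L2 b S \<longrightarrow>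
           (\<exists>\<omega>. L1_nonneg b \<omega> \<and>
              (\<forall>(x, u)\<in>S. AE t in leb b. \<rho> t (norm (x t)) (norm (u t)) \<le> \<omega> t))))"

definition HG ::
    "real \<Rightarrow> (real \<Rightarrow> 'e::{real_inner, banach, second_countable_topology} \<Rightarrow>
       'h::{real_inner, banach, second_countable_topology} \<Rightarrow> 'k::metric_space \<Rightarrow> 'h set) \<Rightarrow> bool" where
  "HG b G \<longleftrightarrow>
     (\<forall>t\<in>{0..b}. \<forall>x u \<eta>.
        G t x u \<eta> \<noteq> {} \<and> compactin weak_topology (G t x u \<eta>) \<and> convex (G t x u \<eta>)) \<and>
     (\<forall>x u \<eta>. measurable_multi b (\<lambda>t. G t x u \<eta>)) \<and>
     (\<forall>D. bounded D \<longrightarrow> (\<exists>l. L1_nonneg b l \<and>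
        (AE t in leb b. \<forall>x u y v. \<forall>\<eta>\<in>D.
           Haus (G t x u \<eta>) (G t y v \<eta>) \<le> ereal (l t * (norm (x - y) + norm (u - v)))))) \<and>
     (\<forall>D. bounded D \<longrightarrow> (\<exists>M>0. AE t in leb b. \<forall>x u. \<forall>\<eta>\<in>D.
        set_norm (G t x u \<eta>) \<le> ereal (M * (1 + norm x + norm u)))) \<and>
     (\<exists>(\<gamma> :: real \<Rightarrow> real) (\<rho> :: real \<Rightarrow> real \<Rightarrow> real \<Rightarrow> real).
        (\<gamma> \<longlongrightarrow> 0) (at_right 0) \<and>
        (AE t in leb b. \<forall>x u \<eta>1 \<eta>2.
           Haus (G t x u \<eta>1) (G t x u \<eta>2) \<le> ereal (\<gamma> (dist \<eta>1 \<eta>2) * \<rho> t (norm x) (norm u))) \<and>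
        (\<forall>Q :: ((real \<Rightarrow> 'e) \<times> (real \<Rightarrow> 'h)) set. bounded_in_C b Q \<longrightarrow>
           (\<exists>\<omega>. L1_nonneg b \<omega> \<and>
              (AE t in leb b. \<forall>(x, u)\<in>Q. \<rho> t (norm (x t)) (norm (u t)) \<le> \<omega> t))))"

definition HW ::
    "real \<Rightarrow> (real \<Rightarrow> 'y::{real_inner, banach, second_countable_topology} set) \<Rightarrow> bool" where
  "HW b W \<longleftrightarrow>
     measurable_multi b W \<and>
     (\<forall>t\<in>{0..b}. W t \<noteq> {} \<and> closed (W t) \<and> convex (W t)) \<and>
     (\<exists>\<phi> :: real \<Rightarrow> real. in_L2 b \<phi> \<and> (\<forall>t\<in>{0..b}. 0 \<le> \<phi> t) \<and>
        (AE t in leb b. set_norm (W t) \<le> ereal (\<phi> t)))"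

definition Caratheodory :: "real \<Rightarrow> (real \<Rightarrow> real \<Rightarrow> real) \<Rightarrow> bool" where
  "Caratheodory b \<kappa> \<longleftrightarrow>
     (\<forall>r\<ge>0. (\<lambda>t. \<kappa> t r) \<in> borel_measurable (leb b)) \<and>
     (AE t in leb b. continuous_on {0..} (\<kappa> t))"

definition Hl ::
    "real \<Rightarrow> (real \<Rightarrow> 'e::{real_inner, banach, second_countable_topology} \<Rightarrow>
       'h::{real_inner, banach, second_countable_topology} \<Rightarrow> 'l::metric_space \<Rightarrow> 'k::metric_space \<Rightarrow>
       real) \<Rightarrow> bool" where
  "Hl b l \<longleftrightarrow>
     (\<forall>x u \<zeta> \<eta>. (\<lambda>t. l t x u \<zeta> \<eta>) \<in> borel_measurable (leb b)) \<and>
     (\<exists>\<kappa>. (\<forall>t\<in>{0..b}. \<forall>r\<ge>0. 0 \<le> \<kappa> t r) \<and> Caratheodory b \<kappa> \<and>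
        (AE t in leb b. \<kappa> t 0 = 0) \<and>
        (\<forall>R>0. \<exists>\<beta>. L1_nonneg b \<beta> \<and> (AE t in leb b. \<forall>r\<in>{0..R}. \<kappa> t r \<le> \<beta> t)) \<and>
        (AE t in leb b. \<forall>x y u \<zeta> \<eta>.
           \<bar>l t x u \<zeta> \<eta> - l t y u \<zeta> \<eta>\<bar> \<le> (1 + max (norm x) (norm y)) * \<kappa> t (norm (x - y)))) \<and>
     (AE t in leb b. \<forall>x \<zeta> \<eta>. convex_on UNIV (\<lambda>u. l t x u \<zeta> \<eta>)) \<and>
     (\<forall>D. bounded D \<longrightarrow> (\<exists>\<theta>. L1_nonneg b \<theta> \<and>
        (AE t in leb b. \<forall>u. \<forall>(\<zeta>, \<eta>)\<in>D. \<bar>l t 0 u \<zeta> \<eta>\<bar> \<le> \<theta> t * (1 + norm u)))) \<and>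
     (AE t in leb b. continuous_on UNIV (\<lambda>(x, u, \<zeta>, \<eta>). l t x u \<zeta> \<eta>))"


subsection \<open>The control problem\<close>

definition admissible_controls ::
    "real \<Rightarrow> (real \<Rightarrow> 'y::{real_inner, banach, second_countable_topology} set) \<Rightarrow> (real \<Rightarrow> 'y) set" where
  "admissible_controls b W = {w. in_L2 b w \<and> (AE t in leb b. w t \<in> W t)}"

definition mild_solutions ::
    "real \<Rightarrow> ('l::metric_space \<Rightarrow> real \<Rightarrow> 'e::{real_inner, banach, second_countable_topology} \<Rightarrow>\<^sub>L 'e) \<Rightarrow>
     (real \<Rightarrow> 'h::{real_inner, banach, second_countable_topology} \<Rightarrow> 'k::metric_space \<Rightarrow> 'h \<Rightarrow> 'h set) \<Rightarrow>
     (real \<Rightarrow> 'e \<Rightarrow> 'h \<Rightarrow> 'l \<Rightarrow> 'e set) \<Rightarrow> (real \<Rightarrow> 'e \<Rightarrow> 'h \<Rightarrow> 'k \<Rightarrow> 'h set) \<Rightarrow>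
     ('y::{real_inner, banach, second_countable_topology} \<Rightarrow>\<^sub>L 'e) \<Rightarrow>
     ('l \<Rightarrow> 'e) \<Rightarrow> ('k \<Rightarrow> 'h) \<Rightarrow> 'l \<Rightarrow> 'k \<Rightarrow> (real \<Rightarrow> 'y) \<Rightarrow>
     ((real \<Rightarrow> 'e) \<times> (real \<Rightarrow> 'h)) set" where
  "mild_solutions b T B F G Bop x0 u0 \<zeta> \<eta> w =
     {(x, u). continuous_on {0..b} x \<and> u 0 = u0 \<eta> \<and>
        (\<exists>u' f g. has_W12_derivative b u u' \<and> integrable (leb b) f \<and> integrable (leb b) g \<and>
           (AE t in leb b. f t \<in> F t (x t) (u t) \<zeta> \<and> g t \<in> G t (x t) (u t) \<eta> \<and>
              - u' t + g t \<in> B t (u t) \<eta> (u t)) \<and>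
           (\<forall>t\<in>{0..b}. x t = blinfun_apply (T \<zeta> t) (x0 \<zeta>) +
              (\<integral>s. blinfun_apply (T \<zeta> (t - s)) (f s + blinfun_apply Bop (w s)) \<partial>lebesgue_on {0..t})))}"

definition cost ::
    "real \<Rightarrow> (real \<Rightarrow> 'e \<Rightarrow> 'h \<Rightarrow> 'l \<Rightarrow> 'k \<Rightarrow> real) \<Rightarrow> ('e \<Rightarrow> 'h \<Rightarrow> 'l \<Rightarrow> 'k \<Rightarrow> real) \<Rightarrow>
     'l \<Rightarrow> 'k \<Rightarrow> (real \<Rightarrow> 'e) \<Rightarrow> (real \<Rightarrow> 'h) \<Rightarrow> real" where
  "cost b l \<phi> \<zeta> \<eta> x u = (\<integral>t. l t (x t) (u t) \<zeta> \<eta> \<partial>leb b) + \<phi> (x b) (u b) \<zeta> \<eta>"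

text \<open>The infimum is \<open>\<infinity>\<close> if there is no solution.\<close>

definition min_cost ::
    "real \<Rightarrow> ('l::metric_space \<Rightarrow> real \<Rightarrow> 'e::{real_inner, banach, second_countable_topology} \<Rightarrow>\<^sub>L 'e) \<Rightarrow>
     (real \<Rightarrow> 'h::{real_inner, banach, second_countable_topology} \<Rightarrow> 'k::metric_space \<Rightarrow> 'h \<Rightarrow> 'h set) \<Rightarrow>
     (real \<Rightarrow> 'e \<Rightarrow> 'h \<Rightarrow> 'l \<Rightarrow> 'e set) \<Rightarrow> (real \<Rightarrow> 'e \<Rightarrow> 'h \<Rightarrow> 'k \<Rightarrow> 'h set) \<Rightarrow>
     ('y::{real_inner, banach, second_countable_topology} \<Rightarrow>\<^sub>L 'e) \<Rightarrow>
     ('l \<Rightarrow> 'e) \<Rightarrow> ('k \<Rightarrow> 'h) \<Rightarrow>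
     (real \<Rightarrow> 'e \<Rightarrow> 'h \<Rightarrow> 'l \<Rightarrow> 'k \<Rightarrow> real) \<Rightarrow> ('e \<Rightarrow> 'h \<Rightarrow> 'l \<Rightarrow> 'k \<Rightarrow> real) \<Rightarrow>
     'l \<Rightarrow> 'k \<Rightarrow> (real \<Rightarrow> 'y) \<Rightarrow> ereal" where
  "min_cost b T B F G Bop x0 u0 l \<phi> \<zeta> \<eta> w =
     (INF (x, u)\<in>mild_solutions b T B F G Bop x0 u0 \<zeta> \<eta> w. ereal (cost b l \<phi> \<zeta> \<eta> x u))"

definition control_cost :: "real \<Rightarrow> (real \<Rightarrow> 'y::real_normed_vector) \<Rightarrow> real" where
  "control_cost b w = 1/2 * (\<integral>t. (norm (w t))\<^sup>2 \<partial>leb b)"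

end

theory Submission
  imports Defs "HOL-Library.Diagonal_Subsequence"
begin

text \<open>
  Direct method on triples (control, state \<open>x\<close>, state \<open>u\<close>). Comparing the monotone inclusion at time
  \<open>s\<close> with the minimal sections at earlier times bounds \<open>u'\<close> pointwise, so a Gronwall argument bounds
  all trajectories uniformly. Compactness of the semigroup and of the domains gives, along a
  subsequence of a minimizing sequence, strong pointwise convergence of the states. The
  velocities \<open>(f, w, g, u')\<close> need not converge, but convex combinations of their tails converge almost
  everywhere; convexity of the values of \<open>F\<close>, \<open>G\<close>, \<open>W\<close> and maximal monotonicity identify the limit as a
  trajectory. The cost of the states converges by dominated convergence and the control cost is
  convex, so the limit is optimal. If no control admits a solution the infimum is infinite, and one
  only needs an admissible control; the selection of minimal norm of \<open>W\<close> is one.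
\<close>

subsection \<open>Convex sets in Hilbert spaces and monotone operators\<close>

text \<open>The obstacle is that the velocities are merely bounded in L^2 while the constraints on
  them move with the state: the sets \<open>F t x u\<close> and \<open>G t x u\<close>, and the
  operator \<open>A t u\<close>, whose domain depends on \<open>u\<close>. A convex combination of
  trajectories is therefore not a trajectory; only the limit is one. The passage works because, at a
  fixed time, the velocities of late trajectories almost satisfy the convex constraint attached to
  the limit state: for F and G by the Lipschitz estimates, for A by the pseudo-distance taken at
  equal times, where the term in \<theta> vanishes. The four velocities form one vector, so that the
  same weights act on all components and the linear relations among them (mild formula, primitive,
  \<open>- u' + g\<close>) survive averaging. No lower bound on the cost is established beforehand:
  the infimum may a priori be -\<infinity>, and its finiteness comes out of the compactness
  argument.\<close>

lemma convex_norm_diff_le: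
  fixes z p :: "'a::real_inner"
  assumes "convex S" "z \<in> S" "p \<in> S" "\<And>y. y \<in> S \<Longrightarrow> d \<le> norm y" "0 \<le> d"
  shows "(norm (z - p))\<^sup>2 \<le> 2 * (norm z)\<^sup>2 + 2 * (norm p)\<^sup>2 - 4 * d\<^sup>2"
proof -
  have "(1/2) *\<^sub>R z + (1/2) *\<^sub>R p \<in> S"
    using assms(1-3) by (intro convexD) auto
  then have "d \<le> norm ((1/2) *\<^sub>R z + (1/2) *\<^sub>R p)" using assms(4) by blast
  also have "(1/2) *\<^sub>R z + (1/2) *\<^sub>R p = (1/2) *\<^sub>R (z + p)" by (simp add: algebra_simps)
  finally have "2 * d \<le> norm (z + p)" by simp
  then have "(2 * d)\<^sup>2 \<le> (norm (z + p))\<^sup>2" using assms(5) by (intro power_mono) auto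
  \<comment> \<open>Parallelogram law; the midpoint bound controls the other diagonal.\<close>
  moreover have "(norm (z - p))\<^sup>2 + (norm (z + p))\<^sup>2 = 2 * (norm z)\<^sup>2 + 2 * (norm p)\<^sup>2"
    by (simp add: power2_norm_eq_inner inner_diff_left inner_diff_right inner_add_left
        inner_add_right inner_commute)
  ultimately show ?thesis by (simp add: power_mult_distrib)
qed

text \<open>With the minimizer as second point the parallelogram bound leaves 2 norm (z n)^2 - 2
  norm p^2, so convergence of the norms forces convergence of the points. It serves both the
  measurable selection and the uniqueness behind \<open>minimal_section\<close>.\<close>

lemma minimizing_seq_tendsto:
  fixes z :: "nat \<Rightarrow> 'a::real_inner"
  assumes "convex S" "p \<in> S" "\<And>y. y \<in> S \<Longrightarrow> norm p \<le> norm y"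
    and "\<And>n. z n \<in> S" "(\<lambda>n. norm (z n)) \<longlonglongrightarrow> norm p"
  shows "z \<longlonglongrightarrow> p"
proof -
  have "(\<lambda>n. 2 * (norm (z n))\<^sup>2 + 2 * (norm p)\<^sup>2 - 4 * (norm p)\<^sup>2)
      \<longlonglongrightarrow> 2 * (norm p)\<^sup>2 + 2 * (norm p)\<^sup>2 - 4 * (norm p)\<^sup>2"
    by (intro tendsto_intros assms)
  then have *: "(\<lambda>n. 2 * (norm (z n))\<^sup>2 + 2 * (norm p)\<^sup>2 - 4 * (norm p)\<^sup>2) \<longlonglongrightarrow> 0" by simp
  have "(\<lambda>n. (norm (z n - p))\<^sup>2) \<longlonglongrightarrow> 0"
    by (rule tendsto_sandwich[OF _ _ tendsto_const *])
      (use convex_norm_diff_le[OF assms(1) assms(4) assms(2,3)] in auto)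
  then have "(\<lambda>n. sqrt ((norm (z n - p))\<^sup>2)) \<longlonglongrightarrow> sqrt 0" by (rule tendsto_real_sqrt)
  then show ?thesis by (simp add: LIM_zero_iff tendsto_norm_zero_iff)
qed

lemma closed_convex_min_norm_exists:
  fixes S :: "'a::{real_inner, banach} set"
  assumes "closed S" "convex S" "S \<noteq> {}"
  shows "\<exists>p\<in>S. \<forall>z\<in>S. norm p \<le> norm z"
proof -
  define d where "d = infdist 0 S"
  have d0: "0 \<le> d" by (simp add: d_def infdist_nonneg)
  have dle: "d \<le> norm y" if "y \<in> S" for y
    using infdist_le[OF that, of 0] by (simp add: d_def)
  have "\<exists>z\<in>S. norm z < d + 1 / real (Suc n)" for n
  proof -
    have "infdist 0 S < d + 1 / real (Suc n)" by (simp add: d_def)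
    then have "\<exists>z\<in>S. dist 0 z < d + 1 / real (Suc n)"
      by (metis assms(3) cINF_less_iff bdd_below_image_dist infdist_notempty)
    then show ?thesis by simp
  qed
  then obtain z where z: "\<And>n. z n \<in> S" "\<And>n. norm (z n) < d + 1 / real (Suc n)" by metis
  have nz: "(\<lambda>n. norm (z n)) \<longlonglongrightarrow> d"
  proof (rule tendsto_sandwich[where f="\<lambda>_. d" and h="\<lambda>n. d + 1 / real (Suc n)"])
    show "(\<lambda>n. d + 1 / real (Suc n)) \<longlonglongrightarrow> d"
      using tendsto_add[OF tendsto_const LIMSEQ_Suc[OF lim_1_over_n], of d] by simp
    show "\<forall>\<^sub>F n in sequentially. d \<le> norm (z n)" using z dle by auto
    show "\<forall>\<^sub>F n in sequentially. norm (z n) \<le> d + 1 / real (Suc n)"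
      by (intro always_eventually allI less_imp_le z(2))
  qed simp
  have "Cauchy z"
  proof (rule CauchyI)
    fix e :: real assume e: "0 < e"
    have "(\<lambda>n. (norm (z n))\<^sup>2) \<longlonglongrightarrow> d\<^sup>2" by (intro tendsto_intros nz)
    \<comment> \<open>An excess of e^2 / 4 in each squared norm adds up to e^2 in the parallelogram
      bound.\<close>
    then have "\<forall>\<^sub>F n in sequentially. (norm (z n))\<^sup>2 < d\<^sup>2 + e\<^sup>2 / 4"
      by (rule order_tendstoD) (use e in auto)
    then obtain N where N: "\<And>n. n \<ge> N \<Longrightarrow> (norm (z n))\<^sup>2 < d\<^sup>2 + e\<^sup>2 / 4"
      by (auto simp: eventually_sequentially)
    have "norm (z m - z n) < e" if "m \<ge> N" "n \<ge> N" for m n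
    proof -
      have "(norm (z m - z n))\<^sup>2 \<le> 2 * (norm (z m))\<^sup>2 + 2 * (norm (z n))\<^sup>2 - 4 * d\<^sup>2"
        by (rule convex_norm_diff_le[OF assms(2)]) (use z dle d0 in auto)
      also have "\<dots> < e\<^sup>2" using N[OF that(1)] N[OF that(2)] by linarith
      finally show ?thesis using e by (simp add: power2_less_imp_less)
    qed
    then show "\<exists>M. \<forall>m\<ge>M. \<forall>n\<ge>M. norm (z m - z n) < e" by blast
  qed
  then obtain p where p: "z \<longlonglongrightarrow> p" using Cauchy_convergent_iff convergent_def by blast
  have "p \<in> S" using closed_sequentially[OF assms(1)] z(1) p by blast
  moreover have "norm p = d" using LIMSEQ_unique[OF tendsto_norm[OF p] nz] .
  ultimately show ?thesis using dle by auto
qed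

section \<open>Distances to closed convex sets and measurable selections\<close>

lemma closed_convex_infdist_attained:
  fixes S :: "'a::{real_inner, banach} set"
  assumes "closed S" "convex S" "S \<noteq> {}"
  shows "\<exists>p\<in>S. infdist a S = dist a p"
proof -
  have "\<exists>p\<in>(\<lambda>x. x - a) ` S. \<forall>z\<in>(\<lambda>x. x - a) ` S. norm p \<le> norm z"
  proof (rule closed_convex_min_norm_exists)
    show "closed ((\<lambda>x. x - a) ` S)" using closed_translation[OF assms(1), of "-a"] by simp
    show "convex ((\<lambda>x. x - a) ` S)" using convex_translation[OF assms(2), of "-a"] by simp
  qed (use assms in auto)
  then obtain p where p: "p \<in> S" "\<And>z. z \<in> S \<Longrightarrow> dist a p \<le> dist a z"
    by (auto simp: dist_norm norm_minus_commute)
  have "infdist a S = dist a p"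
  proof (rule antisym)
    show "dist a p \<le> infdist a S"
      using assms(3) p(2) by (auto simp: infdist_notempty intro!: cINF_greatest)
  qed (rule infdist_le[OF p(1)])
  with p show ?thesis by blast
qed

text \<open>The distance to a closed convex set is attained, hence it exceeds r exactly when the set
  misses the closed ball of radius r; that is a condition of the form used in
  \<open>measurable_multi\<close>.\<close>

lemma measurable_multi_infdist:
  fixes \<Phi> :: "real \<Rightarrow> 'a::{real_inner, banach} set"
  assumes "measurable_multi b \<Phi>" "\<And>t. t \<in> {0..b} \<Longrightarrow> \<Phi> t \<noteq> {} \<and> closed (\<Phi> t) \<and> convex (\<Phi> t)"
  shows "(\<lambda>t. infdist y (\<Phi> t)) \<in> borel_measurable (leb b)"
proof (rule borel_measurableI_greater)
  fix r :: real
  have "infdist y (\<Phi> t) > r \<longleftrightarrow> \<Phi> t \<subseteq> - cball y r" if t: "t \<in> {0..b}" for t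
  proof
    assume "infdist y (\<Phi> t) > r"
    then have "r < dist y z" if "z \<in> \<Phi> t" for z using infdist_le[OF that, of y] by linarith
    then show "\<Phi> t \<subseteq> - cball y r" by fastforce
  next
    assume *: "\<Phi> t \<subseteq> - cball y r"
    obtain p where "p \<in> \<Phi> t" "infdist y (\<Phi> t) = dist y p"
      using closed_convex_infdist_attained assms(2)[OF t] by blast
    with * show "infdist y (\<Phi> t) > r" by auto
  qed
  then have "{t \<in> {0..b}. r < infdist y (\<Phi> t)} = {t \<in> {0..b}. \<Phi> t \<subseteq> - cball y r}" by blast
  moreover have "{t \<in> {0..b}. \<Phi> t \<subseteq> - cball y r} \<in> sets lebesgue"
    using assms(1) closed_cball unfolding measurable_multi_def by blast
  ultimately show "{t \<in> space (leb b). r < infdist y (\<Phi> t)} \<in> sets (leb b)"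
    by (auto simp: sets_restrict_space_iff)
qed

text \<open>The candidate is the point of least norm. It is approximated by \<open>q n\<close>, the
  first point of a dense sequence that nearly lies in \<Phi> t and has nearly the least norm; both
  conditions speak only of distances to \<Phi> t, so the choice is measurable.\<close>

lemma measurable_multi_min_norm_selection:
  fixes \<Phi> :: "real \<Rightarrow> 'a::{real_inner, banach, second_countable_topology} set"
  assumes "measurable_multi b \<Phi>" "\<And>t. t \<in> {0..b} \<Longrightarrow> \<Phi> t \<noteq> {} \<and> closed (\<Phi> t) \<and> convex (\<Phi> t)"
  shows "\<exists>p \<in> borel_measurable (leb b). \<forall>t\<in>{0..b}. p t \<in> \<Phi> t"
proof -
  have "\<forall>t\<in>{0..b}. \<exists>p\<in>\<Phi> t. \<forall>z\<in>\<Phi> t. norm p \<le> norm z"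
    using assms(2) closed_convex_min_norm_exists by blast
  then obtain p where p: "\<And>t. t \<in> {0..b} \<Longrightarrow> p t \<in> \<Phi> t"
    "\<And>t z. t \<in> {0..b} \<Longrightarrow> z \<in> \<Phi> t \<Longrightarrow> norm (p t) \<le> norm z"
    by metis
  obtain D :: "'a set" where D: "countable D" "\<And>U. open U \<Longrightarrow> U \<noteq> {} \<Longrightarrow> \<exists>d\<in>D. d \<in> U"
    using countable_dense_setE by metis
  have "D \<noteq> {}" using D(2)[of UNIV] by auto
  define y where "y = from_nat_into D"
  have dense: "\<exists>i. dist (y i) x < e" if "e > 0" for x e
    using D(2)[of "ball x e"] that D(1) \<open>D \<noteq> {}\<close>
    by (metis centre_in_ball empty_iff from_nat_into_surj mem_ball dist_commute open_ball y_def)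
  note [measurable] = measurable_multi_infdist[OF assms(1)]
  have a_eq: "infdist 0 (\<Phi> t) = norm (p t)" if t: "t \<in> {0..b}" for t
  proof (rule antisym)
    show "infdist 0 (\<Phi> t) \<le> norm (p t)" using infdist_le[OF p(1)[OF t], of 0] by simp
    show "norm (p t) \<le> infdist 0 (\<Phi> t)"
      using assms(2)[OF t] p(2)[OF t] by (auto simp: infdist_notempty intro!: cINF_greatest)
  qed
  define P where "P n t i \<longleftrightarrow> infdist (y i) (\<Phi> t) < 1 / real (Suc n)
      \<and> norm (y i) < infdist 0 (\<Phi> t) + 1 / real (Suc n)" for n t i
  have ex: "\<exists>i. P n t i" if t: "t \<in> {0..b}" for n t
  proof -
    obtain i where i: "dist (y i) (p t) < 1 / real (Suc n)" using dense[of "1 / real (Suc n)"] by auto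
    have "infdist (y i) (\<Phi> t) < 1 / real (Suc n)"
      using infdist_le[OF p(1)[OF t], of "y i"] i by linarith
    moreover have "norm (y i) < norm (p t) + 1 / real (Suc n)"
      using i norm_triangle_ineq2[of "y i" "p t"] by (auto simp: dist_norm)
    ultimately show ?thesis using a_eq[OF t] by (auto simp: P_def)
  qed
  define q where "q n t = y (LEAST i. P n t i)" for n t
  have qm [measurable]: "q n \<in> borel_measurable (leb b)" for n
  proof -
    have [measurable]: "Measurable.pred (leb b) (\<lambda>t. P n t i)" for i
      unfolding P_def using assms(2) by measurable
    have "(\<lambda>t. LEAST i. P n t i) \<in> measurable (leb b) (count_space UNIV)" by measurable
    then show ?thesis unfolding q_def by (rule measurable_compose) simp
  qed
  have qlim: "(\<lambda>n. q n t) \<longlonglongrightarrow> p t" if t: "t \<in> {0..b}" for t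
  proof -
    have Pq: "infdist (q n t) (\<Phi> t) < 1 / real (Suc n)" "norm (q n t) < norm (p t) + 1 / real (Suc n)" for n
      using LeastI_ex[OF ex[OF t, of n]] a_eq[OF t] by (auto simp: P_def q_def)
    \<comment> \<open>\<open>q n t\<close> need not lie in \<Phi> t; its nearest points
      \<open>z n\<close> there do, and they form a minimizing sequence.\<close>
    have "\<exists>z\<in>\<Phi> t. infdist (q n t) (\<Phi> t) = dist (q n t) z" for n
      using closed_convex_infdist_attained assms(2)[OF t] by blast
    then obtain z where z: "\<And>n. z n \<in> \<Phi> t" "\<And>n. infdist (q n t) (\<Phi> t) = dist (q n t) (z n)" by metis
    have inv: "(\<lambda>n. 1 / real (Suc n)) \<longlonglongrightarrow> 0" using LIMSEQ_Suc[OF lim_1_over_n] .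
    have qz: "(\<lambda>n. q n t - z n) \<longlonglongrightarrow> 0"
      by (rule Lim_null_comparison[OF _ inv])
        (use Pq z in \<open>auto simp: dist_norm intro!: always_eventually less_imp_le\<close>)
    have zup: "norm (z n) \<le> norm (p t) + 2 * (1 / real (Suc n))" for n
    proof -
      have "norm (z n) \<le> norm (q n t) + norm (q n t - z n)"
        by (metis norm_minus_commute norm_triangle_sub)
      then show ?thesis using Pq[of n] z(2)[of n] by (simp add: dist_norm)
    qed
    have "(\<lambda>n. norm (z n)) \<longlonglongrightarrow> norm (p t)"
    proof (rule tendsto_sandwich[where f="\<lambda>_. norm (p t)" and h="\<lambda>n. norm (p t) + 2 * (1 / real (Suc n))"])
      show "(\<lambda>n. norm (p t) + 2 * (1 / real (Suc n))) \<longlonglongrightarrow> norm (p t)"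
        using tendsto_add[OF tendsto_const tendsto_mult[OF tendsto_const inv], of "norm (p t)" 2] by simp
      show "\<forall>\<^sub>F n in sequentially. norm (p t) \<le> norm (z n)" using p(2)[OF t z(1)] by simp
      show "\<forall>\<^sub>F n in sequentially. norm (z n) \<le> norm (p t) + 2 * (1 / real (Suc n))"
        by (intro always_eventually allI zup)
    qed simp
    then have "z \<longlonglongrightarrow> p t"
      using assms(2)[OF t] p[OF t] z(1) by (intro minimizing_seq_tendsto[of "\<Phi> t"]) auto
    from tendsto_add[OF qz this] show ?thesis by simp
  qed
  have "p \<in> borel_measurable (leb b)"
    by (rule borel_measurable_LIMSEQ_metric[of q]) (use qm qlim in auto)
  with p(1) show ?thesis by blast
qed

lemma set_norm_leD: "set_norm S \<le> ereal c \<Longrightarrow> s \<in> S \<Longrightarrow> norm s \<le> c"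
  unfolding set_norm_def by (auto simp: SUP_le_iff)

lemma admissible_controls_nonempty:
  assumes "HW b W"
  shows "admissible_controls b W \<noteq> {}"
proof -
  obtain \<phi> where \<phi>: "in_L2 b \<phi>" "AE t in leb b. set_norm (W t) \<le> ereal (\<phi> t)"
    using assms unfolding HW_def by blast
  obtain p where p: "p \<in> borel_measurable (leb b)" "\<And>t. t \<in> {0..b} \<Longrightarrow> p t \<in> W t"
    using measurable_multi_min_norm_selection[of b W] assms unfolding HW_def by blast
  have "AE t in leb b. t \<in> {0..b}" by (rule AE_I2) simp
  then have pW: "AE t in leb b. p t \<in> W t" by (rule AE_mp) (use p(2) in auto)
  have "integrable (leb b) (\<lambda>t. (norm (p t))\<^sup>2)"
  proof (rule Bochner_Integration.integrable_bound)
    show "integrable (leb b) (\<lambda>t. (norm (\<phi> t))\<^sup>2)" using \<phi>(1) by (simp add: in_L2_def)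
    show "AE t in leb b. norm ((norm (p t))\<^sup>2) \<le> norm ((norm (\<phi> t))\<^sup>2)"
      using pW \<phi>(2)
    proof eventually_elim
      case (elim t)
      then have "norm (p t) \<le> \<phi> t" using set_norm_leD by blast
      then have "(norm (p t))\<^sup>2 \<le> (\<phi> t)\<^sup>2" by (intro power_mono) auto
      then show ?case by simp
    qed
  qed (use p(1) in measurable)
  with p(1) pW show ?thesis unfolding admissible_controls_def in_L2_def by blast
qed

section \<open>Maximal monotone operators and weakly compact values\<close>

lemma maximal_monotone_memI:
  assumes "maximal_monotone B" "\<And>z y. y \<in> B z \<Longrightarrow> 0 \<le> (v - y) \<bullet> (u - z)"
  shows "v \<in> B u"
proof -
  \<comment> \<open>Adjoining the pair (u, v) to the graph keeps it monotone, and maximality then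
    says that the pair was already there.\<close>
  define C where "C = B (u := insert v (B u))"
  have "monotone_operator C"
    unfolding monotone_operator_def
  proof (intro allI ballI)
    fix x x' y y' assume *: "y \<in> C x" "y' \<in> C x'"
    have mono: "\<And>x x' y y'. y \<in> B x \<Longrightarrow> y' \<in> B x' \<Longrightarrow> 0 \<le> (y - y') \<bullet> (x - x')"
      using assms(1) unfolding maximal_monotone_def monotone_operator_def by blast
    have sym: "0 \<le> (y - v) \<bullet> (z - u)" if "y \<in> B z" for y z
      using assms(2)[OF that] by (metis inner_minus_left inner_minus_right minus_diff_eq minus_minus)
    show "0 \<le> (y - y') \<bullet> (x - x')"
      using * mono assms(2) sym by (auto simp: C_def split: if_splits)
  qed
  moreover have "\<forall>x. B x \<subseteq> C x" by (auto simp: C_def)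
  ultimately have "C = B" using assms(1) unfolding maximal_monotone_def by blast
  then show ?thesis by (metis C_def fun_upd_same insertI1)
qed

text \<open>Maximality identifies B u with the solutions v of all inequalities imposed by points of
  the graph; each of them cuts out a closed half-space in v.\<close>

lemma maximal_monotone_values:
  assumes "maximal_monotone B"
  shows "closed (B u)" "convex (B u)"
proof -
  have eq: "B u = (\<Inter>z. \<Inter>y\<in>B z. {v. (z - u) \<bullet> v \<le> (z - u) \<bullet> y})"
  proof (intro equalityI subsetI)
    fix v assume "v \<in> B u"
    then have "0 \<le> (v - y) \<bullet> (u - z)" if "y \<in> B z" for y z
      using assms that unfolding maximal_monotone_def monotone_operator_def by blast
    then show "v \<in> (\<Inter>z. \<Inter>y\<in>B z. {v. (z - u) \<bullet> v \<le> (z - u) \<bullet> y})"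
      by (fastforce simp: inner_diff_left inner_diff_right inner_commute)
  next
    fix v assume v: "v \<in> (\<Inter>z. \<Inter>y\<in>B z. {v. (z - u) \<bullet> v \<le> (z - u) \<bullet> y})"
    show "v \<in> B u"
    proof (rule maximal_monotone_memI[OF assms])
      fix z y assume "y \<in> B z"
      then have "(z - u) \<bullet> v \<le> (z - u) \<bullet> y" using v by blast
      then show "0 \<le> (v - y) \<bullet> (u - z)"
        by (simp add: inner_diff_left inner_diff_right inner_commute)
    qed
  qed
  show "closed (B u)" unfolding eq by (intro closed_INT ballI closed_halfspace_le)
  show "convex (B u)" unfolding eq by (intro convex_INT convex_halfspace_le)
qed

text \<open>\<open>minimal_section\<close> is a definite description, so uniqueness of the point of
  least norm is needed besides existence; a constant sequence in
  \<open>minimizing_seq_tendsto\<close> gives it.\<close>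

lemma minimal_section_mem:
  fixes B :: "'h::{real_inner, banach} \<Rightarrow> 'h set"
  assumes "maximal_monotone B" "v \<in> op_dom B"
  shows "minimal_section B v \<in> B v"
proof -
  have ne: "B v \<noteq> {}" using assms(2) by (simp add: op_dom_def)
  obtain p where p: "p \<in> B v" "\<And>z. z \<in> B v \<Longrightarrow> norm p \<le> norm z"
    using closed_convex_min_norm_exists[OF maximal_monotone_values[OF assms(1)] ne] by blast
  have uniq: "y = p" if "y \<in> B v" "\<forall>z\<in>B v. norm y \<le> norm z" for y
  proof -
    have "norm y = norm p" using that p by (simp add: antisym)
    then have "(\<lambda>_::nat. y) \<longlonglongrightarrow> p"
      using minimizing_seq_tendsto[OF maximal_monotone_values(2)[OF assms(1)] p] that by simp
    then show ?thesis by (simp add: LIMSEQ_const_iff)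
  qed
  have "minimal_section B v = p"
    unfolding minimal_section_def by (rule the_equality) (use p(1) p(2) uniq in blast)+
  with p show ?thesis by simp
qed

lemma dis_leD:
  assumes "dis B1 B2 \<le> ereal c" "y \<in> B1 x" "y' \<in> B2 x'"
  shows "(y - y') \<bullet> (x' - x) \<le> (1 + norm y + norm y') * c"
proof -
  have "ereal (((y - y') \<bullet> (x' - x)) / (1 + norm y + norm y')) \<le> dis B1 B2"
    unfolding dis_def
  proof (rule Sup_upper, rule CollectI, intro exI conjI)
    show "y \<in> B1 x" "y' \<in> B2 x'" by fact+
    then show "x \<in> op_dom B1" "x' \<in> op_dom B2" by (auto simp: op_dom_def)
  qed rule
  then have "((y - y') \<bullet> (x' - x)) / (1 + norm y + norm y') \<le> c"
    using assms(1) by (metis ereal_less_eq(3) order_trans)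
  moreover have "1 + norm y + norm y' > 0" by (simp add: add_pos_nonneg)
  ultimately show ?thesis by (simp add: pos_divide_le_eq mult.commute)
qed

text \<open>Inner products separate points, so the weak topology is Hausdorff and compact sets are
  closed in it; it is coarser than the norm topology, which transfers closedness.\<close>

lemma weakly_compact_imp_closed:
  fixes C :: "'a::real_inner set"
  assumes "compactin weak_topology C"
  shows "closed C"
proof -
  have "inj (\<lambda>x (f :: 'a \<Rightarrow>\<^sub>L real). blinfun_apply f x)"
  proof (rule injI)
    fix x y :: 'a assume *: "(\<lambda>f :: 'a \<Rightarrow>\<^sub>L real. blinfun_apply f x) = (\<lambda>f. blinfun_apply f y)"
    have "(x - y) \<bullet> x = (x - y) \<bullet> y"
      using fun_cong[OF *, of "blinfun_inner_right (x - y)"] by simp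
    then have "(x - y) \<bullet> (x - y) = 0" by (simp add: inner_diff_right)
    then show "x = y" by simp
  qed
  moreover have "continuous_map weak_topology euclidean (\<lambda>x (f :: 'a \<Rightarrow>\<^sub>L real). blinfun_apply f x)"
    using continuous_map_pullback[OF continuous_map_id, of UNIV "\<lambda>x (f :: 'a \<Rightarrow>\<^sub>L real). blinfun_apply f x" euclidean]
    unfolding weak_topology_def by simp
  moreover have "Hausdorff_space (euclidean :: (('a \<Rightarrow>\<^sub>L real) \<Rightarrow> real) topology)"
    by (simp add: Hausdorff_space_product_topology flip: euclidean_product_topology)
  ultimately have "Hausdorff_space (weak_topology :: 'a topology)"
    by (meson Hausdorff_space_injective_preimage inj_on_subset subset_UNIV)
  then have "closedin weak_topology C" using assms compactin_imp_closedin by blast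
  moreover have "continuous_map euclidean weak_topology (\<lambda>x::'a. x)"
    unfolding weak_topology_def
  proof (rule continuous_map_pullback')
    show "continuous_map euclidean euclidean ((\<lambda>x (f :: 'a \<Rightarrow>\<^sub>L real). blinfun_apply f x) \<circ> (\<lambda>x. x))"
      by (auto simp: o_def intro!: continuous_on_coordinatewise_then_product continuous_intros)
  qed auto
  ultimately have "closedin euclidean {x \<in> topspace euclidean. x \<in> C}"
    by (rule closedin_continuous_map_preimage[rotated])
  then show ?thesis by simp
qed

subsection \<open>Integrals on intervals and Lebesgue differentiation\<close>

lemma integrable_on_subinterval:
  fixes f :: "real \<Rightarrow> 'a::{banach, second_countable_topology}"
  assumes "integrable (lebesgue_on {a..b}) f" "a \<le> c" "d \<le> b"
  shows "integrable (lebesgue_on {c..d}) f"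
proof -
  have "integrable lebesgue (\<lambda>x. indicator {c..d} x *\<^sub>R (indicator {a..b} x *\<^sub>R f x))"
    by (rule integrable_mult_indicator) (use assms(1) in \<open>simp_all add: integrable_restrict_space\<close>)
  moreover have "(\<lambda>x. indicator {c..d} x *\<^sub>R (indicator {a..b} x *\<^sub>R f x))
      = (\<lambda>x. indicator {c..d} x *\<^sub>R f x)"
    using assms by (auto simp: fun_eq_iff indicator_def)
  ultimately show ?thesis by (simp add: integrable_restrict_space)
qed

lemma integral_subinterval_eq:
  fixes f :: "real \<Rightarrow> 'a::{banach, second_countable_topology}"
  assumes "a \<le> c" "d \<le> b"
  shows "(\<integral>x. f x \<partial>lebesgue_on {c..d}) = (\<integral>x. indicator {c..d} x *\<^sub>R f x \<partial>lebesgue_on {a..b})"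
proof -
  have "(\<lambda>x. indicator {a..b} x *\<^sub>R (indicator {c..d} x *\<^sub>R f x)) = (\<lambda>x. indicator {c..d} x *\<^sub>R f x)"
    using assms by (auto simp: fun_eq_iff indicator_def)
  then show ?thesis by (simp add: integral_restrict_space)
qed

lemma integral_interval_combine:
  fixes f :: "real \<Rightarrow> 'a::{banach, second_countable_topology}"
  assumes f: "integrable (lebesgue_on {a..b}) f" and "a \<le> c" "c \<le> b"
  shows "(\<integral>x. f x \<partial>lebesgue_on {a..b}) = (\<integral>x. f x \<partial>lebesgue_on {a..c}) + (\<integral>x. f x \<partial>lebesgue_on {c..b})"
proof -
  have i: "integrable lebesgue (\<lambda>x. indicator {a..c} x *\<^sub>R f x)"
    "integrable lebesgue (\<lambda>x. indicator {c..b} x *\<^sub>R f x)"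
    using integrable_on_subinterval[OF f, of a c] integrable_on_subinterval[OF f, of c b] assms
    by (simp_all add: integrable_restrict_space)
  have "AE x in lebesgue. x \<noteq> c"
    by (rule AE_I'[of "{c}"]) auto
  then have "AE x in lebesgue. indicator {a..b} x *\<^sub>R f x
      = indicator {a..c} x *\<^sub>R f x + indicator {c..b} x *\<^sub>R f x"
    by eventually_elim (use assms in \<open>auto simp: indicator_def\<close>)
  then have "(\<integral>x. indicator {a..b} x *\<^sub>R f x \<partial>lebesgue)
      = (\<integral>x. indicator {a..c} x *\<^sub>R f x + indicator {c..b} x *\<^sub>R f x \<partial>lebesgue)"
    using f i by (intro integral_cong_AE) (auto simp: integrable_restrict_space)
  then show ?thesis using i by (simp add: integral_restrict_space)
qed

lemma norm_integral_le_bound: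
  fixes f :: "'a \<Rightarrow> 'b::{banach, second_countable_topology}"
  assumes "integrable M g" "AE x in M. norm (f x) \<le> g x"
  shows "norm (\<integral>x. f x \<partial>M) \<le> (\<integral>x. g x \<partial>M)"
proof (cases "integrable M f")
  case True
  have "norm (\<integral>x. f x \<partial>M) \<le> (\<integral>x. norm (f x) \<partial>M)" by simp
  also have "\<dots> \<le> (\<integral>x. g x \<partial>M)" using True assms by (intro integral_mono_AE) auto
  finally show ?thesis .
next
  \<comment> \<open>A non-integrable function has integral 0 by convention, so only non-negativity
    of the bound is left.\<close>
  case False
  have "AE x in M. 0 \<le> g x" using assms(2) by eventually_elim (use norm_ge_zero order_trans in blast)
  then show ?thesis using False by (simp add: not_integrable_integral_eq integral_nonneg_AE)
qed

lemma AE_interval_iff: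
  "(AE t in lebesgue_on {a..b::real}. P t) \<longleftrightarrow> (AE t in lebesgue. t \<in> {a..b} \<longrightarrow> P t)"
  by (rule AE_restrict_space_iff) simp

lemma AE_subinterval:
  fixes a b c d :: real
  assumes "AE t in lebesgue_on {a..b}. P t" "a \<le> c" "d \<le> b"
  shows "AE t in lebesgue_on {c..d}. P t"
  using assms unfolding AE_interval_iff by (auto elim!: eventually_mono)

text \<open>A set of full measure meets every interval. This is how times at which an almost
  everywhere inclusion really holds are picked close to a prescribed time.\<close>

lemma AE_interval_ex:
  fixes a b c d :: real
  assumes "AE t in lebesgue_on {a..b}. P t" "a \<le> c" "c < d" "d \<le> b"
  shows "\<exists>t. c < t \<and> t < d \<and> P t"
proof (rule ccontr)
  assume none: "\<nexists>t. c < t \<and> t < d \<and> P t"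
  have "AE t in lebesgue. t \<in> {a..b} \<longrightarrow> P t" using assms(1) by (simp only: AE_interval_iff)
  then have "AE t in lebesgue. t \<notin> {c<..<d}" by eventually_elim (use none assms in auto)
  then have "{c<..<d} \<in> null_sets lebesgue" by (simp add: AE_iff_null_sets)
  then have "emeasure lebesgue {c<..<d} = 0" by auto
  then show False using assms(3) by simp
qed

section \<open>Primitives of square integrable functions and their left derivatives\<close>

lemma in_L2_integrable:
  fixes v :: "real \<Rightarrow> 'a::{banach, second_countable_topology}"
  assumes "in_L2 b v"
  shows "integrable (leb b) v"
proof (rule Bochner_Integration.integrable_bound)
  interpret finite_measure "leb b" by (rule finite_measure_lebesgue_on) simp
  show "integrable (leb b) (\<lambda>t. 1 + (norm (v t))\<^sup>2)" using assms by (auto simp: in_L2_def)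
  show "AE t in leb b. norm (v t) \<le> norm (1 + (norm (v t))\<^sup>2)"
  proof (rule AE_I2)
    fix t
    have "0 \<le> (norm (v t) - 1)\<^sup>2" by simp
    then show "norm (v t) \<le> norm (1 + (norm (v t))\<^sup>2)" by (simp add: power2_diff) (use norm_ge_zero[of "v t"] in linarith)
  qed
qed (use assms in \<open>auto simp: in_L2_def\<close>)

lemma has_W12_derivative_integrable: "has_W12_derivative b u v \<Longrightarrow> integrable (leb b) v"
  by (simp add: has_W12_derivative_def in_L2_integrable)

lemma has_W12_derivative_diff:
  assumes "has_W12_derivative b u v" "0 \<le> s" "s \<le> t" "t \<le> b"
  shows "u t - u s = (\<integral>x. v x \<partial>lebesgue_on {s..t})"
proof -
  have "integrable (lebesgue_on {0..t}) v"
    by (rule integrable_on_subinterval[OF has_W12_derivative_integrable[OF assms(1)]]) (use assms in auto)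
  from integral_interval_combine[OF this assms(2,3)]
  have "(\<integral>x. v x \<partial>lebesgue_on {0..t}) = (\<integral>x. v x \<partial>lebesgue_on {0..s}) + (\<integral>x. v x \<partial>lebesgue_on {s..t})" .
  moreover have "\<forall>t\<in>{0..b}. u t = u 0 + (\<integral>s. v s \<partial>lebesgue_on {0..t})"
    using assms(1) unfolding has_W12_derivative_def by blast
  then have "u t = u 0 + (\<integral>x. v x \<partial>lebesgue_on {0..t})" "u s = u 0 + (\<integral>x. v x \<partial>lebesgue_on {0..s})"
    using assms(2-4) by (meson atLeastAtMost_iff order_trans)+
  ultimately show ?thesis by (metis add_diff_cancel_left add_diff_cancel_left')
qed

lemma integral_interval_small:
  fixes f :: "real \<Rightarrow> real"
  assumes f: "integrable (lebesgue_on {a..b}) f" and t: "t \<in> {a..b}" and e: "e > 0"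
  obtains d where "d > 0"
    "\<And>c. c \<in> {a..b} \<Longrightarrow> c \<le> t \<Longrightarrow> t - c < d \<Longrightarrow> \<bar>\<integral>x. f x \<partial>lebesgue_on {c..t}\<bar> < e"
    "\<And>c. c \<in> {a..b} \<Longrightarrow> t \<le> c \<Longrightarrow> c - t < d \<Longrightarrow> \<bar>\<integral>x. f x \<partial>lebesgue_on {t..c}\<bar> < e"
proof -
  obtain d where d: "d > 0" "\<And>c. c \<in> {a..b} \<Longrightarrow> \<bar>c - t\<bar> < d \<Longrightarrow>
      \<bar>(\<integral>x. f x \<partial>lebesgue_on {a..c}) - (\<integral>x. f x \<partial>lebesgue_on {a..t})\<bar> < e"
    using indefinite_integral_continuous_real[OF f] t e unfolding continuous_on_iff dist_real_def by blast
  have comb: "(\<integral>x. f x \<partial>lebesgue_on {a..q}) - (\<integral>x. f x \<partial>lebesgue_on {a..p}) = (\<integral>x. f x \<partial>lebesgue_on {p..q})"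
    if "a \<le> p" "p \<le> q" "q \<le> b" for p q
    using integral_interval_combine[OF integrable_on_subinterval[OF f, of a q], of p] that by auto
  show ?thesis
  proof (rule that[OF d(1)])
    fix c assume c: "c \<in> {a..b}"
    show "\<bar>\<integral>x. f x \<partial>lebesgue_on {c..t}\<bar> < e" if "c \<le> t" "t - c < d"
      using d(2)[OF c] comb[of c t] that t c by auto
    show "\<bar>\<integral>x. f x \<partial>lebesgue_on {t..c}\<bar> < e" if "t \<le> c" "c - t < d"
      using d(2)[OF c] comb[of t c] that t c by auto
  qed
qed

lemma has_W12_derivative_continuous:
  assumes "has_W12_derivative b u v"
  shows "continuous_on {0..b} u"
  unfolding continuous_on_iff
proof (intro ballI allI impI)
  fix t e :: real assume t: "t \<in> {0..b}" and e: "e > 0"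
  have nv: "integrable (leb b) (\<lambda>x. norm (v x))"
    using has_W12_derivative_integrable[OF assms] by simp
  have le: "norm (u q - u p) \<le> \<bar>\<integral>x. norm (v x) \<partial>lebesgue_on {p..q}\<bar>" if "0 \<le> p" "p \<le> q" "q \<le> b" for p q
    unfolding has_W12_derivative_diff[OF assms that]
    using integral_norm_bound[of "lebesgue_on {p..q}" v] by linarith
  obtain d where d: "d > 0"
    "\<And>c. c \<in> {0..b} \<Longrightarrow> c \<le> t \<Longrightarrow> t - c < d \<Longrightarrow> \<bar>\<integral>x. norm (v x) \<partial>lebesgue_on {c..t}\<bar> < e"
    "\<And>c. c \<in> {0..b} \<Longrightarrow> t \<le> c \<Longrightarrow> c - t < d \<Longrightarrow> \<bar>\<integral>x. norm (v x) \<partial>lebesgue_on {t..c}\<bar> < e"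
    using integral_interval_small[OF nv t e] by metis
  show "\<exists>d>0. \<forall>x'\<in>{0..b}. dist x' t < d \<longrightarrow> dist (u x') (u t) < e"
  proof (intro exI conjI ballI impI)
    fix c assume c: "c \<in> {0..b}" "dist c t < d"
    show "dist (u c) (u t) < e"
    proof (cases "c \<le> t")
      case True
      then show ?thesis using le[of c t] d(2)[OF c(1)] c t by (auto simp: dist_norm norm_minus_commute)
    next
      case False
      then show ?thesis using le[of t c] d(3)[OF c(1)] c t by (auto simp: dist_norm)
    qed
  qed (fact d(1))
qed

text \<open>Reflection about 0 turns averages over {s-h..s} into averages over {-s..-s+h}, for which
  the differentiation theorem \<open>integrable_ccontinuous_explicit\<close> is stated; the
  exceptional set is reflected back.\<close>

lemma AE_left_average_real:
  fixes f :: "real \<Rightarrow> real"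
  assumes f: "integrable (leb b) f"
  shows "AE s in leb b. ((\<lambda>h. (1/h) * (\<integral>x. f x \<partial>lebesgue_on {s-h..s})) \<longlongrightarrow> f s) (at_right 0)"
proof -
  define g where "g x = indicator {0..b} (- x) * f (- x)" for x
  have f': "integrable lebesgue (\<lambda>x. indicator {0..b} x * f x)"
    using f by (simp add: integrable_restrict_space)
  have "integrable lebesgue g"
    using lebesgue_integrable_real_affine_iff[of "-1" "\<lambda>x. indicator {0..b} x * f x" 0] f'
    unfolding g_def by simp
  then have gi: "g integrable_on cbox p q" for p q
    using integrable_on_lebesgue integrable_on_subcbox by blast
  obtain N where N: "negligible N" "\<And>x e. x \<notin> N \<Longrightarrow> 0 < e \<Longrightarrow>
      \<exists>d>0. \<forall>h. 0 < h \<and> h < d \<longrightarrow> norm (integral (cbox x (x + h *\<^sub>R One)) g /\<^sub>R h ^ DIM(real) - g x) < e"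
    using integrable_ccontinuous_explicit[OF gi] by metis
  have "negligible (uminus ` N)" 
    by (rule negligible_differentiable_image_negligible[OF order_refl N(1)])
      (auto intro!: derivative_intros simp: differentiable_on_def)
  then have "uminus ` N \<in> null_sets lebesgue" by (simp add: negligible_iff_null_sets)
  then have "AE s in lebesgue. s \<notin> uminus ` N" by (rule AE_not_in)
  moreover have "AE s in lebesgue. s \<noteq> 0" by (rule AE_I'[of "{0}"]) auto
  ultimately have "AE s in lebesgue. s \<in> {0..b} \<longrightarrow>
      ((\<lambda>h. (1/h) * (\<integral>x. f x \<partial>lebesgue_on {s-h..s})) \<longlongrightarrow> f s) (at_right 0)"
  proof eventually_elim
    case (elim s)
    show ?case
    proof
      assume s: "s \<in> {0..b}"
      then have "s > 0" using elim by auto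
      have sN: "- s \<notin> N" using elim(1) by force
      have eq: "integral (cbox (- s) (- s + h *\<^sub>R One)) g = (\<integral>x. f x \<partial>lebesgue_on {s-h..s})"
        if "0 < h" "h < s" for h
      proof -
        have "integral (cbox (- s) (- s + h *\<^sub>R One)) g = integral {- s .. - (s - h)} g" by simp
        also have "\<dots> = integral {- s .. - (s - h)} (\<lambda>x. f (- x))"
          by (rule Henstock_Kurzweil_Integration.integral_cong) (use that s in \<open>auto simp: g_def\<close>)
        also have "\<dots> = integral {s - h..s} f" by (rule Henstock_Kurzweil_Integration.integral_reflect_real)
        also have "\<dots> = (\<integral>x. f x \<partial>lebesgue_on {s-h..s})"
          using integrable_on_subinterval[OF f, of "s - h" s] that s
          by (intro lebesgue_integral_eq_integral[symmetric]) auto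
        finally show ?thesis .
      qed
      show "((\<lambda>h. (1/h) * (\<integral>x. f x \<partial>lebesgue_on {s-h..s})) \<longlongrightarrow> f s) (at_right 0)"
      proof (rule tendstoI)
        fix e :: real assume "e > 0"
        then obtain d where d: "d > 0" "\<And>h. 0 < h \<Longrightarrow> h < d \<Longrightarrow>
            norm (integral (cbox (- s) (- s + h *\<^sub>R One)) g /\<^sub>R h ^ DIM(real) - g (- s)) < e"
          using N(2)[OF sN] by blast
        have "dist ((1/h) * (\<integral>x. f x \<partial>lebesgue_on {s-h..s})) (f s) < e" if "0 < h" "h < min d s" for h
          using d(2)[of h] eq[of h] that s by (simp add: g_def dist_norm divide_inverse mult.commute)
        then show "\<forall>\<^sub>F h in at_right 0. dist ((1/h) * (\<integral>x. f x \<partial>lebesgue_on {s-h..s})) (f s) < e"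
          unfolding eventually_at_right_field using d(1) \<open>s > 0\<close> by (intro exI[of _ "min d s"]) auto
      qed
    qed
  qed
  then show ?thesis by (simp only: AE_interval_iff)
qed

text \<open>Reduction to the scalar case: for all c in a countable dense set, the averages of norm
  (v - c) converge to norm (v s - c) outside one common null set, and c is then chosen close to v
  s.\<close>

lemma AE_left_average:
  fixes v :: "real \<Rightarrow> 'a::{banach, second_countable_topology}"
  assumes v: "integrable (leb b) v"
  shows "AE s in leb b. ((\<lambda>h. (1/h) *\<^sub>R (\<integral>x. v x \<partial>lebesgue_on {s-h..s})) \<longlongrightarrow> v s) (at_right 0)"
proof -
  interpret finite_measure "leb b" by (rule finite_measure_lebesgue_on) simp
  obtain D :: "'a set" where D: "countable D" "\<And>U. open U \<Longrightarrow> U \<noteq> {} \<Longrightarrow> \<exists>d\<in>D. d \<in> U"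
    using countable_dense_setE by metis
  have "AE s in leb b. \<forall>c\<in>D.
      ((\<lambda>h. (1/h) * (\<integral>x. norm (v x - c) \<partial>lebesgue_on {s-h..s})) \<longlongrightarrow> norm (v s - c)) (at_right 0)"
    unfolding AE_ball_countable[OF D(1)]
  proof
    fix c assume "c \<in> D"
    show "AE s in leb b. ((\<lambda>h. (1/h) * (\<integral>x. norm (v x - c) \<partial>lebesgue_on {s-h..s})) \<longlongrightarrow> norm (v s - c)) (at_right 0)"
      by (rule AE_left_average_real) (use v in simp)
  qed
  moreover have "AE s in leb b. s \<in> {0..b}" by (rule AE_I2) simp
  moreover have "AE s in leb b. s \<noteq> 0"
    unfolding AE_interval_iff by (rule AE_I'[of "{0}"]) auto
  ultimately show ?thesis
  proof eventually_elim
    case (elim s)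
    then have s: "0 < s" "s \<le> b" by auto
    show ?case
    proof (rule tendstoI)
      fix e :: real assume e: "e > 0"
      obtain c where c: "c \<in> D" "dist c (v s) < e / 3"
        using D(2)[of "ball (v s) (e/3)"] e by (auto simp: dist_commute)
      have "\<forall>\<^sub>F h in at_right 0. (1/h) * (\<integral>x. norm (v x - c) \<partial>lebesgue_on {s-h..s}) < 2 * e / 3"
        by (rule order_tendstoD(2)[of _ "norm (v s - c)"])
          (use elim(1) c e norm_minus_commute[of "v s" c] in \<open>auto simp: dist_norm\<close>)
      moreover have "\<forall>\<^sub>F h in at_right 0. h \<in> {0<..<s}"
        using eventually_at_right[of 0 "0 + s"] s by (auto simp: eventually_at_right_field)
      ultimately show "\<forall>\<^sub>F h in at_right 0. dist ((1/h) *\<^sub>R (\<integral>x. v x \<partial>lebesgue_on {s-h..s})) (v s) < e"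
      proof eventually_elim
        case (elim h)
        interpret J: finite_measure "lebesgue_on {s-h..s}" by (rule finite_measure_lebesgue_on) simp
        have vi: "integrable (lebesgue_on {s-h..s}) v"
          by (rule integrable_on_subinterval[OF v]) (use elim s in auto)
        \<comment> \<open>The average of the constant c is c, so the average of v deviates from c by
          at most the average of norm (v - c).\<close>
        have "(\<integral>x. c \<partial>lebesgue_on {s-h..s}) = h *\<^sub>R c"
          using elim by (simp add: measure_restrict_space)
        then have "(1/h) *\<^sub>R (\<integral>x. v x - c \<partial>lebesgue_on {s-h..s}) = (1/h) *\<^sub>R (\<integral>x. v x \<partial>lebesgue_on {s-h..s}) - c"
          using vi elim
          by (simp add: scaleR_diff_right Bochner_Integration.integral_diff del: lebesgue_integral_const)
        then have "norm ((1/h) *\<^sub>R (\<integral>x. v x \<partial>lebesgue_on {s-h..s}) - c)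
            = (1/h) * norm (\<integral>x. v x - c \<partial>lebesgue_on {s-h..s})"
          using elim by (metis abs_of_nonneg divide_nonneg_pos greaterThanLessThan_iff norm_scaleR zero_le_one)
        also have "\<dots> \<le> (1/h) * (\<integral>x. norm (v x - c) \<partial>lebesgue_on {s-h..s})"
          using elim by (intro mult_left_mono integral_norm_bound) auto
        also have "\<dots> < 2 * e / 3" by (fact elim)
        finally have "dist ((1/h) *\<^sub>R (\<integral>x. v x \<partial>lebesgue_on {s-h..s})) c < 2 * e / 3"
          by (simp add: dist_norm)
        then show ?case using c(2) dist_triangle[of "(1/h) *\<^sub>R (\<integral>x. v x \<partial>lebesgue_on {s-h..s})" "v s" c]
          by linarith
      qed
    qed
  qed
qed

lemma has_W12_derivative_left_derivative:
  assumes u: "has_W12_derivative b u v"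
  shows "AE s in leb b. ((\<lambda>h. (1/h) *\<^sub>R (u s - u (s - h))) \<longlongrightarrow> v s) (at_right 0)"
proof -
  have "AE s in leb b. s \<in> {0..b}" by (rule AE_I2) simp
  moreover have "AE s in leb b. s \<noteq> 0"
    unfolding AE_interval_iff by (rule AE_I'[of "{0}"]) auto
  moreover note AE_left_average[OF has_W12_derivative_integrable[OF u]]
  ultimately show ?thesis
  proof eventually_elim
    case (elim s)
    have "\<forall>\<^sub>F h in at_right 0. (1/h) *\<^sub>R (\<integral>x. v x \<partial>lebesgue_on {s-h..s}) = (1/h) *\<^sub>R (u s - u (s - h))"
      unfolding eventually_at_right_field
      using elim has_W12_derivative_diff[OF u, of _ s] by (intro exI[of _ s]) auto
    then show ?case using elim(3) by (rule Lim_transform_eventually[rotated])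
  qed
qed

subsection \<open>Velocity bound for the monotone inclusion\<close>

text \<open>If N exceeded 3 S / \<kappa>, then S \<le> N, so the right-hand side would be at most 3
  N S and hence below \<kappa> N^2. In the velocity bound N is the speed and S collects the
  data.\<close>

lemma quadratic_bound:
  fixes N S \<kappa> :: real
  assumes "\<kappa> * N\<^sup>2 \<le> 2 * N * S + S\<^sup>2" "0 < \<kappa>" "\<kappa> \<le> 1" "0 \<le> N" "0 \<le> S"
  shows "N \<le> 3 / \<kappa> * S"
proof (rule ccontr)
  assume "\<not> N \<le> 3 / \<kappa> * S"
  then have *: "3 * S < \<kappa> * N" using assms by (simp add: field_simps)
  have "\<kappa> * N \<le> N" using assms by (simp add: mult_left_le_one_le)
  then have "S \<le> N" "0 < N" using * assms by linarith+
  have "2 * N * S + S\<^sup>2 \<le> N * (3 * S)"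
    using mult_right_mono[OF \<open>S \<le> N\<close> assms(5)] by (simp add: power2_eq_square)
  also have "\<dots> < N * (\<kappa> * N)" using * \<open>0 < N\<close> by (rule mult_strict_left_mono)
  also have "\<dots> = \<kappa> * N\<^sup>2" by (simp add: power2_eq_square)
  finally show False using assms(1) by simp
qed

text \<open>At a point \<open>s\<close> of left differentiability of \<open>u\<close> and \<open>\<theta>\<close>, compare the operator at \<open>s\<close> with the
  minimal sections at earlier times \<open>t \<rightarrow> s\<close>. Only earlier times give the term \<open>\<parallel>u'(s)\<parallel>\<^sup>2\<close> the
  right sign, and \<open>lam < 1\<close> absorbs the state dependence.\<close>

lemma evolution_derivative_bound:
  fixes A :: "real \<Rightarrow> 'h::{real_inner, banach, second_countable_topology} \<Rightarrow> 'h \<Rightarrow> 'h set"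
  assumes mm: "\<And>t u. t \<in> {0..b} \<Longrightarrow> maximal_monotone (A t u)"
    and dis: "\<And>t s u v. t \<in> {0..b} \<Longrightarrow> s \<in> {0..b} \<Longrightarrow>
      dis (A t u) (A s v) \<le> ereal (\<bar>\<theta> t - \<theta> s\<bar> + lam * norm (u - v))"
    and lam: "0 \<le> lam" "lam < 1"
    and MB: "\<And>t u v. t \<in> {0..b} \<Longrightarrow> v \<in> op_dom (A t u) \<Longrightarrow>
      norm (minimal_section (A t u) v) \<le> MB * (1 + norm u + norm v)" "0 \<le> MB"
    and \<theta>: "has_W12_derivative b \<theta> \<theta>'"
    and u: "has_W12_derivative b u u'"
    and incl: "AE t in leb b. - u' t + g t \<in> A t (u t) (u t)"
  shows "AE t in leb b. norm (u' t)
    \<le> 3 * (1 + 2 * MB) / (1 - lam) * (1 + norm (g t) + norm (u t) + \<bar>\<theta>' t\<bar>)"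
proof -
  have "AE s in leb b. s \<in> {0..b}" by (rule AE_I2) simp
  moreover have "AE s in leb b. s \<noteq> 0"
    unfolding AE_interval_iff by (rule AE_I'[of "{0}"]) auto
  moreover note has_W12_derivative_left_derivative[OF u] has_W12_derivative_left_derivative[OF \<theta>] incl
  ultimately show ?thesis
  proof eventually_elim
    case (elim s)
    then have s: "0 < s" "s \<le> b" by auto
    define Y where "Y = - u' s + g s"
    \<comment> \<open>The inclusion is known only almost everywhere, so the earlier times are chosen
      among those where it holds.\<close>
    have "\<exists>t. s - s / real (Suc (Suc n)) < t \<and> t < s \<and> - u' t + g t \<in> A t (u t) (u t)" for n
      by (rule AE_interval_ex[OF incl]) (use s in \<open>auto simp: field_simps\<close>)
    then obtain t where t: "\<And>n. s - s / real (Suc (Suc n)) < t n" "\<And>n. t n < s"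
      "\<And>n. - u' (t n) + g (t n) \<in> A (t n) (u (t n)) (u (t n))" by metis
    have t0: "0 < t n" for n
    proof -
      have "s / real (Suc (Suc n)) \<le> s" using s by (simp add: field_simps)
      then show ?thesis using t(1)[of n] by linarith
    qed
    have tb: "t n \<in> {0..b}" for n using t0[of n] t(2)[of n] s by auto
    have lim0: "(\<lambda>n. s / real (Suc (Suc n))) \<longlonglongrightarrow> 0"
      using tendsto_mult[OF tendsto_const[of s] LIMSEQ_Suc[OF LIMSEQ_Suc[OF lim_1_over_n]]] by simp
    have h0: "(\<lambda>n. s - t n) \<longlonglongrightarrow> 0"
      by (rule tendsto_sandwich[OF _ _ tendsto_const lim0])
        (use t(1,2) less_imp_le in \<open>auto intro!: always_eventually simp: algebra_simps\<close>)
    have hr: "filterlim (\<lambda>n. s - t n) (at_right 0) sequentially"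
      using h0 t(2) by (auto simp: filterlim_at intro!: always_eventually)
    define D where "D n = (1 / (s - t n)) *\<^sub>R (u s - u (t n))" for n
    define E where "E n = (1 / (s - t n)) *\<^sub>R (\<theta> s - \<theta> (t n))" for n
    have D: "D \<longlonglongrightarrow> u' s" using filterlim_compose[OF elim(3) hr] by (simp add: D_def[abs_def])
    have E: "E \<longlonglongrightarrow> \<theta>' s" using filterlim_compose[OF elim(4) hr] by (simp add: E_def[abs_def])
    have ts: "t \<longlonglongrightarrow> s" using tendsto_diff[OF tendsto_const[of s] h0] by simp
    have ut: "(\<lambda>n. u (t n)) \<longlonglongrightarrow> u s"
      using has_W12_derivative_continuous[OF u] ts tb s
      by (intro continuous_on_tendsto_compose[of "{0..b}" u]) auto
    define C where "C n = MB * (1 + norm (u (t n)) + norm (u (t n)))" for n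
    have Clim: "C \<longlonglongrightarrow> MB * (1 + norm (u s) + norm (u s))"
      unfolding C_def by (intro tendsto_intros ut)
    have ineq: "- (Y \<bullet> D n) \<le> C n * norm (D n) + (1 + norm Y + C n) * (\<bar>E n\<bar> + lam * norm (D n))" for n
    proof -
      define h where "h = s - t n"
      have h: "h > 0" using t(2)[of n] by (simp add: h_def)
      have dom: "u (t n) \<in> op_dom (A (t n) (u (t n)))" using t(3)[of n] by (auto simp: op_dom_def)
      define y where "y = minimal_section (A (t n) (u (t n))) (u (t n))"
      have y: "y \<in> A (t n) (u (t n)) (u (t n))"
        unfolding y_def by (rule minimal_section_mem[OF mm[OF tb] dom])
      have yC: "norm y \<le> C n" unfolding y_def C_def by (rule MB(1)[OF tb dom])
      have uD: "u s - u (t n) = h *\<^sub>R D n" and tE: "\<theta> s - \<theta> (t n) = h * E n"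
        using h by (simp_all add: D_def E_def h_def)
      \<comment> \<open>The test uses Y at time s and the minimal section y, whose norm is
        controlled, at time \<open>t n\<close>. The increments of u and \<theta> both carry the
        factor h, which is then divided out.\<close>
      have "(Y - y) \<bullet> (u (t n) - u s) \<le> (1 + norm Y + norm y) * (\<bar>\<theta> s - \<theta> (t n)\<bar> + lam * norm (u s - u (t n)))"
        by (rule dis_leD[OF dis]) (use elim tb y in \<open>auto simp: Y_def\<close>)
      moreover have "u (t n) - u s = - (h *\<^sub>R D n)" using uD by (metis minus_diff_eq)
      ultimately have "h * (- ((Y - y) \<bullet> D n)) \<le> (1 + norm Y + norm y) * (\<bar>h * E n\<bar> + lam * norm (h *\<^sub>R D n))"
        unfolding uD tE by simp
      also have "\<dots> = h * ((1 + norm Y + norm y) * (\<bar>E n\<bar> + lam * norm (D n)))"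
        using h by (simp add: abs_mult algebra_simps)
      finally have "- ((Y - y) \<bullet> D n) \<le> (1 + norm Y + norm y) * (\<bar>E n\<bar> + lam * norm (D n))"
        using h by (simp only: mult_le_cancel_left_pos)
      then have "- (Y \<bullet> D n) \<le> - (y \<bullet> D n) + (1 + norm Y + norm y) * (\<bar>E n\<bar> + lam * norm (D n))"
        by (simp add: inner_diff_left)
      also have "- (y \<bullet> D n) \<le> norm y * norm (D n)"
        using Cauchy_Schwarz_ineq2[of y "D n"] by linarith
      also have "norm y * norm (D n) \<le> C n * norm (D n)" using yC by (intro mult_right_mono) auto
      also have "(1 + norm Y + norm y) * (\<bar>E n\<bar> + lam * norm (D n))
          \<le> (1 + norm Y + C n) * (\<bar>E n\<bar> + lam * norm (D n))"
        using yC lam by (intro mult_right_mono) auto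
      finally show ?thesis by simp
    qed
    define c where "c = MB * (1 + norm (u s) + norm (u s))"
    define N where "N = norm (u' s)"
    define a where "a = norm (g s)"
    define \<tau> where "\<tau> = \<bar>\<theta>' s\<bar>"
    have nonneg: "0 \<le> c" "0 \<le> N" "0 \<le> a" "0 \<le> \<tau>"
      using MB(2) by (auto simp: c_def N_def a_def \<tau>_def)
    have "(\<lambda>n. - (Y \<bullet> D n)) \<longlonglongrightarrow> - (Y \<bullet> u' s)" by (intro tendsto_intros D)
    moreover have "(\<lambda>n. C n * norm (D n) + (1 + norm Y + C n) * (\<bar>E n\<bar> + lam * norm (D n)))
        \<longlonglongrightarrow> c * N + (1 + norm Y + c) * (\<tau> + lam * N)"
      unfolding c_def N_def \<tau>_def by (intro tendsto_intros D E Clim)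
    ultimately have "- (Y \<bullet> u' s) \<le> c * N + (1 + norm Y + c) * (\<tau> + lam * N)"
      using ineq by (intro LIMSEQ_le) auto
    moreover have "- (Y \<bullet> u' s) = N\<^sup>2 - g s \<bullet> u' s"
      by (simp add: Y_def N_def inner_diff_left power2_norm_eq_inner)
    moreover have "g s \<bullet> u' s \<le> a * N" unfolding a_def N_def by (rule norm_cauchy_schwarz)
    moreover have "norm Y \<le> N + a"
      unfolding Y_def N_def a_def using norm_triangle_ineq[of "- u' s" "g s"] by simp
    then have "(1 + norm Y + c) * (\<tau> + lam * N) \<le> (1 + (N + a) + c) * (\<tau> + lam * N)"
      using nonneg lam by (intro mult_right_mono) auto
    ultimately have "N\<^sup>2 \<le> a * N + c * N + (1 + (N + a) + c) * (\<tau> + lam * N)" by linarith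
    \<comment> \<open>The product of the N coming from norm Y with lam * N moves to the left and
      leaves the factor 1 - lam.\<close>
    then have q: "(1 - lam) * N\<^sup>2 \<le> N * (a + c + \<tau>) + lam * (N * (1 + a + c)) + (1 + a + c) * \<tau>"
      by (simp add: algebra_simps power2_eq_square)
    define S where "S = 1 + a + c + \<tau>"
    have "lam * (N * (1 + a + c)) \<le> N * (1 + a + c)"
      using nonneg lam by (intro mult_left_le_one_le) auto
    also have "\<dots> \<le> N * S" unfolding S_def using nonneg by (intro mult_left_mono) auto
    also have "N * (a + c + \<tau>) \<le> N * S" unfolding S_def using nonneg by (intro mult_left_mono) auto
    moreover have "(1 + a + c) * \<tau> \<le> S * S"
      unfolding S_def using nonneg by (intro mult_mono) auto
    ultimately have "(1 - lam) * N\<^sup>2 \<le> 2 * N * S + S\<^sup>2"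
      using q by (simp add: power2_eq_square)
    then have "N \<le> 3 / (1 - lam) * S"
      using quadratic_bound[of "1 - lam" N S] lam nonneg by (auto simp: S_def)
    \<comment> \<open>c equals MB * (1 + 2 * norm (u s)), whence the factor 1 + 2 * MB.\<close>
    also have "S \<le> (1 + 2 * MB) * (1 + a + norm (u s) + \<tau>)"
    proof -
      have "0 \<le> MB * a" "0 \<le> MB * \<tau>" "0 \<le> MB" using MB(2) nonneg by auto
      then show ?thesis by (simp add: S_def c_def algebra_simps)
    qed
    then have "3 / (1 - lam) * S \<le> 3 / (1 - lam) * ((1 + 2 * MB) * (1 + a + norm (u s) + \<tau>))"
      using lam by (intro mult_left_mono) auto
    finally show ?case
      by (simp add: N_def a_def \<tau>_def mult.assoc del: distrib_left_numeral)
  qed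
qed

subsection \<open>Convolution with a compact semigroup\<close>

text \<open>For p < q the increment is \<open>T p\<close> applied to \<open>T (q - p) x - x\<close>.
  Continuity at 0 and the uniform bound therefore control increments on either side of a
  point.\<close>

lemma C0_semigroup_continuous_on:
  fixes T :: "real \<Rightarrow> 'a::real_normed_vector \<Rightarrow>\<^sub>L 'a"
  assumes T: "C0_semigroup T" and M: "\<And>t. t \<in> {0..b} \<Longrightarrow> norm (T t) \<le> M"
  shows "continuous_on {0..b} (\<lambda>t. blinfun_apply (T t) x)"
proof (cases "b \<ge> 0")
  case True
  have M0: "0 \<le> M" using M[of 0] True norm_ge_zero order_trans by (metis atLeastAtMost_iff order_refl)
  show ?thesis
    unfolding continuous_on_iff
  proof (intro ballI allI impI)
    fix t e :: real assume t: "t \<in> {0..b}" and e: "e > 0"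
    have "((\<lambda>t. blinfun_apply (T t) x) \<longlongrightarrow> x) (at_right 0)" using T by (simp add: C0_semigroup_def)
    then have "\<forall>\<^sub>F h in at_right 0. dist (blinfun_apply (T h) x) x < e / (M + 1)"
      by (rule tendstoD) (use e M0 in auto)
    then obtain d where d: "d > 0" "\<And>h. 0 < h \<Longrightarrow> h < d \<Longrightarrow> dist (blinfun_apply (T h) x) x < e / (M + 1)"
      by (auto simp: eventually_at_right_field)
    have le: "dist (blinfun_apply (T q) x) (blinfun_apply (T p) x) < e"
      if "p \<in> {0..b}" "q \<in> {0..b}" "p < q" "q - p < d" for p q
    proof -
      have "T (p + (q - p)) = T p o\<^sub>L T (q - p)"
        using T that unfolding C0_semigroup_def by (metis atLeastAtMost_iff diff_ge_0_iff_ge less_imp_le)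
      then have "T q = T p o\<^sub>L T (q - p)" by simp
      then have "blinfun_apply (T q) x - blinfun_apply (T p) x
          = blinfun_apply (T p) (blinfun_apply (T (q - p)) x - x)"
        by (simp add: blinfun.diff_right)
      then have "dist (blinfun_apply (T q) x) (blinfun_apply (T p) x)
          \<le> norm (T p) * norm (blinfun_apply (T (q - p)) x - x)"
        by (metis dist_norm norm_blinfun)
      also have "\<dots> \<le> M * norm (blinfun_apply (T (q - p)) x - x)"
        by (intro mult_right_mono M that) simp
      also have "\<dots> \<le> M * (e / (M + 1))"
        using d(2)[of "q - p"] that M0 by (intro mult_left_mono) (auto simp: dist_norm)
      also have "\<dots> < e" using e M0 by (simp add: field_simps)
      finally show ?thesis .
    qed
    show "\<exists>d>0. \<forall>x'\<in>{0..b}. dist x' t < d \<longrightarrow> dist (blinfun_apply (T x') x) (blinfun_apply (T t) x) < e"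
    proof (intro exI conjI ballI impI)
      fix s assume s: "s \<in> {0..b}" "dist s t < d"
      show "dist (blinfun_apply (T s) x) (blinfun_apply (T t) x) < e"
        using le[of s t] le[of t s] s t e
        by (cases s t rule: linorder_cases) (auto simp: dist_real_def dist_commute)
    qed (fact d(1))
  qed
qed auto

text \<open>Strong continuity handles the time variable and the uniform bound the space variable.
  Joint continuity is what makes the integrand of the mild formula measurable.\<close>

lemma continuous_on_blinfun_pair:
  fixes T :: "'t::metric_space \<Rightarrow> 'a::real_normed_vector \<Rightarrow>\<^sub>L 'b::real_normed_vector"
  assumes c: "\<And>x. continuous_on S (\<lambda>t. blinfun_apply (T t) x)"
    and M: "\<And>t. t \<in> S \<Longrightarrow> norm (T t) \<le> M"
  shows "continuous_on (S \<times> UNIV) (\<lambda>p. blinfun_apply (T (fst p)) (snd p))"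
  unfolding continuous_on_sequentially
proof (intro allI ballI impI)
  fix z :: "nat \<Rightarrow> 't \<times> 'a" and p :: "'t \<times> 'a"
  assume p: "p \<in> S \<times> UNIV" and z: "(\<forall>n. z n \<in> S \<times> UNIV) \<and> z \<longlonglongrightarrow> p"
  obtain t x where [simp]: "p = (t, x)" by (cases p)
  have t: "t \<in> S" and zS: "\<And>n. fst (z n) \<in> S" using p z by (auto simp: mem_Times_iff)
  have "z \<longlonglongrightarrow> (t, x)" using z by simp
  then have z1: "(\<lambda>n. fst (z n)) \<longlonglongrightarrow> t" and z2: "(\<lambda>n. snd (z n)) \<longlonglongrightarrow> x"
    using tendsto_fst tendsto_snd by fastforce+
  have 1: "(\<lambda>n. blinfun_apply (T (fst (z n))) x) \<longlonglongrightarrow> blinfun_apply (T t) x"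
    by (rule continuous_on_tendsto_compose[OF c z1 t]) (simp add: zS)
  have "(\<lambda>n. M * norm (snd (z n) - x)) \<longlonglongrightarrow> M * norm (x - x)" by (intro tendsto_intros z2)
  then have lim: "(\<lambda>n. M * norm (snd (z n) - x)) \<longlonglongrightarrow> 0" by simp
  have le: "norm (blinfun_apply (T (fst (z n))) (snd (z n) - x)) \<le> M * norm (snd (z n) - x)" for n
    using norm_blinfun[of "T (fst (z n))" "snd (z n) - x"]
      mult_right_mono[OF M[OF zS[of n]], of "norm (snd (z n) - x)"] by simp
  have 2: "(\<lambda>n. blinfun_apply (T (fst (z n))) (snd (z n) - x)) \<longlonglongrightarrow> 0"
    by (rule Lim_null_comparison[OF always_eventually lim]) (use le in blast)
  from tendsto_add[OF 1 2]
  show "((\<lambda>p. blinfun_apply (T (fst p)) (snd p)) \<circ> z) \<longlonglongrightarrow> blinfun_apply (T (fst p)) (snd p)"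
    by (simp add: o_def blinfun.diff_right)
qed

locale bounded_C0_semigroup =
  fixes T :: "real \<Rightarrow> 'e::{real_inner, banach, second_countable_topology} \<Rightarrow>\<^sub>L 'e" and b M :: real
  assumes b: "b > 0" and semigroup: "C0_semigroup T"
    and bound: "\<And>t. t \<in> {0..b} \<Longrightarrow> norm (T t) \<le> M"
begin

lemma M_nonneg: "0 \<le> M"
  using order_trans[OF norm_ge_zero bound[of 0]] b by simp

lemma norm_T_apply_le: "t \<in> {0..b} \<Longrightarrow> norm (blinfun_apply (T t) x) \<le> M * norm x"
  using norm_blinfun[of "T t" x] mult_right_mono[OF bound[of t], of "norm x"] by simp

lemma T_add_apply: "0 \<le> s \<Longrightarrow> 0 \<le> t \<Longrightarrow> blinfun_apply (T (s + t)) x = blinfun_apply (T s) (blinfun_apply (T t) x)"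
  using semigroup unfolding C0_semigroup_def by (metis blinfun_apply_blinfun_compose)

lemma T_0_apply [simp]: "blinfun_apply (T 0) x = x"
  using semigroup by (simp add: C0_semigroup_def)

lemma continuous_T: "continuous_on {0..b} (\<lambda>t. blinfun_apply (T t) x)"
  using C0_semigroup_continuous_on[OF semigroup bound] .

text \<open>The integrand is a jointly continuous map on a closed strip, cut off outside, composed
  with s -> (s, h s). The cut-off removes s > t, where \<open>T (t - s)\<close> has a negative
  argument and nothing is known.\<close>

lemma measurable_T_apply:
  assumes "h \<in> borel_measurable (leb b)" "t \<in> {0..b}"
  shows "(\<lambda>s. indicator {0..t} s *\<^sub>R T (t - s) (h s)) \<in> borel_measurable (leb b)"
proof -
  define \<Phi> where "\<Phi> p = indicator ({0..t} \<times> UNIV) p *\<^sub>R blinfun_apply (T (t - fst p)) (snd p)"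
    for p :: "real \<times> 'e"
  have "continuous_on ({0..t} \<times> UNIV) (\<lambda>p. blinfun_apply (T (t - fst p)) (snd p))"
  proof (rule continuous_on_blinfun_pair[where M = M])
    show "continuous_on {0..t} (\<lambda>s. blinfun_apply (T (t - s)) x)" for x
      by (rule continuous_on_compose2[OF continuous_T]) (use assms in \<open>auto intro!: continuous_intros\<close>)
  qed (use bound assms in auto)
  then have "\<Phi> \<in> borel_measurable borel"
    unfolding \<Phi>_def by (intro borel_measurable_continuous_on_indicator borel_closed closed_Times) auto
  moreover have "(\<lambda>s. (s, h s)) \<in> borel_measurable (leb b)"
  proof (rule borel_measurable_Pair)
    show "(\<lambda>s. s) \<in> borel_measurable (leb b)"
      by (intro measurable_restrict_space1 measurable_completion) simp
  qed (fact assms(1))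
  ultimately have "(\<lambda>s. \<Phi> (s, h s)) \<in> borel_measurable (leb b)" by (rule measurable_compose[rotated])
  then show ?thesis by (simp add: \<Phi>_def indicator_def mem_Times_iff)
qed

lemma norm_indicator_T_le:
  assumes "t \<in> {0..b}" 
  shows "norm (indicator {0..t} s *\<^sub>R blinfun_apply (T (t - s)) y) \<le> M * norm y"
  using norm_T_apply_le[of "t - s" y] assms M_nonneg by (auto simp: indicator_def)

definition convol :: "(real \<Rightarrow> 'e) \<Rightarrow> real \<Rightarrow> 'e" where
  "convol h t = (\<integral>s. T (t - s) (h s) \<partial>lebesgue_on {0..t})"

text \<open>A fixed interval of integration lets dominated convergence and the averaging of
  integrals work with one measure for all t.\<close>

lemma convol_eq:
  "t \<in> {0..b} \<Longrightarrow> convol h t = (\<integral>s. indicator {0..t} s *\<^sub>R T (t - s) (h s) \<partial>leb b)"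
  unfolding convol_def by (rule integral_subinterval_eq) auto

lemma integrable_indicator_T:
  assumes "integrable (leb b) h" "t \<in> {0..b}"
  shows "integrable (leb b) (\<lambda>s. indicator {0..t} s *\<^sub>R T (t - s) (h s))"
  by (rule Bochner_Integration.integrable_bound[of _ "\<lambda>s. M * norm (h s)"])
    (use assms measurable_T_apply norm_indicator_T_le M_nonneg in \<open>auto intro!: AE_I2\<close>)

lemma integrable_T:
  assumes "integrable (leb b) h" "t \<in> {0..b}"
  shows "integrable (lebesgue_on {0..t}) (\<lambda>s. T (t - s) (h s))"
proof -
  have "integrable lebesgue (\<lambda>s. indicator {0..b} s *\<^sub>R (indicator {0..t} s *\<^sub>R T (t - s) (h s)))"
    using integrable_indicator_T[OF assms] by (simp add: integrable_restrict_space)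
  moreover have "(\<lambda>s. indicator {0..b} s *\<^sub>R (indicator {0..t} s *\<^sub>R T (t - s) (h s)))
      = (\<lambda>s. indicator {0..t} s *\<^sub>R T (t - s) (h s))"
    using assms(2) by (auto simp: indicator_def fun_eq_iff)
  ultimately show ?thesis by (simp add: integrable_restrict_space)
qed

lemma norm_convol_le:
  assumes "integrable (leb b) h" "t \<in> {0..b}"
  shows "norm (convol h t) \<le> M * (\<integral>s. norm (h s) \<partial>lebesgue_on {0..t})"
proof -
  have hi: "integrable (lebesgue_on {0..t}) (\<lambda>s. M * norm (h s))"
    using integrable_on_subinterval[OF assms(1), of 0 t] assms(2) by auto
  have "norm (convol h t) \<le> (\<integral>s. M * norm (h s) \<partial>lebesgue_on {0..t})"
    unfolding convol_def
    by (rule norm_integral_le_bound[OF hi]) (use assms(2) in \<open>auto intro!: AE_I2 norm_T_apply_le\<close>)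
  then show ?thesis by simp
qed

lemma continuous_convol:
  assumes h: "integrable (leb b) h"
  shows "continuous_on {0..b} (convol h)"
  unfolding continuous_on_sequentially
proof (intro allI ballI impI)
  fix z :: "nat \<Rightarrow> real" and t
  assume t: "t \<in> {0..b}" and z: "(\<forall>n. z n \<in> {0..b}) \<and> z \<longlonglongrightarrow> t"
  have "(\<lambda>n. \<integral>s. indicator {0..z n} s *\<^sub>R blinfun_apply (T (z n - s)) (h s) \<partial>leb b)
    \<longlonglongrightarrow> (\<integral>s. indicator {0..t} s *\<^sub>R T (t - s) (h s) \<partial>leb b)"
  proof (rule integral_dominated_convergence[where w = "\<lambda>s. M * norm (h s)"])
    have "AE s in leb b. s \<noteq> t" unfolding AE_interval_iff by (rule AE_I'[of "{t}"]) auto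
    moreover have "AE s in leb b. s \<in> {0..b}" by (rule AE_I2) simp
    ultimately show "AE s in leb b. (\<lambda>n. indicator {0..z n} s *\<^sub>R blinfun_apply (T (z n - s)) (h s))
        \<longlonglongrightarrow> indicator {0..t} s *\<^sub>R T (t - s) (h s)"
    proof eventually_elim
      case (elim s)
      show ?case
      proof (cases "s < t")
        case True
        then have ev: "\<forall>\<^sub>F n in sequentially. s < z n" using z by (auto intro: order_tendstoD)
        \<comment> \<open>Replacing the finitely many \<open>z n\<close> that are at most s keeps
          the argument of T in {0..b} for every n.\<close>
        define z' where "z' n = (if s < z n then z n else t)" for n
        have z': "0 \<le> z' n - s" "z' n - s \<le> b" for n
          using z t elim True by (auto simp: z'_def) (smt (verit))
        have ev': "\<forall>\<^sub>F n in sequentially. z n = z' n"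
          using ev by eventually_elim (simp add: z'_def)
        have z't: "z' \<longlonglongrightarrow> t" using z ev' by (auto intro: Lim_transform_eventually)
        have "(\<lambda>n. blinfun_apply (T (z' n - s)) (h s)) \<longlonglongrightarrow> T (t - s) (h s)"
          by (rule continuous_on_tendsto_compose[OF continuous_T])
            (use tendsto_diff[OF z't tendsto_const] z' t elim True in \<open>auto intro!: always_eventually\<close>)
        moreover have "\<forall>\<^sub>F n in sequentially. blinfun_apply (T (z' n - s)) (h s)
            = indicator {0..z n} s *\<^sub>R blinfun_apply (T (z n - s)) (h s)"
          using ev by eventually_elim (use elim in \<open>auto simp: z'_def\<close>)
        ultimately have "(\<lambda>n. indicator {0..z n} s *\<^sub>R blinfun_apply (T (z n - s)) (h s))
            \<longlonglongrightarrow> T (t - s) (h s)" by (rule Lim_transform_eventually)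
        then show ?thesis using True elim by simp
      next
        case False
        then have "t < s" using elim by auto
        then have "\<forall>\<^sub>F n in sequentially. z n < s" using z by (auto intro: order_tendstoD)
        then have "\<forall>\<^sub>F n in sequentially. 0 = indicator {0..z n} s *\<^sub>R blinfun_apply (T (z n - s)) (h s)"
          by eventually_elim simp
        then have "(\<lambda>n. indicator {0..z n} s *\<^sub>R blinfun_apply (T (z n - s)) (h s)) \<longlonglongrightarrow> 0"
          by (rule Lim_transform_eventually[OF tendsto_const])
        then show ?thesis using \<open>t < s\<close> by simp
      qed
    qed
  qed (use h t z measurable_T_apply norm_indicator_T_le in \<open>auto intro!: AE_I2\<close>)
  then show "(convol h \<circ> z) \<longlonglongrightarrow> convol h t" using t z by (simp add: o_def convol_eq)
qed

text \<open>By the semigroup law \<open>T (\<tau> - \<sigma>)\<close> carries the convolution up to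
  \<sigma> to the part over {0..\<sigma>} of the integral at \<tau>. Only the integral over
  {\<sigma>..\<tau>} remains, and m bounds it uniformly in h.\<close>

lemma convol_split:
  assumes h: "integrable (leb b) h" and m: "integrable (leb b) m" "AE s in leb b. norm (h s) \<le> m s"
    and st: "0 \<le> \<sigma>" "\<sigma> \<le> \<tau>" "\<tau> \<le> b"
  shows "norm (convol h \<tau> - blinfun_apply (T (\<tau> - \<sigma>)) (convol h \<sigma>)) \<le> M * (\<integral>s. m s \<partial>lebesgue_on {\<sigma>..\<tau>})"
proof -
  have i: "integrable (lebesgue_on {0..\<tau>}) (\<lambda>s. T (\<tau> - s) (h s))"
    by (rule integrable_T[OF h]) (use st in auto)
  have "blinfun_apply (T (\<tau> - \<sigma>)) (convol h \<sigma>)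
      = (\<integral>s. blinfun_apply (T (\<tau> - \<sigma>)) (blinfun_apply (T (\<sigma> - s)) (h s)) \<partial>lebesgue_on {0..\<sigma>})"
    unfolding convol_def
    by (rule integral_bounded_linear[symmetric, OF blinfun.bounded_linear_right integrable_T[OF h]])
      (use st in auto)
  also have "\<dots> = (\<integral>s. T (\<tau> - s) (h s) \<partial>lebesgue_on {0..\<sigma>})"
  proof (rule Bochner_Integration.integral_cong)
    fix s assume "s \<in> space (lebesgue_on {0..\<sigma>})"
    then show "blinfun_apply (T (\<tau> - \<sigma>)) (blinfun_apply (T (\<sigma> - s)) (h s)) = T (\<tau> - s) (h s)"
      using T_add_apply[of "\<tau> - \<sigma>" "\<sigma> - s" "h s"] st by simp
  qed simp
  finally have "convol h \<tau> - blinfun_apply (T (\<tau> - \<sigma>)) (convol h \<sigma>)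
      = (\<integral>s. T (\<tau> - s) (h s) \<partial>lebesgue_on {\<sigma>..\<tau>})"
    using integral_interval_combine[OF i st(1,2)] by (simp add: convol_def)
  then have eq: "norm (convol h \<tau> - blinfun_apply (T (\<tau> - \<sigma>)) (convol h \<sigma>))
      = norm (\<integral>s. T (\<tau> - s) (h s) \<partial>lebesgue_on {\<sigma>..\<tau>})" by simp
  have mi: "integrable (lebesgue_on {\<sigma>..\<tau>}) (\<lambda>s. M * m s)"
    using integrable_on_subinterval[OF m(1) st(1,3)] by simp
  have "AE s in lebesgue_on {\<sigma>..\<tau>}. norm (h s) \<le> m s" by (rule AE_subinterval[OF m(2) st(1,3)])
  moreover have "AE s in lebesgue_on {\<sigma>..\<tau>}. s \<in> {\<sigma>..\<tau>}" by (rule AE_I2) simp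
  ultimately have "AE s in lebesgue_on {\<sigma>..\<tau>}. norm (T (\<tau> - s) (h s)) \<le> M * m s"
  proof eventually_elim
    case (elim s)
    have "norm (T (\<tau> - s) (h s)) \<le> M * norm (h s)"
      by (rule norm_T_apply_le) (use elim st in auto)
    also have "\<dots> \<le> M * m s" using elim M_nonneg by (intro mult_left_mono) auto
    finally show ?case .
  qed
  then have "norm (\<integral>s. T (\<tau> - s) (h s) \<partial>lebesgue_on {\<sigma>..\<tau>}) \<le> (\<integral>s. M * m s \<partial>lebesgue_on {\<sigma>..\<tau>})"
    by (rule norm_integral_le_bound[OF mi])
  then show ?thesis unfolding eq by simp
qed

text \<open>Up to an error uniform in n, the value at t is the compact operator
  \<open>T \<epsilon>\<close> applied to the value at t - \<epsilon>, and the latter values are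
  bounded. Total boundedness follows.\<close>

lemma convol_relatively_compact:
  assumes T_compact: "\<And>t. t > 0 \<Longrightarrow> compact_operator (T t)"
    and h: "\<And>n. integrable (leb b) (h n)"
    and m: "integrable (leb b) m" "\<And>n. AE s in leb b. norm (h n s) \<le> m s"
    and t: "t \<in> {0..b}"
  shows "compact (closure (range (\<lambda>n::nat. convol (h n) t)))"
proof -
  have "\<exists>k. finite k \<and> closure (range (\<lambda>n. convol (h n) t)) \<subseteq> (\<Union>x\<in>k. ball x e)" if e: "e > 0" for e
  proof (cases "t = 0")
    case True
    have "convol (h n) 0 = 0" for n
    proof -
      have "AE s in lebesgue_on {0..0}. s \<noteq> (0::real)"
        unfolding AE_interval_iff by (rule AE_I'[of "{0}"]) auto
      moreover have "AE s in lebesgue_on {0..0}. s = (0::real)" by (rule AE_I2) simp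
      ultimately have "AE s in lebesgue_on {0..0}. blinfun_apply (T (0 - s)) (h n s) = 0"
        by eventually_elim simp
      then show ?thesis unfolding convol_def by (rule integral_eq_zero_AE)
    qed
    then show ?thesis using True e by (intro exI[of _ "{0}"]) auto
  next
    case False
    then have t0: "0 < t" using t by auto
    \<comment> \<open>M may be 0, hence the denominator M + 1. Three errors below e / 4 are added at
      the end.\<close>
    define e' where "e' = e / 4 / (M + 1)"
    have e': "e' > 0" using e M_nonneg by (simp add: e'_def)
    obtain d where d: "d > 0" "\<And>c. c \<in> {0..b} \<Longrightarrow> c \<le> t \<Longrightarrow> t - c < d \<Longrightarrow> \<bar>\<integral>x. m x \<partial>lebesgue_on {c..t}\<bar> < e'"
      using integral_interval_small[OF m(1) t e'] by metis
    define \<epsilon> where "\<epsilon> = min (d / 2) t"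
    have \<epsilon>: "0 < \<epsilon>" "\<epsilon> \<le> t" "\<epsilon> < d" using d(1) t0 by (auto simp: \<epsilon>_def)
    have near: "dist (blinfun_apply (T \<epsilon>) (convol (h n) (t - \<epsilon>))) (convol (h n) t) < e / 4" for n
    proof -
      have "norm (convol (h n) t - blinfun_apply (T (t - (t - \<epsilon>))) (convol (h n) (t - \<epsilon>)))
          \<le> M * (\<integral>s. m s \<partial>lebesgue_on {t - \<epsilon>..t})"
        by (rule convol_split[OF h m]) (use \<epsilon> t in auto)
      also have "\<dots> \<le> M * e'" using d(2)[of "t - \<epsilon>"] \<epsilon> t M_nonneg by (intro mult_left_mono) auto
      also have "\<dots> < e / 4" unfolding e'_def using e M_nonneg by (simp add: field_simps)
      finally show ?thesis by (simp add: dist_norm norm_minus_commute)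
    qed
    have "bounded (range (\<lambda>n. convol (h n) (t - \<epsilon>)))"
    proof (rule boundedI)
      fix y assume "y \<in> range (\<lambda>n. convol (h n) (t - \<epsilon>))"
      then obtain n where y: "y = convol (h n) (t - \<epsilon>)" by blast
      have te: "t - \<epsilon> \<in> {0..b}" using \<epsilon> t by auto
      have "norm y \<le> M * (\<integral>s. norm (h n s) \<partial>lebesgue_on {0..t - \<epsilon>})"
        unfolding y by (rule norm_convol_le[OF h te])
      also have "\<dots> \<le> M * (\<integral>s. m s \<partial>lebesgue_on {0..t - \<epsilon>})"
      proof (intro mult_left_mono integral_mono_AE M_nonneg)
        show "AE s in lebesgue_on {0..t - \<epsilon>}. norm (h n s) \<le> m s"
          by (rule AE_subinterval[OF m(2)]) (use te in auto)
        show "integrable (lebesgue_on {0..t - \<epsilon>}) (\<lambda>s. norm (h n s))"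
          "integrable (lebesgue_on {0..t - \<epsilon>}) m"
          using te by (auto intro!: integrable_norm integrable_on_subinterval[OF h] integrable_on_subinterval[OF m(1)])
      qed
      finally show "norm y \<le> M * (\<integral>s. m s \<partial>lebesgue_on {0..t - \<epsilon>})" .
    qed
    then have "compact (closure (blinfun_apply (T \<epsilon>) ` range (\<lambda>n. convol (h n) (t - \<epsilon>))))"
      using T_compact[OF \<epsilon>(1)] by (simp add: compact_operator_def relatively_compact_def)
    then obtain k where k: "finite k"
      "closure (blinfun_apply (T \<epsilon>) ` range (\<lambda>n. convol (h n) (t - \<epsilon>))) \<subseteq> (\<Union>x\<in>k. ball x (e/4))"
      using e unfolding compact_eq_totally_bounded by (meson divide_pos_pos zero_less_numeral)
    have "closure (range (\<lambda>n. convol (h n) t)) \<subseteq> (\<Union>x\<in>k. ball x e)"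
    proof
      fix y assume "y \<in> closure (range (\<lambda>n. convol (h n) t))"
      then obtain n where n: "dist (convol (h n) t) y < e / 4"
        using e by (auto simp: closure_approachable dest!: spec[of _ "e/4"])
      have "blinfun_apply (T \<epsilon>) (convol (h n) (t - \<epsilon>)) \<in> (\<Union>x\<in>k. ball x (e/4))"
        by (rule subsetD[OF k(2) subsetD[OF closure_subset]]) simp
      then obtain x where x: "x \<in> k" "dist x (blinfun_apply (T \<epsilon>) (convol (h n) (t - \<epsilon>))) < e / 4" by auto
      have "dist x y < e"
        using x(2) near[of n] n e dist_triangle[of x y "convol (h n) t"]
          dist_triangle[of x "convol (h n) t" "blinfun_apply (T \<epsilon>) (convol (h n) (t - \<epsilon>))"] by linarith
      then show "y \<in> (\<Union>x\<in>k. ball x e)" using x(1) by auto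
    qed
    then show ?thesis using k(1) by blast
  qed
  then show ?thesis unfolding compact_eq_totally_bounded by (auto simp: complete_eq_closed)
qed

lemma T_uniform_on_compact:
  assumes K: "compact K" and e: "e > 0"
  obtains d where "d > 0" "\<And>h z. 0 \<le> h \<Longrightarrow> h < d \<Longrightarrow> h \<le> b \<Longrightarrow> z \<in> K \<Longrightarrow> dist (blinfun_apply (T h) z) z < e"
proof -
  \<comment> \<open>The detour through a net point costs M * e' for replacing z under
    \<open>T h\<close>, e' for the motion of the net point and e' for the return to z.\<close>
  define e' where "e' = e / (M + 2)"
  have e': "e' > 0" using e M_nonneg by (simp add: e'_def)
  obtain k where k: "finite k" "K \<subseteq> (\<Union>x\<in>k. ball x e')"
    using K e' unfolding compact_eq_totally_bounded by blast
  have "\<forall>x. \<exists>d>0. \<forall>h. 0 \<le> h \<and> h < d \<and> h \<le> b \<longrightarrow> dist (blinfun_apply (T h) x) x < e'"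
  proof
    fix x
    have "\<exists>d>0. \<forall>h\<in>{0..b}. dist h 0 < d \<longrightarrow> dist (blinfun_apply (T h) x) (blinfun_apply (T 0) x) < e'"
      using continuous_T[of x] b e' unfolding continuous_on_iff by (meson atLeastAtMost_iff less_imp_le order_refl)
    then show "\<exists>d>0. \<forall>h. 0 \<le> h \<and> h < d \<and> h \<le> b \<longrightarrow> dist (blinfun_apply (T h) x) x < e'"
      by (auto simp: dist_real_def)
  qed
  then obtain \<delta> where \<delta>: "\<And>x. \<delta> x > 0" "\<And>x h. 0 \<le> h \<Longrightarrow> h < \<delta> x \<Longrightarrow> h \<le> b \<Longrightarrow> dist (blinfun_apply (T h) x) x < e'"
    by metis
  show ?thesis
  proof (rule that[of "Min (insert 1 (\<delta> ` k))"])
    show "Min (insert 1 (\<delta> ` k)) > 0" using k(1) \<delta>(1) by auto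
    fix h z assume hz: "0 \<le> h" "h < Min (insert 1 (\<delta> ` k))" "h \<le> b" "z \<in> K"
    then obtain x where x: "x \<in> k" "dist x z < e'" using k(2) by auto
    have "h < \<delta> x" using hz(2) k(1) x(1) by auto
    then have 1: "dist (blinfun_apply (T h) x) x < e'" using \<delta>(2) hz by blast
    have 2: "dist (blinfun_apply (T h) z) (blinfun_apply (T h) x) \<le> M * e'"
    proof -
      have "dist (blinfun_apply (T h) z) (blinfun_apply (T h) x) = norm (blinfun_apply (T h) (z - x))"
        by (simp add: dist_norm blinfun.diff_right)
      also have "\<dots> \<le> M * norm (z - x)" by (rule norm_T_apply_le) (use hz in auto)
      also have "\<dots> \<le> M * e'"
        using x(2) M_nonneg by (intro mult_left_mono) (auto simp: dist_norm norm_minus_commute)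
      finally show ?thesis .
    qed
    have "dist (blinfun_apply (T h) z) z < M * e' + e' + e'"
      using 1 2 x(2) dist_triangle[of "blinfun_apply (T h) z" z "blinfun_apply (T h) x"]
        dist_triangle[of "blinfun_apply (T h) x" z x] by linarith
    also have "\<dots> = e' * (M + 2)" by (simp add: algebra_simps)
    also have "\<dots> = e" unfolding e'_def using M_nonneg by simp
    finally show "dist (blinfun_apply (T h) z) z < e" .
  qed
qed

text \<open>\<open>convol_split\<close> compares the value at \<tau> with
  \<open>T (\<tau> - t)\<close> applied to the value at t; the values at t lie in one compact set,
  on which \<open>T (\<tau> - t)\<close> is uniformly close to the identity. The semigroup moves
  forward in time only, so the argument is one-sided.\<close>

lemma convol_right_equicontinuous:
  assumes T_compact: "\<And>t. t > 0 \<Longrightarrow> compact_operator (T t)"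
    and h: "\<And>n. integrable (leb b) (h n)"
    and m: "integrable (leb b) m" "\<And>n. AE s in leb b. norm (h n s) \<le> m s"
    and t: "t \<in> {0..b}" and e: "e > 0"
  shows "\<exists>d>0. \<forall>\<tau>. t \<le> \<tau> \<and> \<tau> < t + d \<and> \<tau> \<le> b \<longrightarrow> (\<forall>n::nat. dist (convol (h n) \<tau>) (convol (h n) t) < e)"
proof -
  define K where "K = closure (range (\<lambda>n. convol (h n) t))"
  have K: "compact K" unfolding K_def by (rule convol_relatively_compact[OF T_compact h m t])
  have inK: "convol (h n) t \<in> K" for n unfolding K_def by (rule closure_subset[THEN subsetD]) simp
  obtain d1 where d1: "d1 > 0"
    "\<And>h z. 0 \<le> h \<Longrightarrow> h < d1 \<Longrightarrow> h \<le> b \<Longrightarrow> z \<in> K \<Longrightarrow> dist (blinfun_apply (T h) z) z < e / 2"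
    using T_uniform_on_compact[OF K, of "e/2"] e by auto
  define e' where "e' = e / 2 / (M + 1)"
  have e': "e' > 0" using e M_nonneg by (simp add: e'_def)
  obtain d2 where d2: "d2 > 0" "\<And>c. c \<in> {0..b} \<Longrightarrow> t \<le> c \<Longrightarrow> c - t < d2 \<Longrightarrow> \<bar>\<integral>x. m x \<partial>lebesgue_on {t..c}\<bar> < e'"
    using integral_interval_small[OF m(1) t e'] by metis
  show ?thesis
  proof (intro exI[of _ "min d1 d2"] conjI allI impI)
    fix \<tau> n assume \<tau>: "t \<le> \<tau> \<and> \<tau> < t + min d1 d2 \<and> \<tau> \<le> b"
    have "norm (convol (h n) \<tau> - blinfun_apply (T (\<tau> - t)) (convol (h n) t)) \<le> M * (\<integral>s. m s \<partial>lebesgue_on {t..\<tau>})"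
      by (rule convol_split[OF h m]) (use \<tau> t in auto)
    also have "\<bar>\<integral>x. m x \<partial>lebesgue_on {t..\<tau>}\<bar> < e'" by (rule d2(2)) (use \<tau> t in auto)
    then have "M * (\<integral>s. m s \<partial>lebesgue_on {t..\<tau>}) \<le> M * e'" using M_nonneg by (intro mult_left_mono) auto
    also have "\<dots> < e / 2" unfolding e'_def using e M_nonneg by (simp add: field_simps)
    finally have "dist (convol (h n) \<tau>) (blinfun_apply (T (\<tau> - t)) (convol (h n) t)) < e / 2"
      by (simp add: dist_norm)
    moreover have "dist (blinfun_apply (T (\<tau> - t)) (convol (h n) t)) (convol (h n) t) < e / 2"
      by (rule d1(2)[OF _ _ _ inK]) (use \<tau> t in auto)
    ultimately show "dist (convol (h n) \<tau>) (convol (h n) t) < e"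
      using dist_triangle[of "convol (h n) \<tau>" "convol (h n) t" "blinfun_apply (T (\<tau> - t)) (convol (h n) t)"]
      by linarith
  qed (use d1 d2 in auto)
qed

end

subsection \<open>Pointwise convergent subsequences\<close>

text \<open>A form of the Arzela-Ascoli theorem. Convergence on a countable dense set containing the
  right end point propagates to each \<open>t\<close> from the right, so one-sided equicontinuity suffices.\<close>

lemma pointwise_convergent_subsequence:
  fixes y :: "nat \<Rightarrow> real \<Rightarrow> 'a::complete_space"
  assumes b: "0 \<le> b"
    and comp: "\<And>t. t \<in> {0..b} \<Longrightarrow> \<exists>K. compact K \<and> (\<forall>n. y n t \<in> K)"
    and equi: "\<And>t e. t \<in> {0..b} \<Longrightarrow> e > 0 \<Longrightarrow>
      \<exists>d>0. \<forall>\<tau>. t \<le> \<tau> \<and> \<tau> < t + d \<and> \<tau> \<le> b \<longrightarrow> (\<forall>n. dist (y n \<tau>) (y n t) < e)"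
  obtains r :: "nat \<Rightarrow> nat" where "strict_mono r" "\<And>t. t \<in> {0..b} \<Longrightarrow> convergent (\<lambda>n. y (r n) t)"
proof -
  define Q where "Q = insert b ({0..b} \<inter> \<rat>)"
  have Q: "countable Q" "Q \<noteq> {}" "Q \<subseteq> {0..b}"
    using countable_rat b by (auto simp: Q_def countable_Int2)
  define q where "q = from_nat_into Q"
  have qQ: "q k \<in> {0..b}" for k 
    unfolding q_def by (rule subsetD[OF Q(3) from_nat_into[OF Q(2)]])
  interpret subseqs "\<lambda>k s. convergent (\<lambda>n. y (s n) (q k))"
  proof
    fix k and s :: "nat \<Rightarrow> nat"
    assume "strict_mono s"
    obtain K where K: "compact K" "\<And>n. y n (q k) \<in> K" using comp[OF qQ] by blast
    have "\<forall>n. y (s n) (q k) \<in> K" using K by blast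
    then obtain l r where r: "l \<in> K" "strict_mono (r :: nat \<Rightarrow> nat)" "((\<lambda>n. y (s n) (q k)) \<circ> r) \<longlonglongrightarrow> l"
      using K(1) unfolding compact_def by metis
    then show "\<exists>r'. strict_mono r' \<and> convergent (\<lambda>n. y ((s \<circ> r') n) (q k))"
      by (intro exI[of _ r]) (auto simp: o_def convergent_def)
  qed
  have conv: "convergent (\<lambda>n. y (diagseq n) (q k))" for k
  proof -
    \<comment> \<open>The diagonal sequence is a subsequence of the k-th one only from index
      \<open>Suc k\<close> on; \<open>LIMSEQ_offset\<close> removes the shift.\<close>
    have "convergent (\<lambda>n. y ((diagseq \<circ> (+) (Suc k)) n) (q k))"
    proof (rule diagseq_holds)
      fix r s :: "nat \<Rightarrow> nat" and n
      assume "strict_mono r" "convergent (\<lambda>i. y (s i) (q n))"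
      then show "convergent (\<lambda>i. y ((s \<circ> r) i) (q n))"
        using convergent_subseq_convergent[of "\<lambda>i. y (s i) (q n)" r] by (simp add: o_def)
    qed
    then obtain l where "(\<lambda>n. y (diagseq (n + Suc k)) (q k)) \<longlonglongrightarrow> l"
      by (auto simp: convergent_def o_def add.commute)
    then have "(\<lambda>n. y (diagseq n) (q k)) \<longlonglongrightarrow> l" by (rule LIMSEQ_offset)
    then show ?thesis by (auto simp: convergent_def)
  qed
  have "convergent (\<lambda>n. y (diagseq n) t)" if t: "t \<in> {0..b}" for t
  proof (cases "t = b")
    case True
    then have "t \<in> Q" by (simp add: Q_def)
    then obtain k where "q k = t" using from_nat_into_surj[OF Q(1)] by (auto simp: q_def)
    then show ?thesis using conv[of k] by simp
  next
    case False
    have "Cauchy (\<lambda>n. y (diagseq n) t)"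
    proof (rule metric_CauchyI)
      fix e :: real assume e: "e > 0"
      obtain d where d: "d > 0" "\<And>\<tau> n. t \<le> \<tau> \<Longrightarrow> \<tau> < t + d \<Longrightarrow> \<tau> \<le> b \<Longrightarrow> dist (y n \<tau>) (y n t) < e / 3"
        using equi[OF t, of "e/3"] e by auto
      obtain p where p: "p \<in> \<rat>" "t < p" "p < min (t + d) b"
        using Rats_dense_in_real[of t "min (t + d) b"] d(1) t False by auto
      then have "p \<in> Q" using t by (auto simp: Q_def)
      then obtain k where k: "q k = p" using from_nat_into_surj[OF Q(1)] by (auto simp: q_def)
      have "Cauchy (\<lambda>n. y (diagseq n) p)" using conv[of k] k by (simp add: convergent_Cauchy)
      then obtain N where N: "\<And>i j. i \<ge> N \<Longrightarrow> j \<ge> N \<Longrightarrow> dist (y (diagseq i) p) (y (diagseq j) p) < e / 3"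
        using e unfolding Cauchy_def by (meson divide_pos_pos zero_less_numeral)
      have "dist (y (diagseq i) t) (y (diagseq j) t) < e" if ij: "i \<ge> N" "j \<ge> N" for i j
      proof -
        have pn: "dist (y n p) (y n t) < e / 3" for n by (rule d(2)) (use p in auto)
        show ?thesis
          using N[OF ij] pn[of "diagseq i"] pn[of "diagseq j"]
            dist_triangle[of "y (diagseq i) t" "y (diagseq j) t" "y (diagseq i) p"]
            dist_triangle[of "y (diagseq i) p" "y (diagseq j) t" "y (diagseq j) p"]
            dist_commute[of "y (diagseq i) p" "y (diagseq i) t"] by linarith
      qed
      then show "\<exists>M. \<forall>m\<ge>M. \<forall>n\<ge>M. dist (y (diagseq m) t) (y (diagseq n) t) < e" by blast
    qed
    then show ?thesis by (simp add: Cauchy_convergent_iff)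
  qed
  then show ?thesis using that subseq_diagseq by blast
qed

subsection \<open>Convex combinations of tails\<close>

text \<open>The convex hull of the functions v n, v (n + 1), ..., with the same weights at every
  argument. Generation by binary combinations lets each property stable under convex combinations
  follow by rule induction.\<close>

inductive_set tail_hull :: "(nat \<Rightarrow> 'a \<Rightarrow> 'b::real_vector) \<Rightarrow> nat \<Rightarrow> ('a \<Rightarrow> 'b) set"
  for v :: "nat \<Rightarrow> 'a \<Rightarrow> 'b" and n :: nat where
  tail: "k \<ge> n \<Longrightarrow> v k \<in> tail_hull v n"
| combination: "p \<in> tail_hull v n \<Longrightarrow> q \<in> tail_hull v n \<Longrightarrow> 0 \<le> a \<Longrightarrow> 0 \<le> c \<Longrightarrow> a + c = 1 \<Longrightarrow>
    (\<lambda>t. a *\<^sub>R p t + c *\<^sub>R q t) \<in> tail_hull v n"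

lemma tail_hull_antimono: "q \<in> tail_hull v n \<Longrightarrow> m \<le> n \<Longrightarrow> q \<in> tail_hull v m"
  by (induction rule: tail_hull.induct) (auto intro: tail_hull.intros)

lemma tail_hull_mem_convex:
  assumes "q \<in> tail_hull v n" "convex C" "\<And>k. k \<ge> n \<Longrightarrow> v k t \<in> C"
  shows "q t \<in> C"
  using assms by (induction rule: tail_hull.induct) (auto simp: convexD)

lemma tail_hull_measurable:
  fixes v :: "nat \<Rightarrow> 'a \<Rightarrow> 'b::{real_normed_vector, second_countable_topology}"
  assumes "q \<in> tail_hull v n" "\<And>k. v k \<in> borel_measurable M"
  shows "q \<in> borel_measurable M"
  using assms by (induction rule: tail_hull.induct) auto

lemma tail_hull_norm_le:
  assumes "q \<in> tail_hull v n" "\<And>k. norm (v k t) \<le> c"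
  shows "norm (q t) \<le> c"
  using tail_hull_mem_convex[OF assms(1) convex_cball[of 0 c], of t] assms(2) by simp

text \<open>Integrated over a finite measure, this bounds the L^1 norm by the squared L^2 norm with
  a free parameter e, in place of the Cauchy-Schwarz inequality.\<close>

lemma norm_le_add_square:
  fixes e x :: real
  assumes "0 < e" "0 \<le> x"
  shows "x \<le> e + x\<^sup>2 / e"
proof (cases "x \<le> e")
  case True
  then show ?thesis using assms by (simp add: add_increasing2)
next
  case False
  then have "x * e \<le> x * x" using assms by (intro mult_left_mono) auto
  then have "x \<le> x\<^sup>2 / e" using assms by (simp add: field_simps power2_eq_square)
  then show ?thesis using assms by linarith
qed

text \<open>A Mazur-type lemma that needs no weak compactness: nearly norm-minimal elements of the convex
  hulls of the tails form a Cauchy sequence in \<open>L\<^sup>2\<close>, by the parallelogram law.\<close>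

lemma tail_hull_convergent:
  fixes v :: "nat \<Rightarrow> 'a \<Rightarrow> 'b::{real_inner, banach, second_countable_topology}"
  assumes "finite_measure M"
    and v [measurable]: "\<And>k. v k \<in> borel_measurable M"
    and m: "integrable M (\<lambda>t. (m t)\<^sup>2)"
    and vm: "\<And>k. AE t in M. norm (v k t) \<le> m t"
  obtains q z where "\<And>n. q n \<in> tail_hull v n" "z \<in> borel_measurable M"
    "AE t in M. (\<lambda>n. q n t) \<longlonglongrightarrow> z t"
proof -
  interpret finite_measure M by fact
  have vm': "AE t in M. \<forall>k. norm (v k t) \<le> m t" using vm by (simp add: AE_all_countable)
  have meas [measurable]: "q \<in> borel_measurable M" if "q \<in> tail_hull v n" for q n
    using tail_hull_measurable[OF that] v by blast
  have qm: "AE t in M. norm (q t) \<le> m t" if "q \<in> tail_hull v n" for q n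
    using vm' by eventually_elim (use tail_hull_norm_le[OF that] in blast)
  have sq: "integrable M (\<lambda>t. (norm (q t))\<^sup>2)" if "q \<in> tail_hull v n" for q n
  proof (rule Bochner_Integration.integrable_bound[OF m])
    show "AE t in M. norm ((norm (q t))\<^sup>2) \<le> norm ((m t)\<^sup>2)"
      using qm[OF that] by eventually_elim (simp add: power_mono)
  qed (use meas[OF that] in measurable)
  define N where "N q = (\<integral>t. (norm (q t))\<^sup>2 \<partial>M)" for q :: "'a \<Rightarrow> 'b"
  have N0: "0 \<le> N q" for q by (simp add: N_def)
  \<comment> \<open>The hulls shrink with n, so these infima increase; the common bound m makes them
    converge.\<close>
  define \<alpha> where "\<alpha> n = (INF q\<in>tail_hull v n. N q)" for n
  have ne: "tail_hull v n \<noteq> {}" for n using tail_hull.tail[of n n v] by blast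
  have bdd: "bdd_below (N ` tail_hull v n)" for n using N0 by (intro bdd_belowI2) auto
  have \<alpha>_le: "\<alpha> n \<le> N q" if "q \<in> tail_hull v n" for n q
    unfolding \<alpha>_def by (rule cINF_lower[OF bdd that])
  have "incseq \<alpha>"
    unfolding incseq_def \<alpha>_def
    by (intro allI impI cINF_superset_mono ne bdd) (use tail_hull_antimono in auto)
  moreover have "\<alpha> n \<le> (\<integral>t. (m t)\<^sup>2 \<partial>M)" for n
  proof -
    have vn: "v n \<in> tail_hull v n" by (simp add: tail_hull.tail)
    have "N (v n) \<le> (\<integral>t. (m t)\<^sup>2 \<partial>M)"
      unfolding N_def
    proof (rule integral_mono_AE[OF sq[OF vn] m])
      show "AE t in M. (norm (v n t))\<^sup>2 \<le> (m t)\<^sup>2"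
        using qm[OF vn] by eventually_elim (simp add: power_mono)
    qed
    then show ?thesis using \<alpha>_le[OF vn] by linarith
  qed
  ultimately obtain L where L: "\<alpha> \<longlonglongrightarrow> L" "\<And>n. \<alpha> n \<le> L"
    using incseq_convergent by blast
  have "\<exists>q\<in>tail_hull v n. N q < \<alpha> n + 1 / real (Suc n)" for n
    using cINF_less_iff[OF ne bdd, of n "\<alpha> n + 1 / real (Suc n)"] unfolding \<alpha>_def by simp
  then obtain q where q: "\<And>n. q n \<in> tail_hull v n" "\<And>n. N (q n) < \<alpha> n + 1 / real (Suc n)"
    by metis
  \<comment> \<open>The midpoint of q i and q j stays in the hull, so its squared norm is at least
    \<alpha> n. The parallelogram law then leaves 2 (L + 1/(n+1)) twice, minus 4 \<alpha> n.\<close>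
  have diff_le: "(\<integral>t. (norm (q i t - q j t))\<^sup>2 \<partial>M) \<le> 4 * (L - \<alpha> n) + 4 / real (Suc n)"
    and diff_int: "integrable M (\<lambda>t. (norm (q i t - q j t))\<^sup>2)"
    if ij: "i \<ge> n" "j \<ge> n" for i j n
  proof -
    have qi: "q i \<in> tail_hull v n" and qj: "q j \<in> tail_hull v n"
      using tail_hull_antimono q(1) ij by blast+
    have mid: "(\<lambda>t. (1/2) *\<^sub>R q i t + (1/2) *\<^sub>R q j t) \<in> tail_hull v n"
      by (rule tail_hull.combination[OF qi qj]) auto
    have par: "(norm (q i t - q j t))\<^sup>2 = 2 * (norm (q i t))\<^sup>2 + 2 * (norm (q j t))\<^sup>2
        - 4 * (norm ((1/2) *\<^sub>R q i t + (1/2) *\<^sub>R q j t))\<^sup>2" for t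
      by (simp add: power2_norm_eq_inner inner_diff_left inner_diff_right inner_add_left
          inner_add_right inner_commute algebra_simps)
    show "integrable M (\<lambda>t. (norm (q i t - q j t))\<^sup>2)"
      unfolding par using sq[OF qi] sq[OF qj] sq[OF mid] by simp
    have "(\<integral>t. (norm (q i t - q j t))\<^sup>2 \<partial>M) = 2 * N (q i) + 2 * N (q j)
        - 4 * N (\<lambda>t. (1/2) *\<^sub>R q i t + (1/2) *\<^sub>R q j t)"
      unfolding par N_def using sq[OF qi] sq[OF qj] sq[OF mid] by simp
    moreover have "\<alpha> n \<le> N (\<lambda>t. (1/2) *\<^sub>R q i t + (1/2) *\<^sub>R q j t)" by (rule \<alpha>_le[OF mid])
    moreover have "N (q k) \<le> L + 1 / real (Suc n)" if "k \<ge> n" for k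
    proof -
      have "1 / real (Suc k) \<le> 1 / real (Suc n)" using that by (simp add: frac_le)
      then show ?thesis using q(2)[of k] L(2)[of k] by linarith
    qed
    note this[OF ij(1)] this[OF ij(2)]
    ultimately show "(\<integral>t. (norm (q i t - q j t))\<^sup>2 \<partial>M) \<le> 4 * (L - \<alpha> n) + 4 / real (Suc n)"
      by simp
  qed
  have qint: "integrable M (q n)" for n
  proof (rule Bochner_Integration.integrable_bound)
    show "integrable M (\<lambda>t. 1 + (norm (q n t))\<^sup>2)" using sq[OF q(1)] by simp
    show "AE t in M. norm (q n t) \<le> norm (1 + (norm (q n t))\<^sup>2)"
      using norm_le_add_square[of 1] by (intro AE_I2) simp
  qed (rule meas[OF q(1)])
  have L1: "\<exists>K. \<forall>i\<ge>K. \<forall>j\<ge>K. (\<integral>t. norm (q i t - q j t) \<partial>M) < e" if e: "e > 0" for e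
  proof -
    define \<mu> where "\<mu> = measure M (space M)"
    define \<epsilon> where "\<epsilon> = e / 2 / (\<mu> + 1)"
    have \<mu>: "0 \<le> \<mu>" by (simp add: \<mu>_def)
    then have \<epsilon>: "\<epsilon> > 0" using e by (simp add: \<epsilon>_def)
    have "(\<lambda>n. 4 * (L - \<alpha> n) + 4 * (1 / real (Suc n))) \<longlonglongrightarrow> 4 * (L - L) + 4 * 0"
      by (intro tendsto_intros L(1) LIMSEQ_Suc[OF lim_1_over_n])
    then have "\<forall>\<^sub>F n in sequentially. 4 * (L - \<alpha> n) + 4 * (1 / real (Suc n)) < \<epsilon> * (e / 2)"
      by (rule order_tendstoD) (use \<epsilon> e in simp)
    then obtain n where n: "4 * (L - \<alpha> n) + 4 * (1 / real (Suc n)) < \<epsilon> * (e / 2)"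
      by (meson eventually_happens sequentially_bot)
    have "(\<integral>t. norm (q i t - q j t) \<partial>M) < e" if ij: "i \<ge> n" "j \<ge> n" for i j
    proof -
      have "(\<integral>t. norm (q i t - q j t) \<partial>M) \<le> (\<integral>t. \<epsilon> + (norm (q i t - q j t))\<^sup>2 / \<epsilon> \<partial>M)"
        using diff_int[OF ij] qint norm_le_add_square[OF \<epsilon>] by (intro integral_mono) auto
      also have "\<dots> = \<epsilon> * \<mu> + (\<integral>t. (norm (q i t - q j t))\<^sup>2 \<partial>M) / \<epsilon>"
        using diff_int[OF ij] by (simp add: \<mu>_def)
      also have "\<dots> < \<epsilon> * \<mu> + e / 2"
        using diff_le[OF ij] n \<epsilon> by (simp add: pos_divide_less_eq mult.commute)
      also have "\<dots> \<le> e" unfolding \<epsilon>_def using \<mu> e by (simp add: field_simps)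
      finally show ?thesis .
    qed
    then show ?thesis by blast
  qed
  \<comment> \<open>A Cauchy sequence in L^1 has an almost everywhere Cauchy subsequence, and r n
    \<ge> n keeps \<open>q (r n)\<close> in the n-th hull.\<close>
  obtain r where r: "strict_mono r" "AE t in M. Cauchy (\<lambda>i. q (r i) t)"
    using cauchy_L1_AE_cauchy_subseq[OF qint L1] by blast
  show ?thesis
  proof (rule that)
    show "q (r n) \<in> tail_hull v n" for n
      using tail_hull_antimono[OF q(1)] strict_mono_imp_increasing[OF r(1)] by blast
    show "(\<lambda>t. lim (\<lambda>n. q (r n) t)) \<in> borel_measurable M"
      by (rule borel_measurable_lim_metric) (rule meas[OF q(1)])
    show "AE t in M. (\<lambda>n. q (r n) t) \<longlonglongrightarrow> lim (\<lambda>n. q (r n) t)"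
      using r(2) by eventually_elim (simp add: Cauchy_convergent_iff convergent_LIMSEQ_iff)
  qed
qed

text \<open>Elements of the n-th hull combine only v k with k \<ge> n, so a convex condition that
  holds eventually is satisfied by all late hull elements and, being closed, by the limit.\<close>

lemma tail_hull_limit_mem:
  fixes v :: "nat \<Rightarrow> 'a \<Rightarrow> 'b::real_normed_vector"
  assumes q: "\<And>n. q n \<in> tail_hull v n" and lim: "(\<lambda>n. q n t) \<longlonglongrightarrow> z"
    and C: "convex C" "closed C" and ev: "\<forall>\<^sub>F k in sequentially. v k t \<in> C"
  shows "z \<in> C"
proof -
  obtain N where N: "\<And>k. k \<ge> N \<Longrightarrow> v k t \<in> C" using ev by (auto simp: eventually_sequentially)
  have "q n t \<in> C" if "n \<ge> N" for n
    by (rule tail_hull_mem_convex[OF q C(1)]) (use N that in auto)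
  then have "\<forall>\<^sub>F n in sequentially. q n t \<in> C" by (auto simp: eventually_sequentially)
  then show ?thesis using Lim_in_closed_set[OF C(2) _ _ lim] by simp
qed

text \<open>The distance need not be attained, so points of S within e + \<delta> are combined with
  the same weights and \<delta> is sent to 0.\<close>

lemma convex_infdist_sublevel:
  fixes S :: "'a::real_normed_vector set"
  assumes "convex S" "S \<noteq> {}"
  shows "convex {p. infdist p S \<le> e}"
proof (rule convexI)
  fix p q and a c :: real
  assume pq: "p \<in> {p. infdist p S \<le> e}" "q \<in> {p. infdist p S \<le> e}" and ac: "0 \<le> a" "0 \<le> c" "a + c = 1"
  have "infdist (a *\<^sub>R p + c *\<^sub>R q) S \<le> e + \<delta>" if \<delta>: "\<delta> > 0" for \<delta>
  proof -
    have ex: "\<exists>s\<in>S. dist r s < e + \<delta>" if "infdist r S \<le> e" for r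
    proof -
      have "infdist r S < e + \<delta>" using that \<delta> by linarith
      then show ?thesis
        by (metis assms(2) cINF_less_iff bdd_below_image_dist infdist_notempty)
    qed
    obtain s s' where s: "s \<in> S" "dist p s < e + \<delta>" "s' \<in> S" "dist q s' < e + \<delta>"
      using ex[of p] ex[of q] pq by auto
    have "infdist (a *\<^sub>R p + c *\<^sub>R q) S \<le> dist (a *\<^sub>R p + c *\<^sub>R q) (a *\<^sub>R s + c *\<^sub>R s')"
      by (rule infdist_le) (use convexD[OF assms(1) s(1,3)] ac in auto)
    also have "\<dots> = norm (a *\<^sub>R (p - s) + c *\<^sub>R (q - s'))"
      by (simp add: dist_norm algebra_simps)
    also have "\<dots> \<le> a * dist p s + c * dist q s'"
      using norm_triangle_ineq[of "a *\<^sub>R (p - s)" "c *\<^sub>R (q - s')"] ac by (simp add: dist_norm)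
    also have "\<dots> \<le> a * (e + \<delta>) + c * (e + \<delta>)" using s ac by (intro add_mono mult_left_mono) auto
    also have "\<dots> = e + \<delta>" using ac by (simp flip: distrib_right)
    finally show ?thesis .
  qed
  then have "infdist (a *\<^sub>R p + c *\<^sub>R q) S \<le> e" by (rule field_le_epsilon)
  then show "a *\<^sub>R p + c *\<^sub>R q \<in> {p. infdist p S \<le> e}" by simp
qed

text \<open>For constraint sets that vary with k the terms only approach the limit set S. The closed
  e-neighbourhoods of S are convex and contain the late terms, hence the limit of the averages; L
  picks out a component of the velocity.\<close>

lemma tail_hull_limit_infdist:
  fixes v :: "nat \<Rightarrow> 'a \<Rightarrow> 'b::real_normed_vector" and L :: "'b \<Rightarrow> 'c::real_normed_vector"
  assumes q: "\<And>n. q n \<in> tail_hull v n" and lim: "(\<lambda>n. q n t) \<longlonglongrightarrow> z"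
    and L: "bounded_linear L"
    and S: "convex S" "closed S" "S \<noteq> {}"
    and v: "(\<lambda>k. infdist (L (v k t)) S) \<longlonglongrightarrow> 0"
  shows "L z \<in> S"
proof -
  have "infdist (L z) S \<le> 0 + e" if e: "e > 0" for e
  proof -
    have "z \<in> L -` {p. infdist p S \<le> e}"
    proof (rule tail_hull_limit_mem[OF q lim])
      show "convex (L -` {p. infdist p S \<le> e})"
        by (rule convex_linear_vimage[OF bounded_linear.linear[OF L] convex_infdist_sublevel[OF S(1,3)]])
      have "closed {p. infdist p S \<le> e}" by (intro closed_Collect_le continuous_intros)
      then show "closed (L -` {p. infdist p S \<le> e})"
        by (intro closed_vimage) (auto intro: linear_continuous_on[OF L])
      have "\<forall>\<^sub>F k in sequentially. infdist (L (v k t)) S < e" using v e by (rule order_tendstoD)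
      then show "\<forall>\<^sub>F k in sequentially. v k t \<in> L -` {p. infdist p S \<le> e}"
        by eventually_elim simp
    qed
    then show ?thesis by simp
  qed
  then have "infdist (L z) S \<le> 0" by (rule field_le_epsilon)
  then have "infdist (L z) S = 0" using infdist_nonneg[of "L z" S] by linarith
  then show ?thesis using in_closed_iff_infdist_zero[OF S(2,3)] by blast
qed

text \<open>Integration against a kernel linear in the value commutes with convex combinations, so
  integrals of late hull elements stay in every ball around L; dominated convergence identifies
  their limit from the other side. The kernel will be that of the convolution or of the
  primitive.\<close>

lemma tail_hull_limit_integral:
  fixes v :: "nat \<Rightarrow> 'a \<Rightarrow> 'b::{banach, second_countable_topology}"
    and K :: "'a \<Rightarrow> 'b \<Rightarrow> 'c::{banach, second_countable_topology}"
  assumes q: "\<And>n. q n \<in> tail_hull v n" and lim: "AE t in M. (\<lambda>n. q n t) \<longlonglongrightarrow> z t"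
    and z: "z \<in> borel_measurable M"
    and v: "\<And>k. v k \<in> borel_measurable M" "\<And>k. AE t in M. norm (v k t) \<le> m t"
    and m: "integrable M m"
    and K: "\<And>s. linear (K s)" "\<And>s y. norm (K s y) \<le> c * norm y"
      "\<And>p. p \<in> borel_measurable M \<Longrightarrow> (\<lambda>s. K s (p s)) \<in> borel_measurable M"
    and c: "0 \<le> c"
    and L: "(\<lambda>k. \<integral>s. K s (v k s) \<partial>M) \<longlonglongrightarrow> L"
  shows "(\<integral>s. K s (z s) \<partial>M) = L"
proof -
  have vm': "AE t in M. \<forall>k. norm (v k t) \<le> m t" using v(2) by (simp add: AE_all_countable)
  have Kb: "AE t in M. norm (K t (p t)) \<le> c * m t" if "p \<in> tail_hull v n" for p n
    using vm'
  proof eventually_elim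
    case (elim t)
    have "norm (K t (p t)) \<le> c * norm (p t)" by (rule K(2))
    also have "\<dots> \<le> c * m t" using tail_hull_norm_le[OF that, of t "m t"] elim c by (intro mult_left_mono) auto
    finally show ?case .
  qed
  have Km: "(\<lambda>t. K t (p t)) \<in> borel_measurable M" if "p \<in> tail_hull v n" for p n
    by (rule K(3)[OF tail_hull_measurable[OF that v(1)]])
  have cm: "integrable M (\<lambda>t. c * m t)" using m by simp
  have Ki: "integrable M (\<lambda>t. K t (p t))" if "p \<in> tail_hull v n" for p n
  proof (rule Bochner_Integration.integrable_bound[OF cm Km[OF that]])
    show "AE t in M. norm (K t (p t)) \<le> norm (c * m t)"
      using Kb[OF that] by eventually_elim (auto intro: order_trans)
  qed
  have hull: "(\<integral>s. K s (p s) \<partial>M) \<in> C"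
    if "p \<in> tail_hull v n" "convex C" "\<And>k. k \<ge> n \<Longrightarrow> (\<integral>s. K s (v k s) \<partial>M) \<in> C" for p n C
    using that
  proof (induction rule: tail_hull.induct)
    case (combination p q a c)
    have "(\<integral>s. K s (a *\<^sub>R p s + c *\<^sub>R q s) \<partial>M) = (\<integral>s. a *\<^sub>R K s (p s) + c *\<^sub>R K s (q s) \<partial>M)"
      by (simp add: linear_add[OF K(1)] linear_scale[OF K(1)])
    also have "\<dots> = a *\<^sub>R (\<integral>s. K s (p s) \<partial>M) + c *\<^sub>R (\<integral>s. K s (q s) \<partial>M)"
      using Ki[OF combination.hyps(1)] Ki[OF combination.hyps(2)] by simp
    finally show ?case using combination by (simp add: convexD)
  qed auto
  have "(\<lambda>n. \<integral>s. K s (q n s) \<partial>M) \<longlonglongrightarrow> (\<integral>s. K s (z s) \<partial>M)"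
  proof (rule integral_dominated_convergence[OF K(3)[OF z] Km[OF q] cm _ Kb[OF q]])
    show "AE s in M. (\<lambda>n. K s (q n s)) \<longlonglongrightarrow> K s (z s)"
      using lim
    proof eventually_elim
      case (elim s)
      have "bounded_linear (K s)"
        by (rule bounded_linear_intro[where K = c])
          (use K(2)[of s] in \<open>auto simp: linear_add[OF K(1)] linear_scale[OF K(1)] mult.commute\<close>)
      then show ?case using elim by (rule bounded_linear.tendsto)
    qed
  qed
  moreover have "(\<lambda>n. \<integral>s. K s (q n s) \<partial>M) \<longlonglongrightarrow> L"
  proof (rule tendstoI)
    fix e :: real assume "e > 0"
    with L have "\<forall>\<^sub>F k in sequentially. dist (\<integral>s. K s (v k s) \<partial>M) L < e" by (rule tendstoD)
    then obtain N where N: "\<And>k. k \<ge> N \<Longrightarrow> (\<integral>s. K s (v k s) \<partial>M) \<in> ball L e"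
      by (auto simp: eventually_sequentially dist_commute)
    have "(\<integral>s. K s (q n s) \<partial>M) \<in> ball L e" if "n \<ge> N" for n
      by (rule hull[OF q convex_ball]) (use N that in auto)
    then show "\<forall>\<^sub>F n in sequentially. dist (\<integral>s. K s (q n s) \<partial>M) L < e"
      by (auto simp: eventually_sequentially dist_commute)
  qed
  ultimately show ?thesis by (rule LIMSEQ_unique)
qed

lemma norm_convex_combination_square_le:
  fixes x y :: "'a::real_inner"
  assumes "0 \<le> a" "0 \<le> c" "a + c = 1"
  shows "(norm (a *\<^sub>R x + c *\<^sub>R y))\<^sup>2 \<le> a * (norm x)\<^sup>2 + c * (norm y)\<^sup>2"
proof -
  have "norm (a *\<^sub>R x + c *\<^sub>R y) \<le> a * norm x + c * norm y"
    using norm_triangle_ineq[of "a *\<^sub>R x" "c *\<^sub>R y"] assms by simp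
  then have "(norm (a *\<^sub>R x + c *\<^sub>R y))\<^sup>2 \<le> (a * norm x + c * norm y)\<^sup>2" by (rule power_mono) simp
  also have "\<dots> = a * (norm x)\<^sup>2 + c * (norm y)\<^sup>2 - a * c * (norm x - norm y)\<^sup>2"
  proof -
    have c: "c = 1 - a" using assms by simp
    show ?thesis unfolding c by (simp add: power2_eq_square algebra_simps)
  qed
  also have "\<dots> \<le> a * (norm x)\<^sup>2 + c * (norm y)\<^sup>2" using assms by simp
  finally show ?thesis .
qed

text \<open>The squared norm is convex rather than linear, so averaging preserves only upper bounds.
  With L the projection to the control, this is the lower semicontinuity of the control
  cost.\<close>

lemma tail_hull_limit_square_integral:
  fixes v :: "nat \<Rightarrow> 'a \<Rightarrow> 'b::{real_inner, banach, second_countable_topology}"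
    and L :: "'b \<Rightarrow> 'c::{real_inner, banach, second_countable_topology}"
  assumes q: "\<And>n. q n \<in> tail_hull v n" and lim: "AE t in M. (\<lambda>n. q n t) \<longlonglongrightarrow> z t"
    and z: "z \<in> borel_measurable M"
    and v: "\<And>k. v k \<in> borel_measurable M" "\<And>k. AE t in M. norm (v k t) \<le> m t"
    and m: "integrable M (\<lambda>t. (m t)\<^sup>2)"
    and L: "bounded_linear L" "\<And>y. norm (L y) \<le> norm y"
    and \<rho>: "(\<lambda>k. \<integral>s. (norm (L (v k s)))\<^sup>2 \<partial>M) \<longlonglongrightarrow> \<rho>"
  shows "(\<integral>s. (norm (L (z s)))\<^sup>2 \<partial>M) \<le> \<rho>"
proof -
  have [measurable]: "L \<in> borel_measurable borel"
    by (intro borel_measurable_continuous_onI linear_continuous_on L)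
  have vm': "AE t in M. \<forall>k. norm (v k t) \<le> m t" using v(2) by (simp add: AE_all_countable)
  have Lb: "AE t in M. norm ((norm (L (p t)))\<^sup>2) \<le> (m t)\<^sup>2" if "p \<in> tail_hull v n" for p n
    using vm'
  proof eventually_elim
    case (elim t)
    have "norm (L (p t)) \<le> m t" using L(2)[of "p t"] tail_hull_norm_le[OF that, of t "m t"] elim by force
    then show ?case by (simp add: power_mono)
  qed
  have Lm: "(\<lambda>t. (norm (L (p t)))\<^sup>2) \<in> borel_measurable M" if "p \<in> borel_measurable M" for p
    using that by measurable
  have Li: "integrable M (\<lambda>t. (norm (L (p t)))\<^sup>2)" if "p \<in> tail_hull v n" for p n
    by (rule Bochner_Integration.integrable_bound[OF m Lm[OF tail_hull_measurable[OF that v(1)]]])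
      (use Lb[OF that] in simp)
  have hull: "(\<integral>s. (norm (L (p s)))\<^sup>2 \<partial>M) \<le> r"
    if "p \<in> tail_hull v n" "\<And>k. k \<ge> n \<Longrightarrow> (\<integral>s. (norm (L (v k s)))\<^sup>2 \<partial>M) \<le> r" for p n r
    using that
  proof (induction rule: tail_hull.induct)
    case (combination p q a c)
    note i = Li[OF combination.hyps(1)] Li[OF combination.hyps(2)]
    have "(\<integral>s. (norm (L (a *\<^sub>R p s + c *\<^sub>R q s)))\<^sup>2 \<partial>M)
        \<le> (\<integral>s. a * (norm (L (p s)))\<^sup>2 + c * (norm (L (q s)))\<^sup>2 \<partial>M)"
    proof (rule integral_mono)
      show "integrable M (\<lambda>s. (norm (L (a *\<^sub>R p s + c *\<^sub>R q s)))\<^sup>2)"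
        by (rule Li[OF tail_hull.combination]) (use combination.hyps in auto)
      show "integrable M (\<lambda>s. a * (norm (L (p s)))\<^sup>2 + c * (norm (L (q s)))\<^sup>2)" using i by simp
      fix s
      show "(norm (L (a *\<^sub>R p s + c *\<^sub>R q s)))\<^sup>2 \<le> a * (norm (L (p s)))\<^sup>2 + c * (norm (L (q s)))\<^sup>2"
        using norm_convex_combination_square_le combination.hyps(3-5)
        by (simp add: linear_add[OF bounded_linear.linear[OF L(1)]] linear_scale[OF bounded_linear.linear[OF L(1)]])
    qed
    also have "\<dots> = a * (\<integral>s. (norm (L (p s)))\<^sup>2 \<partial>M) + c * (\<integral>s. (norm (L (q s)))\<^sup>2 \<partial>M)"
      using i by simp
    also have "\<dots> \<le> a * r + c * r"
      using combination by (intro add_mono mult_left_mono) auto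
    also have "\<dots> = r" using combination.hyps(5) by (simp flip: distrib_right)
    finally show ?case .
  qed auto
  have conv: "(\<lambda>n. \<integral>s. (norm (L (q n s)))\<^sup>2 \<partial>M) \<longlonglongrightarrow> (\<integral>s. (norm (L (z s)))\<^sup>2 \<partial>M)"
  proof (rule integral_dominated_convergence[OF Lm[OF z] Lm[OF tail_hull_measurable[OF q v(1)]] m _ Lb[OF q]])
    show "AE s in M. (\<lambda>n. (norm (L (q n s)))\<^sup>2) \<longlonglongrightarrow> (norm (L (z s)))\<^sup>2"
      using lim by eventually_elim (intro tendsto_intros bounded_linear.tendsto[OF L(1)])
  qed
  have "(\<integral>s. (norm (L (z s)))\<^sup>2 \<partial>M) \<le> \<rho> + e" if e: "e > 0" for e
  proof -
    have "\<forall>\<^sub>F k in sequentially. (\<integral>s. (norm (L (v k s)))\<^sup>2 \<partial>M) < \<rho> + e"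
      using \<rho> by (rule order_tendstoD) (use e in simp)
    then obtain N where N: "\<And>k. k \<ge> N \<Longrightarrow> (\<integral>s. (norm (L (v k s)))\<^sup>2 \<partial>M) < \<rho> + e"
      by (auto simp: eventually_sequentially)
    have "(\<integral>s. (norm (L (q n s)))\<^sup>2 \<partial>M) \<le> \<rho> + e" if "n \<ge> N" for n
      by (rule hull[OF q]) (use N that less_imp_le order_trans in blast)
    then show ?thesis by (intro LIMSEQ_le_const2[OF conv]) blast
  qed
  then show ?thesis by (rule field_le_epsilon)
qed

subsection \<open>Caratheodory functions and square integrable functions\<close>

text \<open>Evaluating x at grid points leaves countably many values for each n, so measurability in
  t at fixed points is enough there; continuity in the second argument handles the refinement of the
  grid.\<close>

lemma measurable_Caratheodory_compose:
  fixes l :: "real \<Rightarrow> 'a::metric_space \<Rightarrow> real"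
  assumes meas: "\<And>p. (\<lambda>t. l t p) \<in> borel_measurable (leb b)"
    and cont: "AE t in leb b. continuous_on UNIV (l t)"
    and x: "continuous_on {0..b} x"
  shows "(\<lambda>t. l t (x t)) \<in> borel_measurable (leb b)"
proof -
  define d where "d n t = of_int \<lfloor>real (Suc n) * t\<rfloor> / real (Suc n)" for n t
  have d_le: "d n t \<le> t" "t - 1 / real (Suc n) \<le> d n t" for n t
  proof -
    show "d n t \<le> t"
      using of_int_floor_le[of "real (Suc n) * t"] by (simp add: d_def pos_divide_le_eq mult.commute)
    have "real (Suc n) * t - 1 \<le> of_int \<lfloor>real (Suc n) * t\<rfloor>" by linarith
    then have "(real (Suc n) * t - 1) / real (Suc n) \<le> d n t"
      unfolding d_def by (rule divide_right_mono) simp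
    then show "t - 1 / real (Suc n) \<le> d n t" by (simp add: diff_divide_distrib)
  qed
  have d_lim: "(\<lambda>n. d n t) \<longlonglongrightarrow> t" for t
  proof (rule tendsto_sandwich[where f = "\<lambda>n. t - 1 / real (Suc n)" and h = "\<lambda>_. t"])
    show "(\<lambda>n. t - 1 / real (Suc n)) \<longlonglongrightarrow> t"
      using tendsto_diff[OF tendsto_const[of t] LIMSEQ_Suc[OF lim_1_over_n]] by simp
    show "\<forall>\<^sub>F n in sequentially. t - 1 / real (Suc n) \<le> d n t" by (intro always_eventually allI d_le)
    show "\<forall>\<^sub>F n in sequentially. d n t \<le> t" by (intro always_eventually allI d_le)
  qed simp
  \<comment> \<open>Rounding down keeps the grid point inside the interval on which x is
    continuous.\<close>
  have d_in: "d n t \<in> {0..b}" if "t \<in> {0..b}" for n t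
    using that d_le(1)[of n t] by (auto simp: d_def)
  have m: "(\<lambda>t. l t (x (d n t))) \<in> borel_measurable (leb b)" for n
    unfolding d_def
  proof (rule measurable_compose_countable[of "\<lambda>i t. l t (x (of_int i / real (Suc n)))"])
    have "(\<lambda>t::real. real (Suc n) * t) \<in> borel_measurable (leb b)"
      by (intro measurable_restrict_space1 measurable_completion) simp
    then show "(\<lambda>t. \<lfloor>real (Suc n) * t\<rfloor>) \<in> measurable (leb b) (count_space UNIV)" by measurable
  qed (rule meas)
  define g where "g t = lim (\<lambda>n. l t (x (d n t)))" for t
  have g: "g \<in> borel_measurable (leb b)" unfolding g_def by (rule borel_measurable_lim_metric[OF m])
  have "AE t in leb b. t \<in> {0..b}" by (rule AE_I2) simp
  with cont have "AE t in leb b. g t = l t (x t)"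
  proof eventually_elim
    case (elim t)
    have "(\<lambda>n. x (d n t)) \<longlonglongrightarrow> x t"
      by (rule continuous_on_tendsto_compose[OF x d_lim elim(2)]) (use d_in elim in auto)
    then have "(\<lambda>n. l t (x (d n t))) \<longlonglongrightarrow> l t (x t)"
      by (rule continuous_on_tendsto_compose[OF elim(1)]) auto
    then show ?case unfolding g_def by (rule limI)
  qed
  \<comment> \<open>The equality holds only almost everywhere; completeness of Lebesgue measure
    carries measurability over.\<close>
  then have "AE t in lebesgue. indicator {0..b} t * g t = indicator {0..b} t * l t (x t)"
    unfolding AE_interval_iff by eventually_elim (simp add: indicator_def)
  moreover have "(\<lambda>t. indicator {0..b} t * g t) \<in> borel_measurable lebesgue"
    using g by (simp add: borel_measurable_restrict_space_iff)
  ultimately have "(\<lambda>t. indicator {0..b} t * l t (x t)) \<in> borel_measurable lebesgue"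
    by (rule borel_measurable_AE[rotated])
  then show ?thesis by (simp add: borel_measurable_restrict_space_iff)
qed

section \<open>Square integrable functions and the Hausdorff distance\<close>

lemma in_L2_add:
  fixes v w :: "real \<Rightarrow> 'a::{real_normed_vector, second_countable_topology}"
  assumes "in_L2 b v" "in_L2 b w"
  shows "in_L2 b (\<lambda>t. v t + w t)"
  unfolding in_L2_def
proof
  show m: "(\<lambda>t. v t + w t) \<in> borel_measurable (leb b)" using assms by (auto simp: in_L2_def)
  show "integrable (leb b) (\<lambda>t. (norm (v t + w t))\<^sup>2)"
  proof (rule Bochner_Integration.integrable_bound)
    show "integrable (leb b) (\<lambda>t. 2 * (norm (v t))\<^sup>2 + 2 * (norm (w t))\<^sup>2)"
      using assms by (auto simp: in_L2_def)
    show "AE t in leb b. norm ((norm (v t + w t))\<^sup>2) \<le> norm (2 * (norm (v t))\<^sup>2 + 2 * (norm (w t))\<^sup>2)"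
    proof (rule AE_I2)
      fix t
      have "(norm (v t + w t))\<^sup>2 \<le> (norm (v t) + norm (w t))\<^sup>2"
        by (intro power_mono norm_triangle_ineq) simp
      also have "\<dots> \<le> 2 * (norm (v t))\<^sup>2 + 2 * (norm (w t))\<^sup>2"
        using sum_squares_bound[of "norm (v t)" "norm (w t)"] by (simp add: power2_sum)
      finally show "norm ((norm (v t + w t))\<^sup>2) \<le> norm (2 * (norm (v t))\<^sup>2 + 2 * (norm (w t))\<^sup>2)" by simp
    qed
  qed (use m in measurable)
qed

lemma in_L2_mult_left: "in_L2 b v \<Longrightarrow> in_L2 b (\<lambda>t. c * v t :: real)"
  by (auto simp: in_L2_def power_mult_distrib)

lemma in_L2_const: "in_L2 b (\<lambda>t. c)"
proof -
  interpret finite_measure "leb b" by (rule finite_measure_lebesgue_on) simp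
  show ?thesis by (simp add: in_L2_def)
qed

lemma in_L2_norm: "in_L2 b v \<Longrightarrow> in_L2 b (\<lambda>t. norm (v t))"
  by (auto simp: in_L2_def)

lemma in_L2_bound:
  fixes v :: "real \<Rightarrow> 'a::{real_normed_vector, second_countable_topology}"
  assumes "v \<in> borel_measurable (leb b)" "in_L2 b m" "AE t in leb b. norm (v t) \<le> m t"
  shows "in_L2 b v"
  unfolding in_L2_def
proof
  show "integrable (leb b) (\<lambda>t. (norm (v t))\<^sup>2)"
  proof (rule Bochner_Integration.integrable_bound)
    show "integrable (leb b) (\<lambda>t. (m t)\<^sup>2)" using assms(2) by (simp add: in_L2_def)
    show "AE t in leb b. norm ((norm (v t))\<^sup>2) \<le> norm ((m t)\<^sup>2)"
      using assms(3) by eventually_elim (simp add: power_mono)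
  qed (use assms(1) in measurable)
qed fact

lemma Haus_leD:
  assumes "Haus A B \<le> ereal c" "a \<in> A"
  shows "infdist a B \<le> c"
proof -
  have "ereal (infdist a B) \<le> (SUP a\<in>A. ereal (infdist a B))" using assms(2) by (rule SUP_upper)
  also have "\<dots> \<le> Haus A B" by (simp add: Haus_def)
  also note assms(1)
  finally show ?thesis by simp
qed

subsection \<open>A priori bounds\<close>

text \<open>Weighting by \<open>exp (- 2 c t)\<close> makes the integral operator a contraction with factor \<open>1/2\<close>.\<close>

lemma integral_inequality_bound:
  fixes p :: "real \<Rightarrow> real"
  assumes b: "0 \<le> b" and cont: "continuous_on {0..b} p" and c: "0 < c" and a: "0 \<le> a"
    and le: "\<And>t. t \<in> {0..b} \<Longrightarrow> p t \<le> a + c * (\<integral>s. p s \<partial>lebesgue_on {0..t})"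
    and t: "t \<in> {0..b}"
  shows "p t \<le> 2 * a * exp (2 * c * b)"
proof -
  have "continuous_on {0..b} (\<lambda>t. p t * exp (- 2 * c * t))" by (intro continuous_intros cont)
  then obtain t0 where t0: "t0 \<in> {0..b}" "\<And>t. t \<in> {0..b} \<Longrightarrow> p t * exp (- 2 * c * t) \<le> p t0 * exp (- 2 * c * t0)"
    using continuous_attains_sup[of "{0..b}" "\<lambda>t. p t * exp (- 2 * c * t)"] b by auto
  define m where "m = p t0 * exp (- 2 * c * t0)"
  have pm: "p t \<le> m * exp (2 * c * t)" if "t \<in> {0..b}" for t
  proof -
    have "p t = p t * exp (- 2 * c * t) * exp (2 * c * t)" by (simp add: exp_minus)
    also have "\<dots> \<le> m * exp (2 * c * t)" using t0(2)[OF that] by (intro mult_right_mono) (auto simp: m_def)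
    finally show ?thesis .
  qed
  have m2: "m \<le> 2 * a"
  proof (cases "m \<le> 0")
    case True
    then show ?thesis using a by linarith
  next
    case False
    have FTC: "((\<lambda>s. exp (2 * c * s)) has_integral (exp (2 * c * t0) / (2 * c) - exp (2 * c * 0) / (2 * c))) {0..t0}"
      by (rule fundamental_theorem_of_calculus)
        (use t0 c in \<open>auto intro!: derivative_eq_intros simp flip: has_real_derivative_iff_has_vector_derivative\<close>)
    have ei: "integrable (lebesgue_on {0..t0}) (\<lambda>s. exp (2 * c * s))"
      by (intro continuous_imp_integrable_real continuous_intros)
    have pi: "integrable (lebesgue_on {0..t0}) p"
      by (intro continuous_imp_integrable_real continuous_on_subset[OF cont]) (use t0 in auto)
    have "(\<integral>s. p s \<partial>lebesgue_on {0..t0}) \<le> (\<integral>s. m * exp (2 * c * s) \<partial>lebesgue_on {0..t0})"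
      by (rule integral_mono) (use pi ei pm t0 in auto)
    also have "\<dots> = m * integral {0..t0} (\<lambda>s. exp (2 * c * s))"
      using lebesgue_integral_eq_integral[OF ei] by simp
    also have "\<dots> = m * ((exp (2 * c * t0) - 1) / (2 * c))"
      using integral_unique[OF FTC] by (simp add: diff_divide_distrib)
    finally have "c * (\<integral>s. p s \<partial>lebesgue_on {0..t0}) \<le> c * (m * ((exp (2 * c * t0) - 1) / (2 * c)))"
      using c by (intro mult_left_mono) auto
    also have "\<dots> = m * exp (2 * c * t0) / 2 - m / 2" using c by (simp add: field_simps)
    \<comment> \<open>At the maximizer t0 the integral term is at most half of p t0, which is where
      the factor 2 in 2 * a comes from.\<close>
    finally have "p t0 \<le> a + m * exp (2 * c * t0) / 2" using le[OF t0(1)] False by linarith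
    moreover have "p t0 = m * exp (2 * c * t0)" by (simp add: m_def exp_minus)
    ultimately have "m * exp (2 * c * t0) \<le> 2 * a" by linarith
    moreover have "m * 1 \<le> m * exp (2 * c * t0)"
      using False t0 c by (intro mult_left_mono) auto
    ultimately show ?thesis by linarith
  qed
  have "p t \<le> m * exp (2 * c * t)" by (rule pm[OF t])
  also have "\<dots> \<le> 2 * a * exp (2 * c * t)" using m2 by (intro mult_right_mono) auto
  also have "\<dots> \<le> 2 * a * exp (2 * c * b)" using t a c by (intro mult_left_mono) auto
  finally show ?thesis .
qed

text \<open>One function P bounds both the forcing h and the derivative of u. The mild formula
  contributes M times its integral and the primitive once, whence the constant M + 1 for the sum of
  the two norms.\<close>

lemma (in bounded_C0_semigroup) coupled_system_bound:
  fixes u u' :: "real \<Rightarrow> 'h::{real_inner, banach, second_countable_topology}"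
  assumes x: "continuous_on {0..b} x" "\<And>t. t \<in> {0..b} \<Longrightarrow> x t = blinfun_apply (T t) x0 + convol h t"
    and h: "integrable (leb b) h"
    and u: "has_W12_derivative b u u'"
    and \<alpha>: "integrable (leb b) \<alpha>" "AE t in leb b. 0 \<le> \<alpha> t"
    and c: "0 < c"
    and hb: "AE t in leb b. norm (h t) \<le> \<alpha> t + c * (norm (x t) + norm (u t))"
    and ub: "AE t in leb b. norm (u' t) \<le> \<alpha> t + c * (norm (x t) + norm (u t))"
    and t: "t \<in> {0..b}"
  shows "norm (x t) + norm (u t) \<le>
    2 * (M * norm x0 + norm (u 0) + (M + 1) * (\<integral>s. \<alpha> s \<partial>leb b)) * exp (2 * ((M + 1) * c) * b)"
proof (rule integral_inequality_bound[OF _ _ _ _ _ t])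
  show "continuous_on {0..b} (\<lambda>t. norm (x t) + norm (u t))"
    by (intro continuous_intros x(1) has_W12_derivative_continuous[OF u])
  have \<alpha>0: "0 \<le> (\<integral>s. \<alpha> s \<partial>leb b)" using \<alpha>(2) by (rule integral_nonneg_AE)
  then show "0 \<le> M * norm x0 + norm (u 0) + (M + 1) * (\<integral>s. \<alpha> s \<partial>leb b)"
    using M_nonneg by auto
  fix t assume t: "t \<in> {0..b}"
  define P where "P s = \<alpha> s + c * (norm (x s) + norm (u s))" for s
  have pi: "integrable (lebesgue_on {0..t}) (\<lambda>s. norm (x s) + norm (u s))"
    by (intro continuous_imp_integrable_real continuous_intros continuous_on_subset[OF x(1)]
        continuous_on_subset[OF has_W12_derivative_continuous[OF u]]) (use t in auto)
  have ai: "integrable (lebesgue_on {0..t}) \<alpha>"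
    by (rule integrable_on_subinterval[OF \<alpha>(1)]) (use t in auto)
  have Pi: "integrable (lebesgue_on {0..t}) P" unfolding P_def using pi ai by simp
  have hi: "integrable (lebesgue_on {0..t}) (\<lambda>s. norm (h s))"
    by (rule integrable_norm[OF integrable_on_subinterval[OF h]]) (use t in auto)
  have hP: "AE s in lebesgue_on {0..t}. norm (h s) \<le> P s"
    unfolding P_def by (rule AE_subinterval[OF hb]) (use t in auto)
  have uP: "AE s in lebesgue_on {0..t}. norm (u' s) \<le> P s"
    unfolding P_def by (rule AE_subinterval[OF ub]) (use t in auto)
  have "norm (x t) \<le> norm (blinfun_apply (T t) x0) + norm (convol h t)"
    unfolding x(2)[OF t] by (rule norm_triangle_ineq)
  also have "\<dots> \<le> M * norm x0 + M * (\<integral>s. norm (h s) \<partial>lebesgue_on {0..t})"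
    by (intro add_mono norm_T_apply_le norm_convol_le h t)
  also have "(\<integral>s. norm (h s) \<partial>lebesgue_on {0..t}) \<le> (\<integral>s. P s \<partial>lebesgue_on {0..t})"
    by (rule integral_mono_AE[OF hi Pi hP])
  finally have nx: "norm (x t) \<le> M * norm x0 + M * (\<integral>s. P s \<partial>lebesgue_on {0..t})"
    using M_nonneg mult_left_mono by auto
  have "u t - u 0 = (\<integral>s. u' s \<partial>lebesgue_on {0..t})"
    by (rule has_W12_derivative_diff[OF u]) (use t in auto)
  then have "norm (u t - u 0) \<le> (\<integral>s. P s \<partial>lebesgue_on {0..t})"
    using norm_integral_le_bound[OF Pi uP] by simp
  then have nu: "norm (u t) \<le> norm (u 0) + (\<integral>s. P s \<partial>lebesgue_on {0..t})"
    using norm_triangle_sub[of "u t" "u 0"] by linarith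
  have "(\<integral>s. \<alpha> s \<partial>lebesgue_on {0..t}) \<le> (\<integral>s. \<alpha> s \<partial>leb b)"
  proof -
    have "AE s in lebesgue_on {t..b}. 0 \<le> \<alpha> s" by (rule AE_subinterval[OF \<alpha>(2)]) (use t in auto)
    then have "0 \<le> (\<integral>s. \<alpha> s \<partial>lebesgue_on {t..b})" by (rule integral_nonneg_AE)
    then show ?thesis using integral_interval_combine[OF \<alpha>(1), of t] t by auto
  qed
  moreover have "(\<integral>s. P s \<partial>lebesgue_on {0..t})
      = (\<integral>s. \<alpha> s \<partial>lebesgue_on {0..t}) + c * (\<integral>s. norm (x s) + norm (u s) \<partial>lebesgue_on {0..t})"
    unfolding P_def using Bochner_Integration.integral_add[OF ai integrable_mult_right[OF pi, of c]] by simp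
  ultimately have "(\<integral>s. P s \<partial>lebesgue_on {0..t})
      \<le> (\<integral>s. \<alpha> s \<partial>leb b) + c * (\<integral>s. norm (x s) + norm (u s) \<partial>lebesgue_on {0..t})" by linarith
  then have "(M + 1) * (\<integral>s. P s \<partial>lebesgue_on {0..t})
      \<le> (M + 1) * ((\<integral>s. \<alpha> s \<partial>leb b) + c * (\<integral>s. norm (x s) + norm (u s) \<partial>lebesgue_on {0..t}))"
    using M_nonneg by (intro mult_left_mono) auto
  then show "norm (x t) + norm (u t) \<le> M * norm x0 + norm (u 0) + (M + 1) * (\<integral>s. \<alpha> s \<partial>leb b)
      + (M + 1) * c * (\<integral>s. norm (x s) + norm (u s) \<partial>lebesgue_on {0..t})"
    using nx nu by (simp add: algebra_simps)
qed (use b c M_nonneg in auto)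

subsection \<open>Trajectories of the control system\<close>

text \<open>The hypotheses at one fixed pair (\<zeta>, \<eta>): \<open>A t u\<close> stands for
  B(t,u,\<eta>), so the parameter term of the pseudo-distance is gone, weak compactness has become
  closedness, and set norms are unfolded into bounds on elements.\<close>

locale control_system = bounded_C0_semigroup T b M
  for T :: "real \<Rightarrow> 'e::{real_inner, banach, second_countable_topology} \<Rightarrow>\<^sub>L 'e" and b M :: real +
  fixes A :: "real \<Rightarrow> 'h::{real_inner, banach, second_countable_topology} \<Rightarrow> 'h \<Rightarrow> 'h set"
    and F :: "real \<Rightarrow> 'e \<Rightarrow> 'h \<Rightarrow> 'e set" and G :: "real \<Rightarrow> 'e \<Rightarrow> 'h \<Rightarrow> 'h set"
    and W :: "real \<Rightarrow> 'y::{real_inner, banach, second_countable_topology} set"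
    and Bop :: "'y \<Rightarrow>\<^sub>L 'e" and x0 :: 'e and u0 :: 'h
    and \<theta> \<theta>' :: "real \<Rightarrow> real" and lam MB MF MG :: real and \<phi>W kF kG :: "real \<Rightarrow> real"
  assumes T_compact: "\<And>t. t > 0 \<Longrightarrow> compact_operator (T t)"
    and mm: "\<And>t u. t \<in> {0..b} \<Longrightarrow> maximal_monotone (A t u)"
    and \<theta>: "has_W12_derivative b \<theta> \<theta>'" and lam: "0 \<le> lam" "lam < 1"
    and dis_A: "\<And>t s u v. t \<in> {0..b} \<Longrightarrow> s \<in> {0..b} \<Longrightarrow>
      dis (A t u) (A s v) \<le> ereal (\<bar>\<theta> t - \<theta> s\<bar> + lam * norm (u - v))"
    and MB: "0 \<le> MB" "\<And>t u v. t \<in> {0..b} \<Longrightarrow> v \<in> op_dom (A t u) \<Longrightarrow>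
      norm (minimal_section (A t u) v) \<le> MB * (1 + norm u + norm v)"
    and dom_compact: "\<And>R. ball_relatively_compact (\<Union>t\<in>{0..b}. \<Union>u\<in>cball 0 R. op_dom (A t u))"
    and F: "\<And>t x u. t \<in> {0..b} \<Longrightarrow> F t x u \<noteq> {} \<and> closed (F t x u) \<and> convex (F t x u)"
    and MF: "0 \<le> MF" "AE t in leb b. \<forall>x u. \<forall>f\<in>F t x u. norm f \<le> MF * (1 + norm x + norm u)"
    and Haus_F: "AE t in leb b. \<forall>x u y v. Haus (F t x u) (F t y v) \<le> ereal (kF t * (norm (x - y) + norm (u - v)))"
    and G: "\<And>t x u. t \<in> {0..b} \<Longrightarrow> G t x u \<noteq> {} \<and> closed (G t x u) \<and> convex (G t x u)"
    and MG: "0 \<le> MG" "AE t in leb b. \<forall>x u. \<forall>g\<in>G t x u. norm g \<le> MG * (1 + norm x + norm u)"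
    and Haus_G: "AE t in leb b. \<forall>x u y v. Haus (G t x u) (G t y v) \<le> ereal (kG t * (norm (x - y) + norm (u - v)))"
    and W: "\<And>t. t \<in> {0..b} \<Longrightarrow> closed (W t) \<and> convex (W t)"
    and \<phi>W: "in_L2 b \<phi>W" "AE t in leb b. \<forall>w\<in>W t. norm w \<le> \<phi>W t"
begin

lemma AE_in_interval: "AE t in leb b. t \<in> {0..b}"
  by (rule AE_I2) simp

text \<open>The selections and the derivative are arguments instead of being bound existentially, so
  that sequences of them are at hand for averaging.\<close>

definition trajectory ::
  "(real \<Rightarrow> 'y) \<Rightarrow> (real \<Rightarrow> 'e) \<Rightarrow> (real \<Rightarrow> 'h) \<Rightarrow> (real \<Rightarrow> 'h) \<Rightarrow> (real \<Rightarrow> 'e) \<Rightarrow> (real \<Rightarrow> 'h) \<Rightarrow> bool" where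
  "trajectory w x u u' f g \<longleftrightarrow> in_L2 b w \<and> (AE t in leb b. w t \<in> W t) \<and>
     continuous_on {0..b} x \<and> u 0 = u0 \<and> has_W12_derivative b u u' \<and>
     integrable (leb b) f \<and> integrable (leb b) g \<and>
     (AE t in leb b. f t \<in> F t (x t) (u t) \<and> g t \<in> G t (x t) (u t) \<and> - u' t + g t \<in> A t (u t) (u t)) \<and>
     (\<forall>t\<in>{0..b}. x t = blinfun_apply (T t) x0 + convol (\<lambda>s. f s + Bop (w s)) t)"

lemma trajectory_forcing_integrable:
  assumes "trajectory w x u u' f g"
  shows "integrable (leb b) (\<lambda>s. f s + Bop (w s))"
proof -
  have "integrable (leb b) w" using assms in_L2_integrable by (auto simp: trajectory_def)
  then have "integrable (leb b) (\<lambda>s. Bop (w s))"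
    by (rule integrable_bounded_linear[OF blinfun.bounded_linear_right])
  then show ?thesis using assms by (auto simp: trajectory_def)
qed

text \<open>The growth conditions and the velocity bound are affine in the norms of the states, so
  \<open>coupled_system_bound\<close> gives one R for all trajectories; inserting R back gives one
  square integrable bound for all velocities.\<close>

lemma trajectory_bounds:
  obtains R m where "in_L2 b m" "\<And>t. 0 \<le> m t"
    "\<And>w x u u' f g t. trajectory w x u u' f g \<Longrightarrow> t \<in> {0..b} \<Longrightarrow> norm (x t) \<le> R \<and> norm (u t) \<le> R"
    "\<And>w x u u' f g. trajectory w x u u' f g \<Longrightarrow> AE t in leb b.
      norm (f t) \<le> m t \<and> norm (w t) \<le> m t \<and> norm (g t) \<le> m t \<and> norm (u' t) \<le> m t"
proof -
  define K where "K = 3 * (1 + 2 * MB) / (1 - lam)"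
  have K0: "0 \<le> K" using lam MB by (simp add: K_def)
  define B0 where "B0 = norm Bop"
  have B0: "0 \<le> B0" by (simp add: B0_def)
  \<comment> \<open>\<alpha> collects what does not depend on the states, and c the coefficients of
    norm (x t) + norm (u t), once norm (g t) has been replaced by its growth bound. The summand 1
    makes c positive.\<close>
  define \<alpha> where "\<alpha> t = (MF + K * (1 + MG)) + B0 * \<bar>\<phi>W t\<bar> + K * \<bar>\<theta>' t\<bar>" for t
  define c where "c = MF + K * (MG + 1) + 1"
  have c: "0 < c" using MF(1) MG(1) K0 by (simp add: c_def add_nonneg_pos)
  have \<theta>'2: "in_L2 b \<theta>'" using \<theta> by (simp add: has_W12_derivative_def)
  have \<alpha>2: "in_L2 b \<alpha>"
    unfolding \<alpha>_def using in_L2_norm[OF \<phi>W(1)] in_L2_norm[OF \<theta>'2]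
    by (intro in_L2_add in_L2_mult_left in_L2_const) auto
  have \<alpha>0: "0 \<le> \<alpha> t" for t using MF(1) MG(1) K0 B0 by (simp add: \<alpha>_def)
  define R where "R = 2 * (M * norm x0 + norm u0 + (M + 1) * (\<integral>s. \<alpha> s \<partial>leb b)) * exp (2 * ((M + 1) * c) * b)"
  have pre: "(AE t in leb b. norm (f t) \<le> MF * (1 + norm (x t) + norm (u t))) \<and>
      (AE t in leb b. norm (g t) \<le> MG * (1 + norm (x t) + norm (u t))) \<and>
      (AE t in leb b. norm (w t) \<le> \<bar>\<phi>W t\<bar>) \<and>
      (AE t in leb b. norm (u' t) \<le> \<alpha> t + c * (norm (x t) + norm (u t))) \<and>
      (AE t in leb b. norm (f t + Bop (w t)) \<le> \<alpha> t + c * (norm (x t) + norm (u t)))"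
    if tr: "trajectory w x u u' f g" for w x u u' f g
  proof (intro conjI)
    have incl: "AE t in leb b. f t \<in> F t (x t) (u t) \<and> g t \<in> G t (x t) (u t) \<and> - u' t + g t \<in> A t (u t) (u t)"
      using tr by (simp add: trajectory_def)
    show f: "AE t in leb b. norm (f t) \<le> MF * (1 + norm (x t) + norm (u t))"
      using incl MF(2) by eventually_elim blast
    show g: "AE t in leb b. norm (g t) \<le> MG * (1 + norm (x t) + norm (u t))"
      using incl MG(2) by eventually_elim blast
    have "AE t in leb b. w t \<in> W t" using tr by (simp add: trajectory_def)
    then show w: "AE t in leb b. norm (w t) \<le> \<bar>\<phi>W t\<bar>"
      using \<phi>W(2) by eventually_elim force
    have "AE t in leb b. norm (u' t) \<le> K * (1 + norm (g t) + norm (u t) + \<bar>\<theta>' t\<bar>)"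
      unfolding K_def
    proof (rule evolution_derivative_bound[OF mm dis_A lam MB(2) MB(1) \<theta>])
      show "has_W12_derivative b u u'" using tr by (simp add: trajectory_def)
      show "AE t in leb b. - u' t + g t \<in> A t (u t) (u t)" using incl by eventually_elim blast
    qed
    then show "AE t in leb b. norm (u' t) \<le> \<alpha> t + c * (norm (x t) + norm (u t))"
      using g
    proof eventually_elim
      case (elim t)
      have "K * (1 + norm (g t) + norm (u t) + \<bar>\<theta>' t\<bar>)
          \<le> K * (1 + MG * (1 + norm (x t) + norm (u t)) + (norm (x t) + norm (u t)) + \<bar>\<theta>' t\<bar>)"
        using K0 by (intro mult_left_mono) (use elim(2) norm_ge_zero[of "x t"] in linarith)+
      also have "\<dots> = K * (1 + MG) + K * \<bar>\<theta>' t\<bar> + K * (MG + 1) * (norm (x t) + norm (u t))"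
        by (simp add: algebra_simps)
      also have "\<dots> \<le> \<alpha> t + c * (norm (x t) + norm (u t))"
      proof (rule add_mono)
        show "K * (1 + MG) + K * \<bar>\<theta>' t\<bar> \<le> \<alpha> t" unfolding \<alpha>_def using MF(1) B0 by auto
        show "K * (MG + 1) * (norm (x t) + norm (u t)) \<le> c * (norm (x t) + norm (u t))"
          unfolding c_def using MF(1) by (intro mult_right_mono) auto
      qed
      finally show ?case using elim(1) by linarith
    qed
    show "AE t in leb b. norm (f t + Bop (w t)) \<le> \<alpha> t + c * (norm (x t) + norm (u t))"
      using f w
    proof eventually_elim
      case (elim t)
      have "norm (Bop (w t)) \<le> B0 * norm (w t)" unfolding B0_def by (rule norm_blinfun)
      also have "\<dots> \<le> B0 * \<bar>\<phi>W t\<bar>" using elim(2) B0 by (intro mult_left_mono)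
      finally have "norm (f t + Bop (w t)) \<le> MF * (1 + norm (x t) + norm (u t)) + B0 * \<bar>\<phi>W t\<bar>"
        using elim(1) norm_triangle_ineq[of "f t" "Bop (w t)"] by linarith
      also have "\<dots> = MF + B0 * \<bar>\<phi>W t\<bar> + MF * (norm (x t) + norm (u t))" by (simp add: algebra_simps)
      also have "\<dots> \<le> \<alpha> t + c * (norm (x t) + norm (u t))"
      proof (rule add_mono)
        show "MF + B0 * \<bar>\<phi>W t\<bar> \<le> \<alpha> t" unfolding \<alpha>_def using MG(1) K0 by simp
        show "MF * (norm (x t) + norm (u t)) \<le> c * (norm (x t) + norm (u t))"
          unfolding c_def using MG(1) K0 by (intro mult_right_mono) auto
      qed
      finally show ?case .
    qed
  qed
  have R: "norm (x t) + norm (u t) \<le> R" if tr: "trajectory w x u u' f g" and t: "t \<in> {0..b}" for w x u u' f g t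
  proof -
    have "norm (x t) + norm (u t) \<le>
        2 * (M * norm x0 + norm (u 0) + (M + 1) * (\<integral>s. \<alpha> s \<partial>leb b)) * exp (2 * ((M + 1) * c) * b)"
    proof (rule coupled_system_bound[OF _ _ _ _ _ _ c _ _ t])
      show "integrable (leb b) (\<lambda>s. f s + Bop (w s))" by (rule trajectory_forcing_integrable[OF tr])
      show "integrable (leb b) \<alpha>" by (rule in_L2_integrable[OF \<alpha>2])
      show "has_W12_derivative b u u'" using tr by (simp add: trajectory_def)
    qed (use tr pre[OF tr] \<alpha>0 in \<open>auto simp: trajectory_def\<close>)
    moreover have "u 0 = u0" using tr by (simp add: trajectory_def)
    ultimately show ?thesis by (simp add: R_def)
  qed
  have R0: "0 \<le> R"
    unfolding R_def using M_nonneg \<alpha>0 by (intro mult_nonneg_nonneg add_nonneg_nonneg integral_nonneg) auto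
  \<comment> \<open>Each velocity is dominated by some of these non-negative summands, so one m
    serves all four.\<close>
  define m where "m t = (MF * (1 + R) + MG * (1 + R) + c * R) + \<bar>\<phi>W t\<bar> + \<alpha> t" for t
  show ?thesis
  proof (rule that[of m R])
    show "in_L2 b m"
      unfolding m_def using in_L2_norm[OF \<phi>W(1)] \<alpha>2 by (intro in_L2_add in_L2_const) auto
    show "0 \<le> m t" for t using MF(1) MG(1) R0 c \<alpha>0 by (simp add: m_def)
    fix w x u u' f g assume tr: "trajectory w x u u' f g"
    show "norm (x t) \<le> R \<and> norm (u t) \<le> R" if "t \<in> {0..b}" for t
      using R[OF tr that] norm_ge_zero[of "x t"] norm_ge_zero[of "u t"] by linarith
    from pre[OF tr] have p: "AE t in leb b. norm (f t) \<le> MF * (1 + norm (x t) + norm (u t))"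
      "AE t in leb b. norm (g t) \<le> MG * (1 + norm (x t) + norm (u t))"
      "AE t in leb b. norm (w t) \<le> \<bar>\<phi>W t\<bar>"
      "AE t in leb b. norm (u' t) \<le> \<alpha> t + c * (norm (x t) + norm (u t))" by auto
    show "AE t in leb b. norm (f t) \<le> m t \<and> norm (w t) \<le> m t \<and> norm (g t) \<le> m t \<and> norm (u' t) \<le> m t"
      using p AE_in_interval
    proof eventually_elim
      case (elim t)
      have le: "norm (x t) + norm (u t) \<le> R" by (rule R[OF tr elim(5)])
      have "MF * (1 + norm (x t) + norm (u t)) \<le> MF * (1 + R)" "MG * (1 + norm (x t) + norm (u t)) \<le> MG * (1 + R)"
        "c * (norm (x t) + norm (u t)) \<le> c * R"
        using le MF(1) MG(1) c by (auto intro!: mult_left_mono)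
      moreover have "0 \<le> MF * (1 + R)" "0 \<le> MG * (1 + R)" "0 \<le> c * R" "0 \<le> \<alpha> t" "0 \<le> \<bar>\<phi>W t\<bar>"
        using MF(1) MG(1) c R0 \<alpha>0 by auto
      ultimately show ?case using elim(1-4) unfolding m_def by linarith
    qed
  qed
qed

text \<open>The inclusion places u t in a domain for almost every t only; taking the closure and
  using continuity of u covers the remaining times.\<close>

lemma trajectory_state_in_compact:
  assumes R: "\<And>w x u u' f g t. trajectory w x u u' f g \<Longrightarrow> t \<in> {0..b} \<Longrightarrow> norm (x t) \<le> R \<and> norm (u t) \<le> R"
  obtains K where "compact K" "\<And>w x u u' f g t. trajectory w x u u' f g \<Longrightarrow> t \<in> {0..b} \<Longrightarrow> u t \<in> K"
proof -
  define K where "K = closure ((\<Union>t\<in>{0..b}. \<Union>u\<in>cball 0 R. op_dom (A t u)) \<inter> cball 0 R)"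
  have "compact K"
    using dom_compact[of R] unfolding K_def ball_relatively_compact_def relatively_compact_def by blast
  moreover have "u t \<in> K" if tr: "trajectory w x u u' f g" and t: "t \<in> {0..b}" for w x u u' f g t
  proof -
    have "AE t in leb b. f t \<in> F t (x t) (u t) \<and> g t \<in> G t (x t) (u t) \<and> - u' t + g t \<in> A t (u t) (u t)"
      using tr by (simp add: trajectory_def)
    then have "AE s in leb b. - u' s + g s \<in> A s (u s) (u s)" by eventually_elim blast
    with AE_in_interval have ae: "AE s in leb b. u s \<in> K"
    proof eventually_elim
      case (elim s)
      have "u s \<in> op_dom (A s (u s))" using elim(2) by (auto simp: op_dom_def)
      moreover have "u s \<in> cball 0 R" using R[OF tr elim(1)] by simp
      ultimately have "u s \<in> (\<Union>t\<in>{0..b}. \<Union>u\<in>cball 0 R. op_dom (A t u)) \<inter> cball 0 R"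
        using elim(1) by blast
      then show ?case unfolding K_def by (rule subsetD[OF closure_subset])
    qed
    have cont: "continuous_on {0..b} u"
      using tr has_W12_derivative_continuous unfolding trajectory_def by blast
    have "\<exists>s. \<bar>s - t\<bar> < 1 / real (Suc n) \<and> s \<in> {0..b} \<and> u s \<in> K" for n
    proof -
      define \<delta> where "\<delta> = 1 / real (Suc n)"
      have "\<delta> > 0" by (simp add: \<delta>_def)
      then have "max 0 (t - \<delta>) < min b (t + \<delta>)" using t b by auto
      then obtain s where "max 0 (t - \<delta>) < s" "s < min b (t + \<delta>)" "u s \<in> K"
        using AE_interval_ex[OF ae, of "max 0 (t - \<delta>)" "min b (t + \<delta>)"] by auto
      then show ?thesis unfolding \<delta>_def[symmetric] by (intro exI[of _ s]) (auto simp: abs_less_iff)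
    qed
    then obtain s where s: "\<And>n. \<bar>s n - t\<bar> < 1 / real (Suc n)" "\<And>n. s n \<in> {0..b}" "\<And>n. u (s n) \<in> K" by metis
    have "(\<lambda>n. s n - t) \<longlonglongrightarrow> 0"
      by (rule Lim_null_comparison[OF _ LIMSEQ_Suc[OF lim_1_over_n]])
        (use s(1) in \<open>auto intro!: always_eventually less_imp_le\<close>)
    then have "s \<longlonglongrightarrow> t" by (simp add: LIM_zero_iff)
    then have "(\<lambda>n. u (s n)) \<longlonglongrightarrow> u t"
      by (rule continuous_on_tendsto_compose[OF cont _ t]) (simp add: s(2) del: atLeastAtMost_iff)
    moreover have "closed K" by (simp add: K_def)
    ultimately show ?thesis using s(3) by (metis closed_sequentially)
  qed
  ultimately show ?thesis by (rule that)
qed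

lemma trajectory_compactness:
  assumes tr: "\<And>n. trajectory (w n) (x n) (u n) (u' n) (f n) (g n)"
  obtains r :: "nat \<Rightarrow> nat" and xl ul where "strict_mono r"
    "\<And>t. t \<in> {0..b} \<Longrightarrow> (\<lambda>n. x (r n) t) \<longlonglongrightarrow> xl t" "\<And>t. t \<in> {0..b} \<Longrightarrow> (\<lambda>n. u (r n) t) \<longlonglongrightarrow> ul t"
proof -
  obtain R m where m: "in_L2 b m" "\<And>t. 0 \<le> m t"
    and R: "\<And>w x u u' f g t. trajectory w x u u' f g \<Longrightarrow> t \<in> {0..b} \<Longrightarrow> norm (x t) \<le> R \<and> norm (u t) \<le> R"
    and fm: "\<And>w x u u' f g. trajectory w x u u' f g \<Longrightarrow> AE t in leb b.
      norm (f t) \<le> m t \<and> norm (w t) \<le> m t \<and> norm (g t) \<le> m t \<and> norm (u' t) \<le> m t"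
    by (rule trajectory_bounds) (rule that)
  obtain K where K: "compact K" "\<And>w x u u' f g t. trajectory w x u u' f g \<Longrightarrow> t \<in> {0..b} \<Longrightarrow> u t \<in> K"
    by (rule trajectory_state_in_compact[of R]) (erule (1) R, rule that)
  define h where "h n s = f n s + Bop (w n s)" for n s
  have h: "integrable (leb b) (h n)" for n unfolding h_def by (rule trajectory_forcing_integrable[OF tr])
  have mi: "integrable (leb b) m" by (rule in_L2_integrable[OF m(1)])
  have hmi: "integrable (leb b) (\<lambda>t. (1 + norm Bop) * m t)" using mi by simp
  have hm: "AE s in leb b. norm (h n s) \<le> (1 + norm Bop) * m s" for n
    using fm[OF tr[of n]]
  proof eventually_elim
    case (elim s)
    have "norm (Bop (w n s)) \<le> norm Bop * m s"
      using norm_blinfun[of Bop "w n s"] mult_left_mono[of "norm (w n s)" "m s" "norm Bop"] elim by simp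
    then show ?case
      using elim norm_triangle_ineq[of "f n s" "Bop (w n s)"] by (simp add: h_def algebra_simps)
  qed
  have x_eq: "x n t = blinfun_apply (T t) x0 + convol (h n) t" if "t \<in> {0..b}" for n t
    using tr[of n] that unfolding trajectory_def h_def by blast
  \<comment> \<open>The term \<open>T t\<close> applied to x0 is common to all n, so only the
    convolution and u need a subsequence; pairing them makes one extraction enough.\<close>
  define y where "y n t = (convol (h n) t, u n t)" for n t
  obtain r where r: "strict_mono (r :: nat \<Rightarrow> nat)" "\<And>t. t \<in> {0..b} \<Longrightarrow> convergent (\<lambda>n. y (r n) t)"
  proof (rule pointwise_convergent_subsequence[of b y])
    show "\<exists>K. compact K \<and> (\<forall>n. y n t \<in> K)" if t: "t \<in> {0..b}" for t
    proof (intro exI conjI allI)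
      show "compact (closure (range (\<lambda>n. convol (h n) t)) \<times> K)"
        by (intro compact_Times convol_relatively_compact[OF T_compact h hmi hm t] K(1))
      show "y n t \<in> closure (range (\<lambda>n. convol (h n) t)) \<times> K" for n
        unfolding y_def using K(2)[OF tr t] closure_subset[of "range (\<lambda>n. convol (h n) t)"] by blast
    qed
    show "\<exists>d>0. \<forall>\<tau>. t \<le> \<tau> \<and> \<tau> < t + d \<and> \<tau> \<le> b \<longrightarrow> (\<forall>n. dist (y n \<tau>) (y n t) < e)"
      if t: "t \<in> {0..b}" and e: "e > 0" for t e
    proof -
      obtain d1 where d1: "d1 > 0" "\<And>\<tau> n. t \<le> \<tau> \<Longrightarrow> \<tau> < t + d1 \<Longrightarrow> \<tau> \<le> b \<Longrightarrow>
          dist (convol (h n) \<tau>) (convol (h n) t) < e / 2"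
        using convol_right_equicontinuous[OF T_compact h hmi hm t half_gt_zero[OF e], of "\<lambda>n. n"] by metis
      obtain d2 where d2: "d2 > 0" "\<And>c. c \<in> {0..b} \<Longrightarrow> t \<le> c \<Longrightarrow> c - t < d2 \<Longrightarrow> \<bar>\<integral>x. m x \<partial>lebesgue_on {t..c}\<bar> < e / 2"
        using integral_interval_small[OF mi t, of "e / 2"] e by (metis half_gt_zero)
      show ?thesis
      proof (intro exI[of _ "min d1 d2"] conjI allI impI)
        fix \<tau> n assume \<tau>: "t \<le> \<tau> \<and> \<tau> < t + min d1 d2 \<and> \<tau> \<le> b"
        have "has_W12_derivative b (u n) (u' n)" using tr by (simp add: trajectory_def)
        then have "u n \<tau> - u n t = (\<integral>s. u' n s \<partial>lebesgue_on {t..\<tau>})"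
          by (rule has_W12_derivative_diff) (use \<tau> t in auto)
        moreover have "norm (\<integral>s. u' n s \<partial>lebesgue_on {t..\<tau>}) \<le> (\<integral>s. m s \<partial>lebesgue_on {t..\<tau>})"
        proof (rule norm_integral_le_bound)
          show "integrable (lebesgue_on {t..\<tau>}) m" by (rule integrable_on_subinterval[OF mi]) (use \<tau> t in auto)
          have "AE s in leb b. norm (u' n s) \<le> m s" using fm[OF tr[of n]] by eventually_elim simp
          then show "AE s in lebesgue_on {t..\<tau>}. norm (u' n s) \<le> m s"
            by (rule AE_subinterval) (use \<tau> t in auto)
        qed
        moreover have "\<bar>\<integral>x. m x \<partial>lebesgue_on {t..\<tau>}\<bar> < e / 2" by (rule d2(2)) (use \<tau> t in auto)
        ultimately have "dist (u n \<tau>) (u n t) < e / 2" by (simp add: dist_norm)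
        moreover have "dist (convol (h n) \<tau>) (convol (h n) t) < e / 2" by (rule d1(2)) (use \<tau> in auto)
        moreover have "dist (y n \<tau>) (y n t) \<le> dist (convol (h n) \<tau>) (convol (h n) t) + dist (u n \<tau>) (u n t)"
          unfolding y_def dist_Pair_Pair by (rule sqrt_sum_squares_le_sum) auto
        ultimately show "dist (y n \<tau>) (y n t) < e" by linarith
      qed (use d1 d2 in auto)
    qed
  qed (use b in auto)
  define z where "z t = lim (\<lambda>n. y (r n) t)" for t
  have z: "(\<lambda>n. y (r n) t) \<longlonglongrightarrow> z t" if "t \<in> {0..b}" for t
    using r(2)[OF that] unfolding z_def by (simp add: convergent_LIMSEQ_iff)
  show ?thesis
  proof (rule that[OF r(1)])
    fix t assume t: "t \<in> {0..b}"
    show "(\<lambda>n. x (r n) t) \<longlonglongrightarrow> blinfun_apply (T t) x0 + fst (z t)"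
      using tendsto_add[OF tendsto_const tendsto_fst[OF z[OF t]], of "blinfun_apply (T t) x0"]
      by (simp add: x_eq[OF t] y_def)
    show "(\<lambda>n. u (r n) t) \<longlonglongrightarrow> snd (z t)"
      using tendsto_snd[OF z[OF t]] by (simp add: y_def)
  qed
qed

text \<open>The limits of averaged velocities are shown to drive the limit states. Closed convex
  constraints pass to the limit pointwise in t, integral equations by linearity, and the control
  cost by convexity.\<close>

lemma trajectory_closed:
  assumes tr: "\<And>n. trajectory (w n) (x n) (u n) (u' n) (f n) (g n)"
    and x: "\<And>t. t \<in> {0..b} \<Longrightarrow> (\<lambda>n. x n t) \<longlonglongrightarrow> xl t"
    and u: "\<And>t. t \<in> {0..b} \<Longrightarrow> (\<lambda>n. u n t) \<longlonglongrightarrow> ul t"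
  shows "\<exists>wl ul' fl gl. trajectory wl xl ul ul' fl gl \<and>
    (\<forall>\<rho>. (\<lambda>n. control_cost b (w n)) \<longlonglongrightarrow> \<rho> \<longrightarrow> control_cost b wl \<le> \<rho>)"
proof -
  obtain R m where m: "in_L2 b m" "\<And>t. 0 \<le> m t"
    and fm: "\<And>w x u u' f g. trajectory w x u u' f g \<Longrightarrow> AE t in leb b.
      norm (f t) \<le> m t \<and> norm (w t) \<le> m t \<and> norm (g t) \<le> m t \<and> norm (u' t) \<le> m t"
    by (rule trajectory_bounds) (rule that)
  \<comment> \<open>One vector in a product of Hilbert spaces, so that f, w, g and u' are averaged
    with the same weights.\<close>
  define v where "v k t = (f k t, w k t, g k t, u' k t)" for k t
  \<comment> \<open>The norm of the quadruple is at most the sum of four norms, each bounded by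
    m.\<close>
  define m4 where "m4 t = 4 * m t" for t
  have m4: "in_L2 b m4" unfolding m4_def by (rule in_L2_mult_left[OF m(1)])
  have m4i: "integrable (leb b) m4" by (rule in_L2_integrable[OF m4])
  have m4sq: "integrable (leb b) (\<lambda>t. (m4 t)\<^sup>2)" using m4 by (simp add: in_L2_def)
  have vm: "v k \<in> borel_measurable (leb b)" for k
    unfolding v_def using tr[of k]
    by (intro borel_measurable_Pair) (auto simp: trajectory_def has_W12_derivative_def in_L2_def)
  have vb: "AE t in leb b. norm (v k t) \<le> m4 t" for k
    using fm[OF tr[of k]]
  proof eventually_elim
    case (elim t)
    have "norm (v k t) \<le> norm (f k t) + (norm (w k t) + (norm (g k t) + norm (u' k t)))"
      unfolding v_def by (intro order_trans[OF norm_Pair_le] add_left_mono order_refl)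
    then show ?case using elim unfolding m4_def by linarith
  qed
  have fin: "finite_measure (leb b)" by (rule finite_measure_lebesgue_on) simp
  obtain q z where q: "\<And>n. q n \<in> tail_hull v n" and z: "z \<in> borel_measurable (leb b)"
    and qz: "AE t in leb b. (\<lambda>n. q n t) \<longlonglongrightarrow> z t"
    by (rule tail_hull_convergent[OF fin vm m4sq vb]) (rule that)
  define fl where "fl t = fst (z t)" for t
  define wl where "wl t = fst (snd (z t))" for t
  define gl where "gl t = fst (snd (snd (z t)))" for t
  define ul' where "ul' t = snd (snd (snd (z t)))" for t
  have vb': "AE t in leb b. \<forall>k. norm (v k t) \<le> m4 t" using vb by (simp add: AE_all_countable)
  have zb: "AE t in leb b. norm (z t) \<le> m4 t"
    using qz vb'
  proof eventually_elim
    case (elim t)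
    have "z t \<in> cball 0 (m4 t)"
      by (rule tail_hull_limit_mem[OF q elim(1)]) (use elim(2) in auto)
    then show ?case by simp
  qed
  have L: "in_L2 b (\<lambda>t. L (z t))" if "bounded_linear L" "\<And>y. norm (L y) \<le> norm y"
    for L :: "'e \<times> 'y \<times> 'h \<times> 'h \<Rightarrow> 'c::{banach, second_countable_topology}"
  proof (rule in_L2_bound[OF _ m4])
    show "(\<lambda>t. L (z t)) \<in> borel_measurable (leb b)"
      by (rule measurable_compose[OF z borel_measurable_continuous_onI[OF linear_continuous_on[OF that(1)]]])
    show "AE t in leb b. norm (L (z t)) \<le> m4 t"
      using zb by eventually_elim (use that(2) order_trans in blast)
  qed
  have bl: "bounded_linear (fst :: 'e \<times> 'y \<times> 'h \<times> 'h \<Rightarrow> 'e)"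
    "bounded_linear (\<lambda>p :: 'e \<times> 'y \<times> 'h \<times> 'h. fst (snd p))"
    "bounded_linear (\<lambda>p :: 'e \<times> 'y \<times> 'h \<times> 'h. fst (snd (snd p)))"
    "bounded_linear (\<lambda>p :: 'e \<times> 'y \<times> 'h \<times> 'h. snd (snd (snd p)))"
    by (intro bounded_linear_intros)+
  have nl: "norm (fst p) \<le> norm p" "norm (fst (snd p)) \<le> norm p"
    "norm (fst (snd (snd p))) \<le> norm p" "norm (snd (snd (snd p))) \<le> norm p"
    for p :: "'e \<times> 'y \<times> 'h \<times> 'h"
  proof -
    obtain a c d e where p: "p = (a, c, d, e)" by (cases p)
    have 1: "norm (c, d, e) \<le> norm p" "norm a \<le> norm p" unfolding p by (rule norm_snd_le norm_fst_le)+
    have 2: "norm (d, e) \<le> norm p" "norm c \<le> norm p"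
      using norm_snd_le[of "(d, e)" c] norm_fst_le[of c "(d, e)"] 1 by linarith+
    have 3: "norm e \<le> norm p" "norm d \<le> norm p"
      using norm_snd_le[of e d] norm_fst_le[of d e] 2 by linarith+
    show "norm (fst p) \<le> norm p" "norm (fst (snd p)) \<le> norm p"
      "norm (fst (snd (snd p))) \<le> norm p" "norm (snd (snd (snd p))) \<le> norm p"
      using 1 2 3 by (simp_all add: p)
  qed
  have f2: "in_L2 b fl" and w2: "in_L2 b wl" and g2: "in_L2 b gl" and u2: "in_L2 b ul'"
    unfolding fl_def wl_def gl_def ul'_def by (rule L; (rule bl nl))+
  have incl: "AE t in leb b. \<forall>k. f k t \<in> F t (x k t) (u k t) \<and> g k t \<in> G t (x k t) (u k t)
      \<and> - u' k t + g k t \<in> A t (u k t) (u k t) \<and> w k t \<in> W t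
      \<and> norm (f k t) \<le> m t \<and> norm (w k t) \<le> m t \<and> norm (g k t) \<le> m t \<and> norm (u' k t) \<le> m t"
    unfolding AE_all_countable
  proof
    fix k
    have "AE t in leb b. f k t \<in> F t (x k t) (u k t) \<and> g k t \<in> G t (x k t) (u k t)
      \<and> - u' k t + g k t \<in> A t (u k t) (u k t)" "AE t in leb b. w k t \<in> W t"
      using tr[of k] by (auto simp: trajectory_def)
    then show "AE t in leb b. f k t \<in> F t (x k t) (u k t) \<and> g k t \<in> G t (x k t) (u k t)
      \<and> - u' k t + g k t \<in> A t (u k t) (u k t) \<and> w k t \<in> W t
      \<and> norm (f k t) \<le> m t \<and> norm (w k t) \<le> m t \<and> norm (g k t) \<le> m t \<and> norm (u' k t) \<le> m t"
      using fm[OF tr[of k]] by eventually_elim blast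
  qed
  have wW: "AE t in leb b. wl t \<in> W t"
    using incl qz AE_in_interval
  proof eventually_elim
    case (elim t)
    have "z t \<in> (\<lambda>p. fst (snd p)) -` W t"
    proof (rule tail_hull_limit_mem[OF q elim(2)])
      show "convex ((\<lambda>p :: 'e \<times> 'y \<times> 'h \<times> 'h. fst (snd p)) -` W t)"
        by (rule convex_linear_vimage[OF bounded_linear.linear[OF bl(2)]]) (use W elim(3) in blast)
      show "closed ((\<lambda>p :: 'e \<times> 'y \<times> 'h \<times> 'h. fst (snd p)) -` W t)"
        using W[OF elim(3)] by (intro closed_vimage continuous_intros) auto
      show "\<forall>\<^sub>F k in sequentially. v k t \<in> (\<lambda>p. fst (snd p)) -` W t"
        using elim(1) by (simp add: v_def)
    qed
    then show ?case by (simp add: wl_def)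
  qed
  have limk: "(\<lambda>k. c * (norm (x k t - xl t) + norm (u k t - ul t))) \<longlonglongrightarrow> 0" if t: "t \<in> {0..b}" for c t
  proof -
    have "(\<lambda>k. c * (norm (x k t - xl t) + norm (u k t - ul t)))
        \<longlonglongrightarrow> c * (norm (xl t - xl t) + norm (ul t - ul t))"
      by (intro tendsto_intros x[OF t] u[OF t])
    then show ?thesis by simp
  qed
  have fF: "AE t in leb b. fl t \<in> F t (xl t) (ul t)"
    using incl qz Haus_F AE_in_interval
  proof eventually_elim
    case (elim t)
    have "(\<lambda>k. infdist (fst (v k t)) (F t (xl t) (ul t))) \<longlonglongrightarrow> 0"
    proof (rule tendsto_sandwich[OF _ _ tendsto_const limk[OF elim(4), of "kF t"]])
      show "\<forall>\<^sub>F k in sequentially. 0 \<le> infdist (fst (v k t)) (F t (xl t) (ul t))"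
        by (simp add: infdist_nonneg)
      show "\<forall>\<^sub>F k in sequentially. infdist (fst (v k t)) (F t (xl t) (ul t))
          \<le> kF t * (norm (x k t - xl t) + norm (u k t - ul t))"
      proof (intro always_eventually allI)
        fix k
        show "infdist (fst (v k t)) (F t (xl t) (ul t)) \<le> kF t * (norm (x k t - xl t) + norm (u k t - ul t))"
          by (rule Haus_leD[of "F t (x k t) (u k t)"]) (use elim(1,3) in \<open>auto simp: v_def\<close>)
      qed
    qed
    then show ?case
      unfolding fl_def using F[OF elim(4)] by (intro tail_hull_limit_infdist[OF q elim(2) bl(1)]) auto
  qed
  have gG: "AE t in leb b. gl t \<in> G t (xl t) (ul t)"
    using incl qz Haus_G AE_in_interval
  proof eventually_elim
    case (elim t)
    have "(\<lambda>k. infdist (fst (snd (snd (v k t)))) (G t (xl t) (ul t))) \<longlonglongrightarrow> 0"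
    proof (rule tendsto_sandwich[OF _ _ tendsto_const limk[OF elim(4), of "kG t"]])
      show "\<forall>\<^sub>F k in sequentially. 0 \<le> infdist (fst (snd (snd (v k t)))) (G t (xl t) (ul t))"
        by (simp add: infdist_nonneg)
      show "\<forall>\<^sub>F k in sequentially. infdist (fst (snd (snd (v k t)))) (G t (xl t) (ul t))
          \<le> kG t * (norm (x k t - xl t) + norm (u k t - ul t))"
      proof (intro always_eventually allI)
        fix k
        show "infdist (fst (snd (snd (v k t)))) (G t (xl t) (ul t)) \<le> kG t * (norm (x k t - xl t) + norm (u k t - ul t))"
          by (rule Haus_leD[of "G t (x k t) (u k t)"]) (use elim(1,3) in \<open>auto simp: v_def\<close>)
      qed
    qed
    then show ?case
      unfolding gl_def using G[OF elim(4)] by (intro tail_hull_limit_infdist[OF q elim(2) bl(3)]) auto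
  qed
  \<comment> \<open>Maximality reduces the inclusion to a test against each pair
    (\<open>z\<^sub>0\<close>, \<open>y\<^sub>0\<close>) in the graph of \<open>A t (ul t)\<close>.
    For a fixed pair the test is a half-space condition on the velocity, hence stable under
    averaging.\<close>
  have uA: "AE t in leb b. - ul' t + gl t \<in> A t (ul t) (ul t)"
    using incl qz AE_in_interval
  proof eventually_elim
    case (elim t)
    show ?case
    proof (rule maximal_monotone_memI[OF mm[OF elim(3)]])
      fix y\<^sub>0 z\<^sub>0 assume y\<^sub>0: "y\<^sub>0 \<in> A t (ul t) z\<^sub>0"
      define P where "P p = - snd (snd (snd p)) + fst (snd (snd p))" for p :: "'e \<times> 'y \<times> 'h \<times> 'h"
      have P: "bounded_linear P" unfolding P_def by (rule bounded_linear_add[OF bounded_linear_minus[OF bl(4)] bl(3)])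
      have eq: "(p - y\<^sub>0) \<bullet> (ul t - z\<^sub>0) = (ul t - z\<^sub>0) \<bullet> p - (ul t - z\<^sub>0) \<bullet> y\<^sub>0" for p
        by (metis inner_commute inner_diff_right)
      \<comment> \<open>Two errors of equal size: the pseudo-distance between
        \<open>A t (u k t)\<close> and \<open>A t (ul t)\<close>, whose \<theta> term vanishes at
        equal times, and the replacement of \<open>u k t\<close> by \<open>ul t\<close> in the
        test.\<close>
      define S where "S k = 2 * (1 + (m t + m t) + norm y\<^sub>0) * norm (u k t - ul t)" for k
      have S: "(P (v k t) - y\<^sub>0) \<bullet> (ul t - z\<^sub>0) \<ge> - S k" for k
      proof -
        define Y where "Y = P (v k t)"
        have Yk: "Y \<in> A t (u k t) (u k t)" using elim(1) by (simp add: Y_def P_def v_def)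
        have "norm Y \<le> norm (u' k t) + norm (g k t)"
          unfolding Y_def P_def v_def using norm_triangle_ineq[of "- u' k t" "g k t"] by simp
        then have nY: "norm Y \<le> m t + m t" using elim(1) by (smt (verit))
        have "(Y - y\<^sub>0) \<bullet> (z\<^sub>0 - u k t) \<le> (1 + norm Y + norm y\<^sub>0) * (\<bar>\<theta> t - \<theta> t\<bar> + lam * norm (u k t - ul t))"
          by (rule dis_leD[OF dis_A[OF elim(3) elim(3)] Yk y\<^sub>0])
        also have "\<dots> \<le> (1 + (m t + m t) + norm y\<^sub>0) * norm (u k t - ul t)"
          using nY lam m(2)[of t] by (intro mult_mono) (auto simp: mult_left_le_one_le)
        finally have 1: "(Y - y\<^sub>0) \<bullet> (z\<^sub>0 - u k t) \<le> (1 + (m t + m t) + norm y\<^sub>0) * norm (u k t - ul t)" .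
        have "(Y - y\<^sub>0) \<bullet> (u k t - ul t) \<le> norm (Y - y\<^sub>0) * norm (u k t - ul t)"
          by (rule norm_cauchy_schwarz)
        also have "\<dots> \<le> (1 + (m t + m t) + norm y\<^sub>0) * norm (u k t - ul t)"
          using nY norm_triangle_ineq4[of Y y\<^sub>0] by (intro mult_right_mono) auto
        finally have 2: "(Y - y\<^sub>0) \<bullet> (u k t - ul t) \<le> (1 + (m t + m t) + norm y\<^sub>0) * norm (u k t - ul t)" .
        have "(Y - y\<^sub>0) \<bullet> (ul t - z\<^sub>0) = - ((Y - y\<^sub>0) \<bullet> (z\<^sub>0 - u k t)) - (Y - y\<^sub>0) \<bullet> (u k t - ul t)"
          by (simp add: inner_diff_right)
        then show ?thesis using 1 2 unfolding S_def Y_def by linarith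
      qed
      have "(\<lambda>k. 2 * (1 + (m t + m t) + norm y\<^sub>0) * norm (u k t - ul t))
          \<longlonglongrightarrow> 2 * (1 + (m t + m t) + norm y\<^sub>0) * norm (ul t - ul t)"
        by (intro tendsto_intros u[OF elim(3)])
      then have Slim: "S \<longlonglongrightarrow> 0" unfolding S_def by simp
      \<comment> \<open>The defect S k is only asymptotically zero, so the half-space is first
        relaxed by e.\<close>
      have "0 \<le> (P (z t) - y\<^sub>0) \<bullet> (ul t - z\<^sub>0) + e" if e: "e > 0" for e
      proof -
        have "z t \<in> P -` {p. (ul t - z\<^sub>0) \<bullet> p \<ge> (ul t - z\<^sub>0) \<bullet> y\<^sub>0 - e}"
        proof (rule tail_hull_limit_mem[OF q elim(2)])
          show "convex (P -` {p. (ul t - z\<^sub>0) \<bullet> p \<ge> (ul t - z\<^sub>0) \<bullet> y\<^sub>0 - e})"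
            by (rule convex_linear_vimage[OF bounded_linear.linear[OF P] convex_halfspace_ge])
          show "closed (P -` {p. (ul t - z\<^sub>0) \<bullet> p \<ge> (ul t - z\<^sub>0) \<bullet> y\<^sub>0 - e})"
            by (intro closed_vimage closed_halfspace_ge linear_continuous_on[OF P])
          have "\<forall>\<^sub>F k in sequentially. S k < e" using Slim e by (rule order_tendstoD)
          then show "\<forall>\<^sub>F k in sequentially. v k t \<in> P -` {p. (ul t - z\<^sub>0) \<bullet> p \<ge> (ul t - z\<^sub>0) \<bullet> y\<^sub>0 - e}"
          proof eventually_elim
            case (elim k)
            then show ?case using S[of k] unfolding eq by simp
          qed
        qed
        then show ?thesis unfolding eq by simp
      qed
      then have "0 \<le> (P (z t) - y\<^sub>0) \<bullet> (ul t - z\<^sub>0)" by (rule field_le_epsilon)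
      then show "0 \<le> (- ul' t + gl t - y\<^sub>0) \<bullet> (ul t - z\<^sub>0)" by (simp add: P_def ul'_def gl_def)
    qed
  qed
  have x_eq: "xl t = blinfun_apply (T t) x0 + convol (\<lambda>s. fl s + Bop (wl s)) t" if t: "t \<in> {0..b}" for t
  proof -
    \<comment> \<open>The convolution as an integral with a kernel linear in the velocity. Its
      values along the sequence are \<open>x k t\<close> minus the common term from x0, and they
      converge because the states do.\<close>
    define K where "K s p = indicator {0..t} s *\<^sub>R T (t - s) (fst p + Bop (fst (snd p)))"
      for s and p :: "'e \<times> 'y \<times> 'h \<times> 'h"
    have Kc: "(\<integral>s. K s (p s) \<partial>leb b) = convol (\<lambda>s. fst (p s) + Bop (fst (snd (p s)))) t" for p
      unfolding K_def using convol_eq[OF t, of "\<lambda>s. fst (p s) + Bop (fst (snd (p s)))"] by simp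
    have "(\<integral>s. K s (z s) \<partial>leb b) = xl t - blinfun_apply (T t) x0"
    proof (rule tail_hull_limit_integral[OF q qz z vm vb m4i])
      show "linear (K s)" for s
        unfolding K_def by (intro bounded_linear.linear bounded_linear_intros)
      show "norm (K s y) \<le> (M * (1 + norm Bop)) * norm y" for s y
      proof -
        have "norm (K s y) \<le> M * norm (fst y + Bop (fst (snd y)))"
          unfolding K_def by (rule norm_indicator_T_le[OF t])
        moreover have "norm (fst y + Bop (fst (snd y))) \<le> (1 + norm Bop) * norm y"
          using norm_triangle_ineq[of "fst y" "Bop (fst (snd y))"] nl(1,2)[of y]
            norm_blinfun[of Bop "fst (snd y)"] mult_left_mono[OF nl(2)[of y], of "norm Bop"]
          by (simp add: distrib_right)
        then have "M * norm (fst y + Bop (fst (snd y))) \<le> M * ((1 + norm Bop) * norm y)"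
          using M_nonneg by (rule mult_left_mono)
        ultimately show ?thesis by (simp add: mult.assoc)
      qed
      show "(\<lambda>s. K s (p s)) \<in> borel_measurable (leb b)" if p: "p \<in> borel_measurable (leb b)" for p
        unfolding K_def
      proof (rule measurable_T_apply[OF _ t])
        have "bounded_linear (\<lambda>p :: 'e \<times> 'y \<times> 'h \<times> 'h. fst p + Bop (fst (snd p)))"
          by (intro bounded_linear_intros)
        then show "(\<lambda>s. fst (p s) + Bop (fst (snd (p s)))) \<in> borel_measurable (leb b)"
          by (intro measurable_compose[OF p borel_measurable_continuous_onI] linear_continuous_on)
      qed
      show "0 \<le> M * (1 + norm Bop)" using M_nonneg by simp
      have "x k t - blinfun_apply (T t) x0 = (\<integral>s. K s (v k s) \<partial>leb b)" for k
      proof -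
        have "x k t = blinfun_apply (T t) x0 + convol (\<lambda>s. f k s + Bop (w k s)) t"
          using tr[of k] t unfolding trajectory_def by blast
        then show ?thesis unfolding Kc by (simp add: v_def)
      qed
      then show "(\<lambda>k. \<integral>s. K s (v k s) \<partial>leb b) \<longlonglongrightarrow> xl t - blinfun_apply (T t) x0"
        using tendsto_diff[OF x[OF t] tendsto_const, of "blinfun_apply (T t) x0"] by simp
    qed
    then show ?thesis unfolding Kc by (simp add: fl_def wl_def algebra_simps)
  qed
  have u_eq: "ul t = u0 + (\<integral>s. ul' s \<partial>lebesgue_on {0..t})" if t: "t \<in> {0..b}" for t
  proof -
    define K where "K s p = indicator {0..t} s *\<^sub>R snd (snd (snd p))" for s and p :: "'e \<times> 'y \<times> 'h \<times> 'h"
    have Kc: "(\<integral>s. K s (p s) \<partial>leb b) = (\<integral>s. snd (snd (snd (p s))) \<partial>lebesgue_on {0..t})" for p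
      unfolding K_def using integral_subinterval_eq[of 0 0 t b "\<lambda>s. snd (snd (snd (p s)))"] t by simp
    have "(\<integral>s. K s (z s) \<partial>leb b) = ul t - u0"
    proof (rule tail_hull_limit_integral[OF q qz z vm vb m4i])
      show "linear (K s)" for s
        unfolding K_def by (intro bounded_linear.linear bounded_linear_intros)
      show "norm (K s y) \<le> 1 * norm y" for s y
        unfolding K_def using nl(4)[of y] by (auto simp: indicator_def)
      show "(\<lambda>s. K s (p s)) \<in> borel_measurable (leb b)" if p: "p \<in> borel_measurable (leb b)" for p
      proof -
        have "(\<lambda>s. snd (snd (snd (p s)))) \<in> borel_measurable (leb b)"
          by (rule measurable_compose[OF p borel_measurable_continuous_onI[OF linear_continuous_on[OF bl(4)]]])
        moreover have "indicator {0..t} \<in> borel_measurable (leb b)"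
          by (intro measurable_restrict_space1 measurable_completion borel_measurable_indicator) simp
        ultimately show ?thesis unfolding K_def by (intro borel_measurable_scaleR)
      qed
      have "u k t - u0 = (\<integral>s. K s (v k s) \<partial>leb b)" for k
      proof -
        have "has_W12_derivative b (u k) (u' k)" "u k 0 = u0" using tr[of k] by (auto simp: trajectory_def)
        then show ?thesis unfolding Kc using has_W12_derivative_diff[of b "u k" "u' k" 0 t] t by (simp add: v_def)
      qed
      then show "(\<lambda>k. \<integral>s. K s (v k s) \<partial>leb b) \<longlonglongrightarrow> ul t - u0"
        using tendsto_diff[OF u[OF t] tendsto_const, of u0] by simp
    qed simp
    then show ?thesis unfolding Kc by (simp add: ul'_def algebra_simps)
  qed
  have u0: "ul 0 = u0"
  proof -
    have "(\<lambda>n. u n 0) \<longlonglongrightarrow> ul 0" using u b by simp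
    moreover have "u n 0 = u0" for n using tr[of n] by (simp add: trajectory_def)
    ultimately show ?thesis by (simp add: LIMSEQ_const_iff)
  qed
  have hi: "integrable (leb b) (\<lambda>s. fl s + Bop (wl s))"
    by (intro Bochner_Integration.integrable_add in_L2_integrable f2
        integrable_bounded_linear[OF blinfun.bounded_linear_right] w2)
  \<comment> \<open>A pointwise limit need not be continuous; continuity is read off from the mild
    formula for the limit.\<close>
  have xc: "continuous_on {0..b} xl"
  proof -
    have "continuous_on {0..b} (\<lambda>t. blinfun_apply (T t) x0 + convol (\<lambda>s. fl s + Bop (wl s)) t)"
      by (intro continuous_intros continuous_T continuous_convol[OF hi])
    then show ?thesis by (rule continuous_on_eq) (simp add: x_eq)
  qed
  have "trajectory wl xl ul ul' fl gl"
    unfolding trajectory_def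
  proof (intro conjI)
    show "has_W12_derivative b ul ul'" using u_eq u0 u2 by (simp add: has_W12_derivative_def)
    show "AE t in leb b. fl t \<in> F t (xl t) (ul t) \<and> gl t \<in> G t (xl t) (ul t) \<and> - ul' t + gl t \<in> A t (ul t) (ul t)"
      using fF gG uA by eventually_elim blast
    show "\<forall>t\<in>{0..b}. xl t = blinfun_apply (T t) x0 + convol (\<lambda>s. fl s + Bop (wl s)) t"
      using x_eq by blast
  qed (use w2 wW xc u0 in_L2_integrable f2 g2 in auto)
  moreover have "control_cost b wl \<le> \<rho>" if \<rho>: "(\<lambda>n. control_cost b (w n)) \<longlonglongrightarrow> \<rho>" for \<rho>
  proof -
    have "(\<lambda>k. 2 * control_cost b (w k)) \<longlonglongrightarrow> 2 * \<rho>" by (intro tendsto_intros \<rho>)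
    then have "(\<lambda>k. \<integral>s. (norm (fst (snd (v k s))))\<^sup>2 \<partial>leb b) \<longlonglongrightarrow> 2 * \<rho>"
      by (simp add: control_cost_def v_def)
    from tail_hull_limit_square_integral[OF q qz z vm vb m4sq bl(2) nl(2) this]
    show ?thesis by (simp add: control_cost_def wl_def)
  qed
  ultimately show ?thesis by blast
qed

end

subsection \<open>Convergence of the cost\<close>

lemma running_cost_tendsto:
  fixes l :: "real \<Rightarrow> 'e::metric_space \<Rightarrow> 'h::metric_space \<Rightarrow> real"
  assumes meas: "\<And>x u. (\<lambda>t. l t x u) \<in> borel_measurable (leb b)"
    and cont: "AE t in leb b. continuous_on UNIV (\<lambda>p. l t (fst p) (snd p))"
    and x: "\<And>n. continuous_on {0..b} (x n)" "continuous_on {0..b} xl"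
      "\<And>t. t \<in> {0..b} \<Longrightarrow> (\<lambda>n. x n t) \<longlonglongrightarrow> xl t"
    and u: "\<And>n. continuous_on {0..b} (u n)" "continuous_on {0..b} ul"
      "\<And>t. t \<in> {0..b} \<Longrightarrow> (\<lambda>n. u n t) \<longlonglongrightarrow> ul t"
    and bound: "\<And>n. AE t in leb b. \<bar>l t (x n t) (u n t)\<bar> \<le> \<beta> t" and \<beta>: "integrable (leb b) \<beta>"
  shows "(\<lambda>n. \<integral>t. l t (x n t) (u n t) \<partial>leb b) \<longlonglongrightarrow> (\<integral>t. l t (xl t) (ul t) \<partial>leb b)"
proof (rule integral_dominated_convergence[OF _ _ \<beta>])
  have comp: "(\<lambda>t. l t (y t) (v t)) \<in> borel_measurable (leb b)"
    if "continuous_on {0..b} y" "continuous_on {0..b} v" for y v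
    using measurable_Caratheodory_compose[of "\<lambda>t p. l t (fst p) (snd p)" b "\<lambda>t. (y t, v t)"] meas cont that
    by (simp add: continuous_on_Pair)
  show "(\<lambda>t. l t (xl t) (ul t)) \<in> borel_measurable (leb b)" by (rule comp[OF x(2) u(2)])
  show "(\<lambda>t. l t (x n t) (u n t)) \<in> borel_measurable (leb b)" for n by (rule comp[OF x(1) u(1)])
  show "AE t in leb b. norm (l t (x n t) (u n t)) \<le> \<beta> t" for n using bound[of n] by simp
  have "AE t in leb b. t \<in> {0..b}" by (rule AE_I2) simp
  with cont show "AE t in leb b. (\<lambda>n. l t (x n t) (u n t)) \<longlonglongrightarrow> l t (xl t) (ul t)"
  proof eventually_elim
    case (elim t)
    have "(\<lambda>n. (x n t, u n t)) \<longlonglongrightarrow> (xl t, ul t)" by (intro tendsto_Pair x(3) u(3) elim)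
    from continuous_on_tendsto_compose[OF elim(1) this] show ?case by simp
  qed
qed

text \<open>The modulus estimate moves x to 0, where the linear growth in u applies.\<close>

lemma Hl_bound:
  fixes l :: "real \<Rightarrow> 'e::{real_inner, banach, second_countable_topology} \<Rightarrow>
       'h::{real_inner, banach, second_countable_topology} \<Rightarrow> 'l::metric_space \<Rightarrow> 'k::metric_space \<Rightarrow> real"
  assumes "Hl b l" "0 \<le> R"
  obtains \<beta> where "integrable (leb b) \<beta>"
    "AE t in leb b. \<forall>x u. norm x \<le> R \<longrightarrow> norm u \<le> R \<longrightarrow> \<bar>l t x u \<zeta> \<eta>\<bar> \<le> \<beta> t"
proof -
  have "\<exists>\<kappa>. (\<forall>t\<in>{0..b}. \<forall>r\<ge>0. 0 \<le> \<kappa> t r) \<and> Caratheodory b \<kappa> \<and>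
        (AE t in leb b. \<kappa> t 0 = 0) \<and>
        (\<forall>R>0. \<exists>\<beta>. L1_nonneg b \<beta> \<and> (AE t in leb b. \<forall>r\<in>{0..R}. \<kappa> t r \<le> \<beta> t)) \<and>
        (AE t in leb b. \<forall>x y u \<zeta> \<eta>.
           \<bar>l t x u \<zeta> \<eta> - l t y u \<zeta> \<eta>\<bar> \<le> (1 + max (norm x) (norm y)) * \<kappa> t (norm (x - y)))"
    using assms(1) unfolding Hl_def by (elim conjE)
  then obtain \<kappa> where \<kappa>: "\<forall>R>0. \<exists>\<beta>. L1_nonneg b \<beta> \<and> (AE t in leb b. \<forall>r\<in>{0..R}. \<kappa> t r \<le> \<beta> t)"
    "AE t in leb b. \<forall>x y u \<zeta> \<eta>. \<bar>l t x u \<zeta> \<eta> - l t y u \<zeta> \<eta>\<bar> \<le> (1 + max (norm x) (norm y)) * \<kappa> t (norm (x - y))"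
    by (elim exE conjE) (rule that)
  \<comment> \<open>R may be 0, while the modulus bound is stated for positive radii.\<close>
  obtain \<beta> where \<beta>: "L1_nonneg b \<beta>" "AE t in leb b. \<forall>r\<in>{0..R + 1}. \<kappa> t r \<le> \<beta> t"
    using \<kappa>(1)[rule_format, of "R + 1"] assms(2) by auto
  have "\<forall>D. bounded D \<longrightarrow> (\<exists>\<theta>. L1_nonneg b \<theta> \<and>
        (AE t in leb b. \<forall>u. \<forall>(\<zeta>, \<eta>)\<in>D. \<bar>l t 0 u \<zeta> \<eta>\<bar> \<le> \<theta> t * (1 + norm u)))"
    using assms(1) unfolding Hl_def by (elim conjE)
  moreover have "bounded {(\<zeta>, \<eta>)}" by simp
  ultimately obtain \<theta> where \<theta>: "L1_nonneg b \<theta>" "AE t in leb b. \<forall>u. \<forall>(\<zeta>, \<eta>)\<in>{(\<zeta>, \<eta>)}. \<bar>l t 0 u \<zeta> \<eta>\<bar> \<le> \<theta> t * (1 + norm u)"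
    by meson
  show ?thesis
  proof (rule that)
    show "integrable (leb b) (\<lambda>t. \<theta> t * (1 + R) + (1 + R) * \<beta> t)"
      using \<beta>(1) \<theta>(1) by (auto simp: L1_nonneg_def)
    have "AE t in leb b. t \<in> {0..b}" by (rule AE_I2) simp
    with \<kappa>(2) \<beta>(2) \<theta>(2)
    show "AE t in leb b. \<forall>x u. norm x \<le> R \<longrightarrow> norm u \<le> R \<longrightarrow> \<bar>l t x u \<zeta> \<eta>\<bar> \<le> \<theta> t * (1 + R) + (1 + R) * \<beta> t"
    proof eventually_elim
      case (elim t)
      show ?case
      proof (intro allI impI)
        fix x :: 'e and u :: 'h assume xu: "norm x \<le> R" "norm u \<le> R"
        have nn: "0 \<le> \<theta> t" "0 \<le> \<beta> t" using \<theta>(1) \<beta>(1) elim(4) by (auto simp: L1_nonneg_def)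
        have "\<bar>l t x u \<zeta> \<eta> - l t 0 u \<zeta> \<eta>\<bar> \<le> (1 + max (norm x) (norm (0::'e))) * \<kappa> t (norm (x - 0))"
          using elim(1) by blast
        also have "\<dots> \<le> (1 + norm x) * \<beta> t" using elim(2) xu(1) by (auto intro!: mult_left_mono)
        also have "\<dots> \<le> (1 + R) * \<beta> t" using xu(1) nn by (intro mult_right_mono) auto
        finally have 1: "\<bar>l t x u \<zeta> \<eta> - l t 0 u \<zeta> \<eta>\<bar> \<le> (1 + R) * \<beta> t" .
        have "\<bar>l t 0 u \<zeta> \<eta>\<bar> \<le> \<theta> t * (1 + norm u)" using elim(3) by simp
        also have "\<dots> \<le> \<theta> t * (1 + R)" using xu(2) nn by (intro mult_left_mono) auto
        finally show "\<bar>l t x u \<zeta> \<eta>\<bar> \<le> \<theta> t * (1 + R) + (1 + R) * \<beta> t" using 1 by linarith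
      qed
    qed
  qed
qed

text \<open>All trajectories share the bound R, so \<open>Hl_bound\<close> supplies one dominating
  function; the end cost needs convergence at b only.\<close>

lemma (in control_system) cost_tendsto:
  assumes l: "Hl b l" and \<phi>: "continuous_on UNIV (\<lambda>(x, u, \<zeta>', \<eta>'). \<phi> x u \<zeta>' \<eta>')"
    and tr: "\<And>n. trajectory (w n) (x n) (u n) (u' n) (f n) (g n)" and trl: "trajectory wl xl ul ul' fl gl"
    and x: "\<And>t. t \<in> {0..b} \<Longrightarrow> (\<lambda>n. x n t) \<longlonglongrightarrow> xl t"
    and u: "\<And>t. t \<in> {0..b} \<Longrightarrow> (\<lambda>n. u n t) \<longlonglongrightarrow> ul t"
  shows "(\<lambda>n. cost b l \<phi> \<zeta> \<eta> (x n) (u n)) \<longlonglongrightarrow> cost b l \<phi> \<zeta> \<eta> xl ul"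
proof -
  obtain R m where R: "\<And>w x u u' f g t. trajectory w x u u' f g \<Longrightarrow> t \<in> {0..b} \<Longrightarrow> norm (x t) \<le> R \<and> norm (u t) \<le> R"
    by (rule trajectory_bounds) (rule that)
  have R0: "0 \<le> R" using R[OF trl, of 0] b order_trans[OF norm_ge_zero] by auto
  obtain \<beta> where \<beta>: "integrable (leb b) \<beta>"
    "AE t in leb b. \<forall>x u. norm x \<le> R \<longrightarrow> norm u \<le> R \<longrightarrow> \<bar>l t x u \<zeta> \<eta>\<bar> \<le> \<beta> t"
    by (rule Hl_bound[OF l R0]) (rule that)
  have c: "continuous_on {0..b} x" "continuous_on {0..b} u" if "trajectory w x u u' f g" for w x u u' f g
    using that has_W12_derivative_continuous[of b u u'] by (auto simp: trajectory_def)
  have "(\<lambda>n. \<integral>t. l t (x n t) (u n t) \<zeta> \<eta> \<partial>leb b) \<longlonglongrightarrow> (\<integral>t. l t (xl t) (ul t) \<zeta> \<eta> \<partial>leb b)"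
  proof (rule running_cost_tendsto[where l = "\<lambda>t x u. l t x u \<zeta> \<eta>", OF _ _ c(1)[OF tr] c(1)[OF trl] x c(2)[OF tr] c(2)[OF trl] u _ \<beta>(1)])
    show "(\<lambda>t. l t x u \<zeta> \<eta>) \<in> borel_measurable (leb b)" for x u using l by (simp add: Hl_def)
    have "AE t in leb b. continuous_on UNIV (\<lambda>(x, u, \<zeta>, \<eta>). l t x u \<zeta> \<eta>)" using l by (simp add: Hl_def)
    then show "AE t in leb b. continuous_on UNIV (\<lambda>p. l t (fst p) (snd p) \<zeta> \<eta>)"
    proof eventually_elim
      case (elim t)
      have "continuous_on UNIV (\<lambda>p. (fst p, snd p, \<zeta>, \<eta>))" by (intro continuous_intros)
      from continuous_on_compose2[OF elim this] show ?case by simp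
    qed
    show "AE t in leb b. \<bar>l t (x n t) (u n t) \<zeta> \<eta>\<bar> \<le> \<beta> t" for n
      using \<beta>(2) AE_in_interval by eventually_elim (use R[OF tr] in blast)
  qed
  moreover have "(\<lambda>n. \<phi> (x n b) (u n b) \<zeta> \<eta>) \<longlonglongrightarrow> \<phi> (xl b) (ul b) \<zeta> \<eta>"
  proof -
    have "(\<lambda>n. (x n b, u n b, \<zeta>, \<eta>)) \<longlonglongrightarrow> (xl b, ul b, \<zeta>, \<eta>)"
      by (intro tendsto_Pair tendsto_const x u) (use b in auto)
    from continuous_on_tendsto_compose[OF \<phi> this] show ?thesis by simp
  qed
  ultimately show ?thesis unfolding cost_def by (rule tendsto_add)
qed

section \<open>Existence of an optimal control\<close>

theorem theorem5p1:
  fixes b :: real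
    and domA :: "'l::metric_space \<Rightarrow> 'e::{real_inner, banach, second_countable_topology} set"
    and A :: "'l \<Rightarrow> 'e \<Rightarrow> 'e"
    and T :: "'l \<Rightarrow> real \<Rightarrow> 'e \<Rightarrow>\<^sub>L 'e"
    and B :: "real \<Rightarrow> 'h::{real_inner, banach, second_countable_topology} \<Rightarrow> 'k::metric_space
                \<Rightarrow> 'h \<Rightarrow> 'h set"
    and F :: "real \<Rightarrow> 'e \<Rightarrow> 'h \<Rightarrow> 'l \<Rightarrow> 'e set"
    and G :: "real \<Rightarrow> 'e \<Rightarrow> 'h \<Rightarrow> 'k \<Rightarrow> 'h set"
    and W :: "real \<Rightarrow> 'y::{real_inner, banach, second_countable_topology} set"
    and Bop :: "'y \<Rightarrow>\<^sub>L 'e"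
    and x0 :: "'l \<Rightarrow> 'e"
    and u0 :: "'k \<Rightarrow> 'h"
    and l :: "real \<Rightarrow> 'e \<Rightarrow> 'h \<Rightarrow> 'l \<Rightarrow> 'k \<Rightarrow> real"
    and \<phi> :: "'e \<Rightarrow> 'h \<Rightarrow> 'l \<Rightarrow> 'k \<Rightarrow> real"
    and \<zeta> :: 'l
    and \<eta> :: 'k
  assumes "b > 0"
    and "\<And>\<zeta>'. linear_operator_on (domA \<zeta>') (A \<zeta>')"
    and "\<And>t u \<eta>'. t \<in> {0..b} \<Longrightarrow> maximal_monotone (B t u \<eta>')"
    and "\<And>\<eta>'. u0 \<eta>' \<in> op_dom (B 0 (u0 \<eta>') \<eta>')"
    and "HA b domA A T"
    and "HB b B"
    and "HF b F"
    and "HG b G"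
    and "HW b W"
    and "Hl b l"
    and "continuous_on UNIV (\<lambda>(x, u, \<zeta>', \<eta>'). \<phi> x u \<zeta>' \<eta>')"
  shows "\<exists>w_opt \<in> admissible_controls b W.
    min_cost b T B F G Bop x0 u0 l \<phi> \<zeta> \<eta> w_opt + ereal (control_cost b w_opt) =
      (INF w \<in> admissible_controls b W.
        min_cost b T B F G Bop x0 u0 l \<phi> \<zeta> \<eta> w + ereal (control_cost b w))"
proof -
  \<comment> \<open>The hypotheses give constants for bounded sets of parameters; here the
    parameters are fixed, so singletons are inserted.\<close>
  have bdd: "bounded {\<zeta>}" "bounded {\<eta>}" by simp_all
  have "\<forall>D. bounded D \<longrightarrow> (\<exists>M>0. \<forall>\<zeta>\<in>D. \<forall>t\<in>{0..b}. norm (T \<zeta> t) \<le> M)"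
    using assms(5) unfolding HA_def by (elim conjE)
  from this[THEN spec, THEN mp, OF bdd(1)]
  obtain M where M: "\<And>t. t \<in> {0..b} \<Longrightarrow> norm (T \<zeta> t) \<le> M" by blast
  have "\<forall>\<zeta>. generates (domA \<zeta>) (A \<zeta>) (T \<zeta>) \<and> (\<forall>t>0. compact_operator (T \<zeta> t))"
    using assms(5) unfolding HA_def by (elim conjE)
  then have T: "C0_semigroup (T \<zeta>)" "\<And>t. t > 0 \<Longrightarrow> compact_operator (T \<zeta> t)"
    by (simp_all add: generates_def)
  have "\<exists>\<theta> lam lam'. in_W12 b \<theta> \<and> 0 \<le> lam \<and> lam < 1 \<and> 0 < lam' \<and>
      (\<forall>t\<in>{0..b}. \<forall>s\<in>{0..b}. \<forall>u v \<eta>1 \<eta>2. dis (B t u \<eta>1) (B s v \<eta>2)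
        \<le> ereal (\<bar>\<theta> t - \<theta> s\<bar> + lam * norm (u - v) + lam' * dist \<eta>1 \<eta>2))"
    using assms(6) unfolding HB_def by (elim conjE)
  then obtain \<theta> lam lam' where lam: "0 \<le> lam" "lam < 1" and "in_W12 b \<theta>"
    and dis: "\<And>t s u v \<eta>1 \<eta>2. t \<in> {0..b} \<Longrightarrow> s \<in> {0..b} \<Longrightarrow> dis (B t u \<eta>1) (B s v \<eta>2)
        \<le> ereal (\<bar>\<theta> t - \<theta> s\<bar> + lam * norm (u - v) + lam' * dist \<eta>1 \<eta>2)" by blast
  then obtain \<theta>' where \<theta>: "has_W12_derivative b \<theta> \<theta>'" by (auto simp: in_W12_def)
  have "\<exists>M>0. \<forall>t\<in>{0..b}. \<forall>u \<eta>. \<forall>v\<in>op_dom (B t u \<eta>).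
      norm (minimal_section (B t u \<eta>) v) \<le> M * (1 + norm u + norm v)"
    using assms(6) unfolding HB_def by (elim conjE)
  then obtain MB where MB: "MB > 0" "\<And>t u \<eta> v. t \<in> {0..b} \<Longrightarrow> v \<in> op_dom (B t u \<eta>) \<Longrightarrow>
      norm (minimal_section (B t u \<eta>) v) \<le> MB * (1 + norm u + norm v)" by blast
  have "\<forall>\<Omega>. bounded \<Omega> \<longrightarrow> ball_relatively_compact (\<Union>t\<in>{0..b}. \<Union>(u, \<eta>)\<in>\<Omega>. op_dom (B t u \<eta>))"
    using assms(6) unfolding HB_def by (elim conjE)
  note this[THEN spec, THEN mp, OF bounded_Times[OF bounded_cball bdd(2)]]
  then have dom: "ball_relatively_compact (\<Union>t\<in>{0..b}. \<Union>(u, \<eta>)\<in>cball 0 R \<times> {\<eta>}. op_dom (B t u \<eta>))" for R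
    by blast
  have "\<forall>D. bounded D \<longrightarrow> (\<exists>k. L1_nonneg b k \<and> (AE t in leb b. \<forall>x u y v. \<forall>\<zeta>\<in>D.
      Haus (F t x u \<zeta>) (F t y v \<zeta>) \<le> ereal (k t * (norm (x - y) + norm (u - v)))))"
    using assms(7) unfolding HF_def by (elim conjE)
  from this[THEN spec, THEN mp, OF bdd(1)]
  obtain kF where kF: "AE t in leb b. \<forall>x u y v. \<forall>\<zeta>\<in>{\<zeta>}.
      Haus (F t x u \<zeta>) (F t y v \<zeta>) \<le> ereal (kF t * (norm (x - y) + norm (u - v)))"
    by (elim exE conjE) (rule that)
  have "\<forall>D. bounded D \<longrightarrow> (\<exists>M>0. AE t in leb b. \<forall>x u. \<forall>\<zeta>\<in>D.
      set_norm (F t x u \<zeta>) \<le> ereal (M * (1 + norm x + norm u)))"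
    using assms(7) unfolding HF_def by (elim conjE)
  from this[THEN spec, THEN mp, OF bdd(1)]
  obtain MF where MF: "MF > 0" "AE t in leb b. \<forall>x u. \<forall>\<zeta>\<in>{\<zeta>}.
      set_norm (F t x u \<zeta>) \<le> ereal (MF * (1 + norm x + norm u))"
    by (elim exE conjE) (rule that)
  have "\<forall>D. bounded D \<longrightarrow> (\<exists>k. L1_nonneg b k \<and> (AE t in leb b. \<forall>x u y v. \<forall>\<eta>\<in>D.
      Haus (G t x u \<eta>) (G t y v \<eta>) \<le> ereal (k t * (norm (x - y) + norm (u - v)))))"
    using assms(8) unfolding HG_def by (elim conjE)
  from this[THEN spec, THEN mp, OF bdd(2)]
  obtain kG where kG: "AE t in leb b. \<forall>x u y v. \<forall>\<eta>\<in>{\<eta>}.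
      Haus (G t x u \<eta>) (G t y v \<eta>) \<le> ereal (kG t * (norm (x - y) + norm (u - v)))"
    by (elim exE conjE) (rule that)
  have "\<forall>D. bounded D \<longrightarrow> (\<exists>M>0. AE t in leb b. \<forall>x u. \<forall>\<eta>\<in>D.
      set_norm (G t x u \<eta>) \<le> ereal (M * (1 + norm x + norm u)))"
    using assms(8) unfolding HG_def by (elim conjE)
  from this[THEN spec, THEN mp, OF bdd(2)]
  obtain MG where MG: "MG > 0" "AE t in leb b. \<forall>x u. \<forall>\<eta>\<in>{\<eta>}.
      set_norm (G t x u \<eta>) \<le> ereal (MG * (1 + norm x + norm u))"
    by (elim exE conjE) (rule that)
  have "\<exists>\<phi> :: real \<Rightarrow> real. in_L2 b \<phi> \<and> (\<forall>t\<in>{0..b}. 0 \<le> \<phi> t) \<and> (AE t in leb b. set_norm (W t) \<le> ereal (\<phi> t))"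
    using assms(9) unfolding HW_def by (elim conjE)
  then obtain \<phi>W where \<phi>W: "in_L2 b \<phi>W" "AE t in leb b. set_norm (W t) \<le> ereal (\<phi>W t)"
    by blast
  have F0: "\<forall>t\<in>{0..b}. \<forall>x u \<zeta>. F t x u \<zeta> \<noteq> {} \<and> compactin weak_topology (F t x u \<zeta>) \<and> convex (F t x u \<zeta>)"
    using assms(7) unfolding HF_def by (elim conjE)
  have G0: "\<forall>t\<in>{0..b}. \<forall>x u \<eta>. G t x u \<eta> \<noteq> {} \<and> compactin weak_topology (G t x u \<eta>) \<and> convex (G t x u \<eta>)"
    using assms(8) unfolding HG_def by (elim conjE)
  have W0: "\<forall>t\<in>{0..b}. W t \<noteq> {} \<and> closed (W t) \<and> convex (W t)"
    using assms(9) unfolding HW_def by (elim conjE)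
  interpret control_system "T \<zeta>" b M "\<lambda>t u. B t u \<eta>" "\<lambda>t x u. F t x u \<zeta>" "\<lambda>t x u. G t x u \<eta>" W Bop
    "x0 \<zeta>" "u0 \<eta>" \<theta> \<theta>' lam MB MF MG \<phi>W kF kG
  proof
    show "dis (B t u \<eta>) (B s v \<eta>) \<le> ereal (\<bar>\<theta> t - \<theta> s\<bar> + lam * norm (u - v))"
      if "t \<in> {0..b}" "s \<in> {0..b}" for t s u v using dis[OF that, of u \<eta> v \<eta>] by simp
    show "ball_relatively_compact (\<Union>t\<in>{0..b}. \<Union>u\<in>cball 0 R. op_dom (B t u \<eta>))" for R
    proof -
      have "(\<Union>t\<in>{0..b}. \<Union>u\<in>cball 0 R. op_dom (B t u \<eta>))
          = (\<Union>t\<in>{0..b}. \<Union>(u, \<eta>)\<in>cball 0 R \<times> {\<eta>}. op_dom (B t u \<eta>))" by auto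
      then show ?thesis using dom[of R] by (simp only:)
    qed
    show "F t x u \<zeta> \<noteq> {} \<and> closed (F t x u \<zeta>) \<and> convex (F t x u \<zeta>)" if "t \<in> {0..b}" for t x u
      using F0 that weakly_compact_imp_closed by blast
    show "G t x u \<eta> \<noteq> {} \<and> closed (G t x u \<eta>) \<and> convex (G t x u \<eta>)" if "t \<in> {0..b}" for t x u
      using G0 that weakly_compact_imp_closed by blast
    show "closed (W t) \<and> convex (W t)" if "t \<in> {0..b}" for t
      using W0 that by blast
    show "AE t in leb b. \<forall>x u. \<forall>f\<in>F t x u \<zeta>. norm f \<le> MF * (1 + norm x + norm u)"
      using MF(2) by eventually_elim (use set_norm_leD in blast)
    show "AE t in leb b. \<forall>x u. \<forall>f\<in>G t x u \<eta>. norm f \<le> MG * (1 + norm x + norm u)"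
      using MG(2) by eventually_elim (use set_norm_leD in blast)
    show "AE t in leb b. \<forall>w\<in>W t. norm w \<le> \<phi>W t"
      using \<phi>W(2) by eventually_elim (use set_norm_leD in blast)
    show "AE t in leb b. \<forall>x u y v. Haus (F t x u \<zeta>) (F t y v \<zeta>) \<le> ereal (kF t * (norm (x - y) + norm (u - v)))"
      using kF by simp
    show "AE t in leb b. \<forall>x u y v. Haus (G t x u \<eta>) (G t y v \<eta>) \<le> ereal (kG t * (norm (x - y) + norm (u - v)))"
      using kG by simp
  qed (use assms(1,3) M T lam \<theta> MB MF(1) MG(1) \<phi>W in auto)
  let ?S = "mild_solutions b T B F G Bop x0 u0 \<zeta> \<eta>"
  let ?m = "min_cost b T B F G Bop x0 u0 l \<phi> \<zeta> \<eta>"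
  let ?J = "cost b l \<phi> \<zeta> \<eta>"
  define I where "I = (INF w \<in> admissible_controls b W. ?m w + ereal (control_cost b w))"
  have sol_iff: "w \<in> admissible_controls b W \<and> (x, u) \<in> ?S w \<longleftrightarrow> (\<exists>u' f g. trajectory w x u u' f g)" for w x u
    unfolding admissible_controls_def mild_solutions_def trajectory_def convol_def by blast
  have m_le: "?m w \<le> ereal (?J x u)" if "(x, u) \<in> ?S w" for w x u
    unfolding min_cost_def by (rule INF_lower2[OF that]) simp
  have I_le: "I \<le> ?m w + ereal (control_cost b w)" if "w \<in> admissible_controls b W" for w
    unfolding I_def by (rule INF_lower[OF that])
  show ?thesis
  proof (cases "I = \<infinity>")
    case True
    obtain w where w: "w \<in> admissible_controls b W" using admissible_controls_nonempty[OF assms(9)] by blast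
    have "?m w + ereal (control_cost b w) = I" using I_le[OF w] True by simp
    then show ?thesis using w unfolding I_def by blast
  next
    case False
    \<comment> \<open>I may still be -\<infinity> at this point, so strict upper bounds
      \<open>c n\<close> decreasing to I take the place of I + 1/n.\<close>
    then have "I < \<infinity>" by simp
    then obtain c where c: "\<And>n::nat. I < c n" "c \<longlonglongrightarrow> I"
      using approx_from_above_dense_linorder[of I \<infinity>] by blast
    have "\<exists>w x u u' f g. trajectory w x u u' f g \<and> ereal (?J x u + control_cost b w) < c n" for n
    proof -
      obtain w where w: "w \<in> admissible_controls b W" "?m w + ereal (control_cost b w) < c n"
        using c(1)[of n] unfolding I_def INF_less_iff by blast
      \<comment> \<open>The control cost is finite and may be moved across in the extended reals;
        the inner infimum then yields a single state.\<close>
      then have "?m w < c n - ereal (control_cost b w)"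
        by (simp add: ereal_less_minus)
      then obtain x u where xu: "(x, u) \<in> ?S w" "ereal (?J x u) < c n - ereal (control_cost b w)"
        unfolding min_cost_def INF_less_iff by auto
      then have "ereal (?J x u + control_cost b w) < c n" by (simp add: ereal_less_minus)
      then show ?thesis using sol_iff w(1) xu(1) by blast
    qed
    then obtain w x u u' f g where tr: "\<And>n. trajectory (w n) (x n) (u n) (u' n) (f n) (g n)"
      and less: "\<And>n. ereal (?J (x n) (u n) + control_cost b (w n)) < c n" by metis
    have ge: "I \<le> ereal (?J (x n) (u n) + control_cost b (w n))" for n
    proof -
      have *: "w n \<in> admissible_controls b W" "(x n, u n) \<in> ?S (w n)" using sol_iff tr by blast+
      have "I \<le> ?m (w n) + ereal (control_cost b (w n))" by (rule I_le[OF *(1)])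
      also have "\<dots> \<le> ereal (?J (x n) (u n)) + ereal (control_cost b (w n))"
        by (rule add_right_mono[OF m_le[OF *(2)]])
      finally show ?thesis by simp
    qed
    obtain r xl ul where r: "strict_mono (r :: nat \<Rightarrow> nat)"
      and xl: "\<And>t. t \<in> {0..b} \<Longrightarrow> (\<lambda>n. x (r n) t) \<longlonglongrightarrow> xl t"
      and ul: "\<And>t. t \<in> {0..b} \<Longrightarrow> (\<lambda>n. u (r n) t) \<longlonglongrightarrow> ul t"
      by (rule trajectory_compactness[OF tr]) (rule that)
    obtain wl ul' fl gl where trl: "trajectory wl xl ul ul' fl gl"
      and wl: "\<And>\<rho>. (\<lambda>n. control_cost b (w (r n))) \<longlonglongrightarrow> \<rho> \<Longrightarrow> control_cost b wl \<le> \<rho>"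
      using trajectory_closed[of "\<lambda>n. w (r n)" "\<lambda>n. x (r n)" "\<lambda>n. u (r n)" "\<lambda>n. u' (r n)"
          "\<lambda>n. f (r n)" "\<lambda>n. g (r n)", OF tr xl ul] by blast
    have J: "(\<lambda>n. ?J (x (r n)) (u (r n))) \<longlonglongrightarrow> ?J xl ul"
      by (rule cost_tendsto[OF assms(10,11) tr trl xl ul])
    have V: "(\<lambda>n. ereal (?J (x (r n)) (u (r n)) + control_cost b (w (r n)))) \<longlonglongrightarrow> I"
    proof (rule tendsto_sandwich[where f = "\<lambda>_. I" and h = "\<lambda>n. c (r n)"])
      show "(\<lambda>n. c (r n)) \<longlonglongrightarrow> I" using LIMSEQ_subseq_LIMSEQ[OF c(2) r] by (simp add: o_def)
    qed (use ge less in \<open>auto intro!: always_eventually less_imp_le\<close>)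
    \<comment> \<open>Control costs are non-negative, so the limit of the state costs bounds I from
      below; this excludes -\<infinity>.\<close>
    have "ereal (?J xl ul) \<le> I"
    proof (rule LIMSEQ_le[OF _ V])
      show "(\<lambda>n. ereal (?J (x (r n)) (u (r n)))) \<longlonglongrightarrow> ereal (?J xl ul)" using J by simp
      show "\<exists>N. \<forall>n\<ge>N. ereal (?J (x (r n)) (u (r n))) \<le> ereal (?J (x (r n)) (u (r n)) + control_cost b (w (r n)))"
        by (simp add: control_cost_def)
    qed
    then obtain i where i: "I = ereal i" using False by (cases I) auto
    have "(\<lambda>n. ?J (x (r n)) (u (r n)) + control_cost b (w (r n))) \<longlonglongrightarrow> i" using V unfolding i by simp
    \<comment> \<open>Convergence of the total and of the state costs forces convergence of the
      control costs, which is what \<open>wl\<close> asks for.\<close>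
    from tendsto_diff[OF this J] have "(\<lambda>n. control_cost b (w (r n))) \<longlonglongrightarrow> i - ?J xl ul" by simp
    then have le: "control_cost b wl \<le> i - ?J xl ul" by (rule wl)
    have adm: "wl \<in> admissible_controls b W" "(xl, ul) \<in> ?S wl" using sol_iff trl by blast+
    have "?m wl + ereal (control_cost b wl) \<le> ereal (?J xl ul) + ereal (control_cost b wl)"
      by (rule add_right_mono[OF m_le[OF adm(2)]])
    also have "\<dots> \<le> I" using le by (simp add: i)
    finally have "?m wl + ereal (control_cost b wl) = I" using I_le[OF adm(1)] by (rule antisym)
    then show ?thesis using adm(1) unfolding I_def by blast
  qed
qed

end
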